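(* Let $\{Y_i,\ i=0,1,2,\ldots\}$ be random variables with the same marginal distribution, with ${\rm E}Y_0=\mu>0$ and ${\rm E}(Y_0^2)<\infty$, and let $\{W(t),\,t\ge 0\}$ be a standard Wiener process defined on the same probability space such that, for some constants $\sigma>0$ and $\beta<1/4$, $$\sup_{0\le t\le T}|S(t)-\mu t-\sigma W(t)|=O_{\rm a.s.}(T^\beta)\quad\text{as }T\to\infty .$$ Then the following four statements hold. (1) As $T\to\infty$, $$Q(T)=\sigma\left(W(T)-W\left(T-\frac{\sigma}{\mu}W(T)\right)\right)+o_{\rm a.s.}(T^{1/4}).$$ (2) $$\limsup_{T\to\infty}\frac{\sup_{0\le t\le T}|Q(t/\mu)|}{(T\log\log T)^{1/4}(\log T)^{1/2}}=\frac{2^{1/4}\sigma^{3/2}}{\mu^{3/4}}\quad\text{a.s.}$$ (3) $$\lim_{T\to\infty}\frac{\sup_{0\le t\le T}|Q(t/\mu)|}{(\log T)^{1/2}\left(\sup_{0\le t\le T}|\mu N(t)-t|\right)^{1/2}}=\frac{\sigma}{\mu^{1/2}}\quad\text{a.s.}$$ (4) For every $y\ge 0$, $$\lim_{T\to\infty}{\rm P}\left(T^{-1/4}|Q(T/\mu)|\le y\right)=2\int_{-\infty}^\infty \Phi\left(y\mu^{3/4}\sigma^{-3/2}|x|^{-1/2}\right)\varphi(x)\,dx-1 .$$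
   Context: For $t\ge 0$ (with $[t]$ the integer part of $t$) define $$S(t)=\sum_{i=1}^{[t]}Y_i,\qquad N(t)=\inf\{s\ge 1:\ S(s)>t\},\qquad Q(t)=S(t)+\mu N(\mu t)-2\mu t .$$ $\Phi$ and $\varphi$ are the standard normal distribution function and density. $O_{\rm a.s.}(\cdot)$ and $o_{\rm a.s.}(\cdot)$ mean that the corresponding $O$, $o$ relation holds almost surely as $T\to\infty$. The argument $T-\frac{\sigma}{\mu}W(T)$ is almost surely positive for all large $T$; for definiteness set $W(s)=0$ for $s<0$. *)

theory Defs
  imports "HOL-Probability.Probability" "HOL-Library.Landau_Symbols"
begin

definition partial_sum :: "(nat \<Rightarrow> 'a \<Rightarrow> real) \<Rightarrow> real \<Rightarrow> 'a \<Rightarrow> real" where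
  "partial_sum Y t \<omega> = (\<Sum>i = 1..nat \<lfloor>t\<rfloor>. Y i \<omega>)"

(* Real-valued, so the infimum of the empty set is an unspecified real. Under the hypotheses
   of the theorem, almost surely the set is nonempty for every t. *)
definition first_passage :: "(nat \<Rightarrow> 'a \<Rightarrow> real) \<Rightarrow> real \<Rightarrow> 'a \<Rightarrow> real" where
  "first_passage Y t \<omega> = Inf {s. 1 \<le> s \<and> partial_sum Y s \<omega> > t}"

definition Q_process :: "(nat \<Rightarrow> 'a \<Rightarrow> real) \<Rightarrow> real \<Rightarrow> real \<Rightarrow> 'a \<Rightarrow> real" where
  "Q_process Y \<mu> t \<omega> = partial_sum Y t \<omega> + \<mu> * first_passage Y (\<mu> * t) \<omega> - 2 * \<mu> * t"

(* The time set is [0, \<infinity>); values of W at negative times are unconstrained. Starting at 0 and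
   continuity of paths are required almost surely. *)
definition wiener_process :: "'a measure \<Rightarrow> (real \<Rightarrow> 'a \<Rightarrow> real) \<Rightarrow> bool" where
  "wiener_process M W \<longleftrightarrow>
     prob_space M \<and>
     (\<forall>t\<ge>0. W t \<in> borel_measurable M) \<and>
     (AE \<omega> in M. W 0 \<omega> = 0) \<and>
     (\<forall>(n::nat) (t::nat \<Rightarrow> real). 0 \<le> t 0 \<and> mono_on {..n} t \<longrightarrow>
        prob_space.indep_vars M (\<lambda>_. borel) (\<lambda>i \<omega>. W (t (Suc i)) \<omega> - W (t i) \<omega>) {..<n}) \<and>
     (\<forall>s t. 0 \<le> s \<and> s < t \<longrightarrow>
        distributed M lborel (\<lambda>\<omega>. W t \<omega> - W s \<omega>) (normal_density 0 (sqrt (t - s)))) \<and>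
     (AE \<omega> in M. continuous_on {0..} (\<lambda>t. W t \<omega>))"

definition zero_ext :: "(real \<Rightarrow> 'a \<Rightarrow> real) \<Rightarrow> real \<Rightarrow> 'a \<Rightarrow> real" where
  "zero_ext W s \<omega> = (if s < 0 then 0 else W s \<omega>)"

definition std_normal_cdf :: "real \<Rightarrow> real" where
  "std_normal_cdf = cdf (density lborel std_normal_density)"

end

theory Submission
  imports Defs "HOL-Real_Asymp.Real_Asymp"
begin

text \<open>
  Along almost every path the overshoot of \<open>S\<close> at a first passage is negligible, so
  \<open>\<mu> N(\<mu> T) - \<mu> T = - \<sigma> W(N(\<mu> T)) + O(T\<^sup>b)\<close> with \<open>b < 1/4\<close>, and \<open>Q(T)\<close> is, up to the same error,
  \<open>\<sigma>\<close> times the increment of \<open>W\<close> between \<open>N(\<mu> T)\<close> and \<open>T\<close>. Replacing \<open>N(\<mu> T)\<close> by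
  \<open>T - (\<sigma>/\<mu>) W(T)\<close> moves the time by about \<open>T\<close> to the power \<open>1/4\<close>, hence \<open>W\<close> by about the square root of that.

  With \<open>m = max |W|\<close> on \<open>[0, U]\<close> and \<open>a = \<sigma>/\<mu>\<close>, the maximum of \<open>|W(u) - W(u - a W(u))|\<close> is
  asymptotic to \<open>sqrt (a m ln U)\<close>. The upper bound is the modulus of continuity at lags \<open>h\<close> of order \<open>sqrt U\<close>,
  where \<open>2 ln (U/h)\<close> is asymptotic to \<open>ln U\<close>. For the lower bound, the dependence between lag and increment is
  defeated by uniformity: the probability that some interval of length slightly below \<open>U\<close> contains no nearly
  maximal increment for some integer lag is smaller than any power of \<open>U\<close>, so almost surely there is one for
  all intervals and all lags simultaneously; apply this next to the maximiser of \<open>|W|\<close>, where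
  the lag \<open>a W(u)\<close> is nearly constant. The limsup then follows from the law of the iterated logarithm.

  For the limit law, the lag is computed from \<open>W\<close> at a slightly earlier time and rounded to a grid. It is
  then independent of the increment, which is Gaussian given the lag.
\<close>

section \<open>Gaussian tails and maximal inequalities\<close>

text \<open>Probability only supplies almost sure path properties and one Gaussian integral; the
  rest is analysis of a fixed path, in the locales \<open>renewal_path\<close>,
  \<open>kiefer_path\<close> and \<open>kiefer_family\<close>. Two obstacles shape this. A property
  with a free parameter \<delta> has an exceptional null set depending on \<delta>, so \<delta> runs
  through a sequence and disappears only in the limits of ratios. And the running maximum of the
  absolute path must be bounded below at all large times, whereas the lower half of the law of the
  iterated logarithm speaks only of some; large increments over long lags supply the bound instead.

  The exponents come from one rule: a time shift of order T to the \<gamma> moves the path by at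
  most any power above \<gamma>/2. From the trivial shift of order T this gives 1, 9/16, 5/16, 3/16,
  and the last is below 1/4. The constant in the oscillation result is that of a maximum of about
  sqrt U independent Gaussians, one for each disjoint interval of length sqrt U.\<close>

lemma (in prob_space) normal_tail_le:
  assumes D: "distributed M lborel X (normal_density 0 s)" and s: "0 < s" and x: "0 \<le> x"
  shows "prob {\<omega>\<in>space M. x \<le> X \<omega>} \<le> exp (- x\<^sup>2 / (2 * s\<^sup>2))"
proof -
  let ?c = "exp (- x\<^sup>2 / (2 * s\<^sup>2))"
  \<comment> \<open>Beyond x the square \<open>t\<^sup>2\<close> dominates
    \<open>x\<^sup>2 + (t - x)\<^sup>2\<close>, so the density lies below \<open>?c\<close> times
    the normal density centred at x. The latter has mass 1, which gives the sharp exponent without a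
    prefactor.\<close>
  have le: "normal_density 0 s t \<le> ?c * normal_density x s t" if "x \<le> t" for t
  proof -
    have "x\<^sup>2 + (t - x)\<^sup>2 \<le> t\<^sup>2"
      using mult_left_mono[OF that x] by (simp add: power2_eq_square algebra_simps)
    then have "- t\<^sup>2 / (2 * s\<^sup>2) \<le> - x\<^sup>2 / (2 * s\<^sup>2) + - (t - x)\<^sup>2 / (2 * s\<^sup>2)"
      unfolding add_divide_distrib[symmetric] by (intro divide_right_mono) auto
    then have "exp (- t\<^sup>2 / (2 * s\<^sup>2)) \<le> ?c * exp (- (t - x)\<^sup>2 / (2 * s\<^sup>2))"
      unfolding exp_add[symmetric] by simp
    then show ?thesis
      unfolding normal_density_def using divide_right_mono[of _ _ "sqrt (2 * pi * s\<^sup>2)"] by simp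
  qed
  have "emeasure M (X -` {x..} \<inter> space M) = (\<integral>\<^sup>+t. ennreal (normal_density 0 s t) * indicator {x..} t \<partial>lborel)"
    by (rule distributed_emeasure[OF D]) simp
  also have "\<dots> \<le> (\<integral>\<^sup>+t. ennreal ?c * ennreal (normal_density x s t) \<partial>lborel)"
    using le by (intro nn_integral_mono) (auto simp: indicator_def ennreal_mult[symmetric] ennreal_leI)
  also have "\<dots> = ennreal ?c * (\<integral>\<^sup>+t. ennreal (normal_density x s t) \<partial>lborel)"
    by (rule nn_integral_cmult) simp
  also have "(\<integral>\<^sup>+t. ennreal (normal_density x s t) \<partial>lborel) = 1"
    using s by (subst nn_integral_eq_integral) (auto simp: integrable_normal_density)
  finally have "emeasure M (X -` {x..} \<inter> space M) \<le> ennreal ?c" by simp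
  moreover have "X -` {x..} \<inter> space M = {\<omega>\<in>space M. x \<le> X \<omega>}" by auto
  ultimately show ?thesis by (simp add: emeasure_eq_measure)
qed

lemma (in prob_space) normal_uminus:
  assumes "distributed M lborel X (normal_density 0 s)" and "0 < s"
  shows "distributed M lborel (\<lambda>\<omega>. - X \<omega>) (normal_density 0 s)"
  using normal_density_affine[OF assms, of "-1" 0] by simp

text \<open>Only the part of the tail between \<open>s * x\<close> and \<open>s * (x + 1)\<close> is
  kept: its length s cancels the factor 1/s of the density, which is smallest at the right end. The
  3 bounds sqrt (2 pi); having \<open>x + 1\<close> in place of x costs only a lower-order term in
  the exponent.\<close>

lemma (in prob_space) normal_tail_ge:
  assumes D: "distributed M lborel X (normal_density 0 s)" and s: "0 < s" and x: "0 \<le> x"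
  shows "exp (- (x + 1)\<^sup>2 / 2) / 3 \<le> prob {\<omega>\<in>space M. s * x \<le> X \<omega>}"
proof -
  let ?c = "exp (- (x + 1)\<^sup>2 / 2) / (3 * s)"
  have le: "?c \<le> normal_density 0 s t" if t: "s * x \<le> t" "t \<le> s * (x + 1)" for t
  proof -
    have t0: "0 \<le> t" using t(1) s x by (meson order_trans less_imp_le mult_nonneg_nonneg)
    have "t\<^sup>2 \<le> (s * (x + 1))\<^sup>2" using t t0 by (intro power_mono) auto
    then have "t\<^sup>2 / (2 * s\<^sup>2) \<le> (s * (x + 1))\<^sup>2 / (2 * s\<^sup>2)" by (intro divide_right_mono) auto
    also have "\<dots> = (x + 1)\<^sup>2 / 2" using s by (simp add: power_mult_distrib)
    finally have e: "exp (- (x + 1)\<^sup>2 / 2) \<le> exp (- t\<^sup>2 / (2 * s\<^sup>2))" by simp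
    have "sqrt (2 * pi) \<le> sqrt (3\<^sup>2)" using pi_less_4 by (intro real_sqrt_le_mono) simp
    then have "sqrt (2 * pi * s\<^sup>2) \<le> 3 * s" using s by (simp add: real_sqrt_mult)
    then have "1 / (3 * s) \<le> 1 / sqrt (2 * pi * s\<^sup>2)" using s by (intro divide_left_mono) auto
    then have "1 / (3 * s) * exp (- (x + 1)\<^sup>2 / 2) \<le> 1 / sqrt (2 * pi * s\<^sup>2) * exp (- t\<^sup>2 / (2 * s\<^sup>2))"
      using e s by (intro mult_mono) auto
    then show ?thesis by (simp add: normal_density_def)
  qed
  have "ennreal (exp (- (x + 1)\<^sup>2 / 2) / 3) = (\<integral>\<^sup>+t. ennreal ?c * indicator {s * x..s * (x + 1)} t \<partial>lborel)"
    using s by (subst nn_integral_cmult_indicator) (auto simp: ennreal_mult[symmetric] algebra_simps)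
  also have "\<dots> \<le> (\<integral>\<^sup>+t. ennreal (normal_density 0 s t) * indicator {s * x..} t \<partial>lborel)"
    using le by (intro nn_integral_mono) (auto simp: indicator_def ennreal_leI)
  also have "\<dots> = emeasure M (X -` {s * x..} \<inter> space M)"
    by (rule distributed_emeasure[OF D, symmetric]) simp
  also have "X -` {s * x..} \<inter> space M = {\<omega>\<in>space M. s * x \<le> X \<omega>}" by auto
  finally show ?thesis by (simp add: emeasure_eq_measure)
qed

lemma (in prob_space) normal_nonneg_ge_half:
  assumes D: "distributed M lborel X (normal_density 0 s)" and s: "0 < s"
  shows "1 / 2 \<le> prob {\<omega>\<in>space M. 0 \<le> X \<omega>}"
proof -
  have [measurable]: "X \<in> borel_measurable M" using distributed_measurable[OF D] by simp
  have "measure (distr M lborel X) {0..} = measure (distr M lborel (\<lambda>\<omega>. - X \<omega>)) {0..}"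
    using distributed_distr_eq_density[OF D] distributed_distr_eq_density[OF normal_uminus[OF D s]]
    by simp
  then have "prob (X -` {0..} \<inter> space M) = prob ((\<lambda>\<omega>. - X \<omega>) -` {0..} \<inter> space M)"
    by (simp add: measure_distr)
  moreover have "X -` {0..} \<inter> space M = {\<omega>\<in>space M. 0 \<le> X \<omega>}"
    "(\<lambda>\<omega>. - X \<omega>) -` {0..} \<inter> space M = {\<omega>\<in>space M. X \<omega> \<le> 0}" by auto
  ultimately have eq: "prob {\<omega>\<in>space M. 0 \<le> X \<omega>} = prob {\<omega>\<in>space M. X \<omega> \<le> 0}" by simp
  have "1 = prob ({\<omega>\<in>space M. 0 \<le> X \<omega>} \<union> {\<omega>\<in>space M. X \<omega> \<le> 0})"
    by (subst prob_space[symmetric]) (rule arg_cong[where f=prob], auto)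
  also have "\<dots> \<le> prob {\<omega>\<in>space M. 0 \<le> X \<omega>} + prob {\<omega>\<in>space M. X \<omega> \<le> 0}"
    by (rule measure_Un_le) auto
  finally show ?thesis using eq by simp
qed

text \<open>Levy's inequality. Split according to the first index at which the partial sum reaches
  x; the remaining sum is independent of that event and nonnegative with probability at least 1/2,
  and then the total is still at least x.\<close>

lemma (in prob_space) levy_maximal:
  fixes X :: "nat \<Rightarrow> 'a \<Rightarrow> real"
  assumes ind: "indep_vars (\<lambda>_. borel) X {..<n}"
    and half: "\<And>k. k \<le> n \<Longrightarrow> 1 / 2 \<le> prob {\<omega>\<in>space M. 0 \<le> (\<Sum>i\<in>{k..<n}. X i \<omega>)}"
  shows "prob {\<omega>\<in>space M. \<exists>k\<le>n. x \<le> (\<Sum>i<k. X i \<omega>)} \<le> 2 * prob {\<omega>\<in>space M. x \<le> (\<Sum>i<n. X i \<omega>)}"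
proof -
  have [measurable]: "X i \<in> borel_measurable M" if "i < n" for i
    using ind that by (auto simp: indep_vars_def)
  have [measurable]: "(\<lambda>\<omega>. \<Sum>i\<in>I. X i \<omega>) \<in> borel_measurable M" if "I \<subseteq> {..<n}" for I
    using that by (intro borel_measurable_sum) auto
  define S where "S k \<omega> = (\<Sum>i<k. X i \<omega>)" for k \<omega>
  have Sm[measurable]: "S k \<in> borel_measurable M" if "k \<le> n" for k
    unfolding S_def[abs_def] using that by (intro borel_measurable_sum) auto
  define A where "A k = {\<omega>\<in>space M. x \<le> S k \<omega> \<and> (\<forall>j<k. S j \<omega> < x)}" for k
  define B where "B k = {\<omega>\<in>space M. 0 \<le> (\<Sum>i\<in>{k..<n}. X i \<omega>)}" for k
  have Am: "A k \<in> events" if "k \<le> n" for k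
  proof -
    have "A k = {\<omega>\<in>space M. x \<le> S k \<omega>} \<inter> (\<Inter>j\<in>{..<k}. {\<omega>\<in>space M. S j \<omega> < x}) \<inter> space M"
      by (auto simp: A_def)
    moreover have "{\<omega>\<in>space M. S j \<omega> < x} \<in> events" if "j < k" for j
      using that \<open>k \<le> n\<close> by (intro borel_measurable_less Sm borel_measurable_const) auto
    moreover have "{\<omega>\<in>space M. x \<le> S k \<omega>} \<in> events"
      using that by (intro borel_measurable_le Sm borel_measurable_const) auto
    ultimately show ?thesis
      by (cases "k = 0") (auto intro!: sets.Int sets.finite_INT)
  qed
  have Bm: "B k \<in> events" for k
    unfolding B_def by (intro borel_measurable_le borel_measurable_sum borel_measurable_const) auto
  \<comment> \<open>\<open>A k\<close> depends on the summands before k only, \<open>B k\<close> on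
    those from k on. Both are preimages under the restrictions of the family to these two disjoint
    index blocks, and the restrictions are independent.\<close>
  have prod: "prob (A k \<inter> B k) = prob (A k) * prob (B k)" if k: "k \<le> n" for k
  proof -
    let ?P = "\<lambda>I. PiM I (\<lambda>_. borel :: real measure)"
    define R where "R I \<omega> = restrict (\<lambda>i. X i \<omega>) I" for I \<omega>
    have iv: "indep_var (?P {..<k}) (R {..<k}) (?P {k..<n}) (R {k..<n})"
      unfolding R_def[abs_def] by (rule indep_var_restrict[OF ind]) (use k in auto)
    define A' where "A' = {f\<in>space (?P {..<k}). x \<le> (\<Sum>i<k. f i) \<and> (\<forall>j<k. (\<Sum>i<j. f i) < x)}"
    define B' where "B' = {f\<in>space (?P {k..<n}). 0 \<le> (\<Sum>i\<in>{k..<n}. f i)}"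
    have sm: "(\<lambda>f. \<Sum>i\<in>J. f i) \<in> borel_measurable (?P I)" if "J \<subseteq> I" for I J :: "nat set"
      using that by (intro borel_measurable_sum measurable_component_singleton) auto
    have A'm: "A' \<in> sets (?P {..<k})"
    proof -
      have "A' = {f\<in>space (?P {..<k}). x \<le> (\<Sum>i<k. f i)} \<inter>
          (\<Inter>j\<in>{..<k}. {f\<in>space (?P {..<k}). (\<Sum>i<j. f i) < x}) \<inter> space (?P {..<k})"
        by (auto simp: A'_def)
      moreover have "{f\<in>space (?P {..<k}). (\<Sum>i<j. f i) < x} \<in> sets (?P {..<k})" if "j < k" for j
        using that by (intro borel_measurable_less sm borel_measurable_const) auto
      moreover have "{f\<in>space (?P {..<k}). x \<le> (\<Sum>i<k. f i)} \<in> sets (?P {..<k})"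
        by (intro borel_measurable_le sm borel_measurable_const) auto
      ultimately show ?thesis
        by (cases "k = 0") (auto intro!: sets.Int sets.finite_INT)
    qed
    have B'm: "B' \<in> sets (?P {k..<n})"
      unfolding B'_def by (intro borel_measurable_le sm borel_measurable_const) auto
    have RA: "R {..<k} -` A' \<inter> space M = A k"
    proof -
      have "(\<Sum>i<j. R {..<k} \<omega> i) = S j \<omega>" if "j \<le> k" for j \<omega>
        unfolding R_def S_def using that by (intro sum.cong) auto
      moreover have "R {..<k} \<omega> \<in> space (?P {..<k})" for \<omega> by (auto simp: R_def space_PiM)
      ultimately show ?thesis by (auto simp: A'_def A_def)
    qed
    have RB: "R {k..<n} -` B' \<inter> space M = B k"
    proof -
      have "(\<Sum>i\<in>{k..<n}. R {k..<n} \<omega> i) = (\<Sum>i\<in>{k..<n}. X i \<omega>)" for \<omega>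
        unfolding R_def by (intro sum.cong) auto
      moreover have "R {k..<n} \<omega> \<in> space (?P {k..<n})" for \<omega> by (auto simp: R_def space_PiM)
      ultimately show ?thesis by (auto simp: B'_def B_def)
    qed
    have eq: "(\<lambda>\<omega>. (R {..<k} \<omega>, R {k..<n} \<omega>)) -` (A' \<times> B') \<inter> space M
       = (R {..<k} -` A' \<inter> space M) \<inter> (R {k..<n} -` B' \<inter> space M)" by auto
    show ?thesis using indep_varD[OF iv A'm B'm] unfolding eq RA RB .
  qed
  have disj: "disjoint_family_on A {..n}"
    unfolding disjoint_family_on_def
  proof (intro ballI impI)
    have *: "A i \<inter> A j = {}" if "i < j" for i j using that by (fastforce simp: A_def)
    fix i j :: nat assume "i \<noteq> j"
    then consider "i < j" | "j < i" by linarith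
    then show "A i \<inter> A j = {}" by cases (blast dest: *)+
  qed
  have disj': "disjoint_family_on (\<lambda>k. A k \<inter> B k) {..n}"
    unfolding disjoint_family_on_def
  proof (intro ballI impI)
    fix i j :: nat assume "i \<in> {..n}" "j \<in> {..n}" "i \<noteq> j"
    then have "A i \<inter> A j = {}" using disj by (simp add: disjoint_family_on_def)
    then show "A i \<inter> B i \<inter> (A j \<inter> B j) = {}" by blast
  qed
  have un: "{\<omega>\<in>space M. \<exists>k\<le>n. x \<le> S k \<omega>} = (\<Union>k\<in>{..n}. A k)"
  proof -
    have "\<exists>k\<le>n. \<omega> \<in> A k" if "\<omega> \<in> space M" "k \<le> n" "x \<le> S k \<omega>" for k \<omega>
    proof -
      define m where "m = (LEAST k. x \<le> S k \<omega>)"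
      have m: "x \<le> S m \<omega>" "m \<le> k"
        unfolding m_def by (rule LeastI[of _ k], fact that, rule Least_le, fact that)
      have "S j \<omega> < x" if "j < m" for j
        using not_less_Least[OF that[unfolded m_def]] by simp
      then have "\<omega> \<in> A m" using m that unfolding A_def by blast
      then show ?thesis using m that by (intro exI[of _ m]) auto
    qed
    note first = this
    show ?thesis
    proof (intro equalityI subsetI)
      fix \<omega> assume "\<omega> \<in> {\<omega>\<in>space M. \<exists>k\<le>n. x \<le> S k \<omega>}"
      then obtain k where "\<omega> \<in> space M" "k \<le> n" "x \<le> S k \<omega>" by blast
      from first[OF this] show "\<omega> \<in> (\<Union>k\<in>{..n}. A k)" by blast
    next
      fix \<omega> assume "\<omega> \<in> (\<Union>k\<in>{..n}. A k)"
      then obtain k where "k \<le> n" "\<omega> \<in> A k" by blast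
      then show "\<omega> \<in> {\<omega>\<in>space M. \<exists>k\<le>n. x \<le> S k \<omega>}" unfolding A_def by blast
    qed
  qed
  have "prob {\<omega>\<in>space M. \<exists>k\<le>n. x \<le> S k \<omega>} = (\<Sum>k\<le>n. prob (A k))"
    unfolding un using Am disj by (intro finite_measure_finite_Union) auto
  also have "\<dots> \<le> (\<Sum>k\<le>n. 2 * prob (A k \<inter> B k))"
  proof (rule sum_mono)
    fix k assume "k \<in> {..n}"
    then have "1 / 2 \<le> prob (B k)" using half by (simp add: B_def)
    then have "prob (A k) * (1 / 2) \<le> prob (A k) * prob (B k)" by (intro mult_left_mono) auto
    then show "prob (A k) \<le> 2 * prob (A k \<inter> B k)" using prod[of k] \<open>k \<in> _\<close> by simp
  qed
  also have "\<dots> = 2 * prob (\<Union>k\<in>{..n}. A k \<inter> B k)"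
    using Am Bm disj' by (subst finite_measure_finite_Union) (auto simp: sum_distrib_left)
  also have "\<dots> \<le> 2 * prob {\<omega>\<in>space M. x \<le> S n \<omega>}"
  proof -
    have "S n \<omega> = S k \<omega> + (\<Sum>i\<in>{k..<n}. X i \<omega>)" if "k \<le> n" for k \<omega>
      unfolding S_def using that by (metis atLeast0LessThan sum.atLeastLessThan_concat zero_le)
    then have "(\<Union>k\<in>{..n}. A k \<inter> B k) \<subseteq> {\<omega>\<in>space M. x \<le> S n \<omega>}"
      by (fastforce simp: A_def B_def)
    then show ?thesis by (intro mult_left_mono finite_measure_mono) auto
  qed
  finally show ?thesis by (simp add: S_def)
qed

section \<open>The Wiener process and its maximal inequality over intervals\<close>

locale wiener = prob_space M for M :: "'a measure" +
  fixes W :: "real \<Rightarrow> 'a \<Rightarrow> real"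
  assumes wiener_process: "wiener_process M W"
begin

lemma measurable_W: "0 \<le> t \<Longrightarrow> W t \<in> borel_measurable M"
  using wiener_process by (simp add: wiener_process_def)

lemma W_0: "AE \<omega> in M. W 0 \<omega> = 0"
  using wiener_process by (simp add: wiener_process_def)

lemma W_continuous: "AE \<omega> in M. continuous_on {0..} (\<lambda>t. W t \<omega>)"
  using wiener_process by (simp add: wiener_process_def)

lemma indep_increments:
  "0 \<le> t 0 \<Longrightarrow> mono_on {..n} t \<Longrightarrow>
    indep_vars (\<lambda>_. borel) (\<lambda>i \<omega>. W (t (Suc i)) \<omega> - W (t i) \<omega>) {..<n}"
  using wiener_process unfolding wiener_process_def by blast

lemma increment_normal:
  "0 \<le> s \<Longrightarrow> s < t \<Longrightarrow>
    distributed M lborel (\<lambda>\<omega>. W t \<omega> - W s \<omega>) (normal_density 0 (sqrt (t - s)))"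
  using wiener_process unfolding wiener_process_def by blast

text \<open>The sign c lets the one-sided maximal inequality be applied to W and to its negative,
  which together bound the absolute value.\<close>

lemma increment_normal_signed:
  assumes "0 \<le> s" "s < t" "c \<in> {1, -1}"
  shows "distributed M lborel (\<lambda>\<omega>. c * (W t \<omega> - W s \<omega>)) (normal_density 0 (sqrt (t - s)))"
  using increment_normal[OF assms(1,2)] normal_uminus[OF increment_normal[OF assms(1,2)]] assms
  by auto

lemma grid_maximal:
  assumes s: "0 \<le> s" and h: "0 < h" and x: "0 \<le> x" and n: "0 < n" and c: "c \<in> {1, -1}"
  shows "prob {\<omega>\<in>space M. \<exists>k\<le>n. x \<le> c * (W (s + h * real k / real n) \<omega> - W s \<omega>)}
    \<le> 2 * exp (- x\<^sup>2 / (2 * h))"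
proof -
  define t where "t k = s + h * real k / real n" for k
  define X where "X i \<omega> = c * (W (t (Suc i)) \<omega> - W (t i) \<omega>)" for i \<omega>
  have t0: "t 0 = s" "t n = s + h" using n by (auto simp: t_def)
  have tmono: "strict_mono t" using h n
    by (auto simp: t_def strict_mono_def intro!: divide_strict_right_mono mult_strict_left_mono)
  have tge: "0 \<le> t k" for k using s h n by (auto simp: t_def)
  have "mono_on {..n} t" using tmono by (simp add: mono_on_def strict_mono_less_eq)
  then have iv: "indep_vars (\<lambda>_. borel) (\<lambda>i \<omega>. W (t (Suc i)) \<omega> - W (t i) \<omega>) {..<n}"
    using tge by (intro indep_increments)
  have ind: "indep_vars (\<lambda>_. borel) X {..<n}"
    unfolding X_def[abs_def] by (rule indep_vars_compose2[OF iv]) simp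
  have sum1: "(\<Sum>i\<in>{k..<m}. X i \<omega>) = c * (W (t m) \<omega> - W (t k) \<omega>)" if "k \<le> m" for k m \<omega>
    unfolding X_def sum_distrib_left[symmetric] using sum_Suc_diff'[OF that, of "\<lambda>i. W (t i) \<omega>"] by simp
  have sum0: "(\<Sum>i<k. X i \<omega>) = c * (W (t k) \<omega> - W s \<omega>)" for k \<omega>
    using sum1[of 0 k \<omega>] by (simp add: t0 atLeast0LessThan)
  have half: "1 / 2 \<le> prob {\<omega>\<in>space M. 0 \<le> (\<Sum>i\<in>{k..<n}. X i \<omega>)}" if "k \<le> n" for k
  proof (cases "k = n")
    case True
    then show ?thesis by (simp add: prob_space)
  next
    case False
    then have "t k < t n" using that tmono by (simp add: strict_mono_less)
    then show ?thesis
      using normal_nonneg_ge_half[OF increment_normal_signed[OF tge _ c, of k "t n"]] that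
      by (simp add: sum1)
  qed
  have "prob {\<omega>\<in>space M. \<exists>k\<le>n. x \<le> (\<Sum>i<k. X i \<omega>)} \<le> 2 * prob {\<omega>\<in>space M. x \<le> (\<Sum>i<n. X i \<omega>)}"
    by (rule levy_maximal[OF ind half])
  also have "prob {\<omega>\<in>space M. x \<le> (\<Sum>i<n. X i \<omega>)} \<le> exp (- x\<^sup>2 / (2 * h))"
    using normal_tail_le[OF increment_normal_signed[OF s _ c, of "s + h"] _ x] h
    by (simp add: sum0 t0)
  finally show ?thesis by (simp add: sum0 t_def)
qed

text \<open>Dyadic times make this a countable union, hence an event regardless of path regularity;
  continuity holds only almost surely and enters in \<open>not_exceed\<close>.\<close>

definition exceed :: "real \<Rightarrow> real \<Rightarrow> real \<Rightarrow> 'a set" where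
  "exceed s h x = {\<omega>\<in>space M. \<exists>k. \<exists>i\<le>2 ^ k. x < \<bar>W (s + h * real i / 2 ^ k) \<omega> - W s \<omega>\<bar>}"

lemma exceed_events: "0 \<le> s \<Longrightarrow> 0 \<le> h \<Longrightarrow> exceed s h x \<in> events"
proof -
  assume s: "0 \<le> s" "0 \<le> h"
  have "{\<omega>\<in>space M. x < \<bar>W (s + h * real i / 2 ^ k) \<omega> - W s \<omega>\<bar>} \<in> events" for i k :: nat
    using s by (intro borel_measurable_less borel_measurable_abs borel_measurable_diff measurable_W
        borel_measurable_const) auto
  moreover have "exceed s h x = (\<Union>k. \<Union>i\<in>{..2 ^ k}. {\<omega>\<in>space M. x < \<bar>W (s + h * real i / 2 ^ k) \<omega> - W s \<omega>\<bar>})"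
    by (auto simp: exceed_def)
  ultimately show ?thesis by (auto intro!: sets.countable_UN sets.finite_UN)
qed

text \<open>The 4 is Levy's factor 2 for each of the two signs. The bound on each dyadic grid does
  not depend on the grid, and since the grids are nested it passes to the limit by continuity from
  below.\<close>

lemma exceed_prob:
  assumes s: "0 \<le> s" and h: "0 < h" and x: "0 \<le> x"
  shows "prob (exceed s h x) \<le> 4 * exp (- x\<^sup>2 / (2 * h))"
proof -
  define A where "A k = {\<omega>\<in>space M. \<exists>i\<le>2 ^ k. x < \<bar>W (s + h * real i / 2 ^ k) \<omega> - W s \<omega>\<bar>}" for k :: nat
  define B where "B c k = {\<omega>\<in>space M. \<exists>i\<le>2 ^ k. x \<le> c * (W (s + h * real i / real (2 ^ k)) \<omega> - W s \<omega>)}"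
    for c and k :: nat
  have "{\<omega>\<in>space M. x < \<bar>W (s + h * real i / 2 ^ k) \<omega> - W s \<omega>\<bar>} \<in> events" for i k :: nat
    using s h by (intro borel_measurable_less borel_measurable_abs borel_measurable_diff measurable_W
        borel_measurable_const) auto
  moreover have "A k = (\<Union>i\<in>{..2 ^ k}. {\<omega>\<in>space M. x < \<bar>W (s + h * real i / 2 ^ k) \<omega> - W s \<omega>\<bar>})" for k
    by (auto simp: A_def)
  ultimately have Am: "A k \<in> events" for k by auto
  have Bm: "B c k \<in> events" for c k
  proof -
    have "{\<omega>\<in>space M. x \<le> c * (W (s + h * real i / real (2 ^ k)) \<omega> - W s \<omega>)} \<in> events" for i
      using s h by (intro borel_measurable_le borel_measurable_times borel_measurable_diff measurable_W
          borel_measurable_const) auto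
    moreover have "B c k = (\<Union>i\<in>{..2 ^ k}. {\<omega>\<in>space M. x \<le> c * (W (s + h * real i / real (2 ^ k)) \<omega> - W s \<omega>)})"
      by (auto simp: B_def)
    ultimately show ?thesis by auto
  qed
  have "incseq A"
  proof (rule incseq_SucI)
    fix k
    have "\<exists>j\<le>2 ^ Suc k. h * real i / 2 ^ k = h * real j / 2 ^ Suc k" if "i \<le> 2 ^ k" for i
      using that by (intro exI[of _ "2 * i"]) auto
    then show "A k \<subseteq> A (Suc k)" unfolding A_def by fastforce
  qed
  moreover have "exceed s h x = (\<Union>k. A k)" by (auto simp: exceed_def A_def)
  ultimately have lim: "(\<lambda>k. prob (A k)) \<longlonglongrightarrow> prob (exceed s h x)"
    using finite_Lim_measure_incseq[of A] Am by auto
  have "prob (A k) \<le> 4 * exp (- x\<^sup>2 / (2 * h))" for k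
  proof -
    have "A k \<subseteq> B 1 k \<union> B (-1) k"
      unfolding A_def B_def by (fastforce simp: abs_if split: if_splits)
    then have "prob (A k) \<le> prob (B 1 k \<union> B (-1) k)" using Bm by (intro finite_measure_mono) auto
    also have "\<dots> \<le> prob (B 1 k) + prob (B (-1) k)" using Bm by (intro measure_Un_le) auto
    also have "prob (B 1 k) \<le> 2 * exp (- x\<^sup>2 / (2 * h))"
      unfolding B_def by (rule grid_maximal[OF s h x]) auto
    also have "prob (B (-1) k) \<le> 2 * exp (- x\<^sup>2 / (2 * h))"
      unfolding B_def by (rule grid_maximal[OF s h x]) auto
    finally show ?thesis by simp
  qed
  then show ?thesis by (intro LIMSEQ_le_const2[OF lim]) auto
qed

text \<open>Rounding the relative position of t down to dyadic grids gives points converging to t,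
  so continuity extends the bound from dyadic times to all times.\<close>

lemma not_exceed:
  assumes cont: "continuous_on {0..} (\<lambda>t. W t \<omega>)" and w: "\<omega> \<in> space M" "\<omega> \<notin> exceed s h x"
    and s: "0 \<le> s" "0 < h" and t: "s \<le> t" "t \<le> s + h"
  shows "\<bar>W t \<omega> - W s \<omega>\<bar> \<le> x"
proof -
  define r where "r = (t - s) / h"
  have r: "0 \<le> r" "r \<le> 1" "t = s + h * r" using s t by (auto simp: r_def)
  define i where "i k = nat \<lfloor>2 ^ k * r\<rfloor>" for k :: nat
  have i: "real (i k) = of_int \<lfloor>2 ^ k * r\<rfloor>" for k using r by (simp add: i_def)
  have ile: "i k \<le> 2 ^ k" for k
  proof -
    have "2 ^ k * r \<le> 2 ^ k" using r by simp
    then have "real (i k) \<le> 2 ^ k" using i[of k] by linarith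
    then show ?thesis by (metis of_nat_le_iff of_nat_numeral of_nat_power)
  qed
  have "(\<lambda>k. real (i k) / 2 ^ k) \<longlonglongrightarrow> r"
  proof (rule tendsto_sandwich)
    show "eventually (\<lambda>k. r - (1 / 2) ^ k \<le> real (i k) / 2 ^ k) sequentially"
    proof (intro always_eventually allI)
      fix k
      have "2 ^ k * r - 1 \<le> real (i k)" using i[of k] by linarith
      then have "(2 ^ k * r - 1) / 2 ^ k \<le> real (i k) / 2 ^ k" by (intro divide_right_mono) auto
      then show "r - (1 / 2) ^ k \<le> real (i k) / 2 ^ k" by (simp add: diff_divide_distrib power_divide)
    qed
    show "eventually (\<lambda>k. real (i k) / 2 ^ k \<le> r) sequentially"
    proof (intro always_eventually allI)
      fix k
      have "real (i k) \<le> 2 ^ k * r" using i[of k] by linarith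
      then have "real (i k) / 2 ^ k \<le> 2 ^ k * r / 2 ^ k" by (intro divide_right_mono) auto
      then show "real (i k) / 2 ^ k \<le> r" by simp
    qed
    have "(\<lambda>k. r - (1 / 2) ^ k) \<longlonglongrightarrow> r - 0"
      by (intro tendsto_intros LIMSEQ_power_zero) auto
    then show "(\<lambda>k. r - (1 / 2) ^ k) \<longlonglongrightarrow> r" by simp
  qed simp
  then have lim: "(\<lambda>k. s + h * (real (i k) / 2 ^ k)) \<longlonglongrightarrow> t"
    unfolding r(3) by (intro tendsto_intros)
  have "(\<lambda>k. W (s + h * (real (i k) / 2 ^ k)) \<omega>) \<longlonglongrightarrow> W t \<omega>"
    using s t by (intro continuous_on_tendsto_compose[OF cont lim]) auto
  then have "(\<lambda>k. \<bar>W (s + h * (real (i k) / 2 ^ k)) \<omega> - W s \<omega>\<bar>) \<longlonglongrightarrow> \<bar>W t \<omega> - W s \<omega>\<bar>"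
    by (intro tendsto_intros)
  moreover have "\<bar>W (s + h * (real (i k) / 2 ^ k)) \<omega> - W s \<omega>\<bar> \<le> x" for k
  proof -
    have "\<not> x < \<bar>W (s + h * real (i k) / 2 ^ k) \<omega> - W s \<omega>\<bar>"
      using w ile[of k] unfolding exceed_def by blast
    then show ?thesis by simp
  qed
  ultimately show ?thesis by (intro LIMSEQ_le_const2) auto
qed

end

section \<open>Modulus of continuity\<close>

text \<open>The window reaches to \<open>2 * U\<close> because the times compared with U, namely
  first passage times and \<open>u - a * w u\<close> at negative \<open>w u\<close>, may lie beyond
  U but eventually not beyond \<open>2 * U\<close>.\<close>

abbreviation osc_le :: "(real \<Rightarrow> real) \<Rightarrow> real \<Rightarrow> real \<Rightarrow> real \<Rightarrow> bool" where
  "osc_le w U h c \<equiv> \<forall>s\<in>{0..2 * U}. \<forall>t\<in>{0..2 * U}. \<bar>s - t\<bar> \<le> h \<longrightarrow> \<bar>w s - w t\<bar> \<le> c"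

context wiener
begin

text \<open>Union bound over starting points on a grid of mesh \<open>\<eta> * h\<close>. From the
  grid point just below s, the later time is at distance at most \<open>(1 + \<eta>) * h\<close>
  (threshold x) and s itself at most one mesh (threshold y).\<close>

lemma modulus_event:
  assumes "0 < U" "0 < h" "0 < \<eta>" "0 \<le> x" "0 \<le> y"
  shows "\<exists>B\<in>events. prob B \<le> (2 * U / (\<eta> * h) + 1) *
      (4 * exp (- x\<^sup>2 / (2 * ((1 + \<eta>) * h))) + 4 * exp (- y\<^sup>2 / (2 * (\<eta> * h)))) \<and>
    (\<forall>\<omega>\<in>space M - B. continuous_on {0..} (\<lambda>t. W t \<omega>) \<longrightarrow>
      osc_le (\<lambda>t. W t \<omega>) U h (x + y))"
proof -
  define d where "d = \<eta> * h"
  have d: "0 < d" using assms by (simp add: d_def)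
  define n where "n = nat \<lfloor>2 * U / d\<rfloor>"
  have n: "real n \<le> 2 * U / d" using assms d by (simp add: n_def)
  define E where "E i = exceed (real i * d) ((1 + \<eta>) * h) x \<union> exceed (real i * d) d y" for i
  define e where "e = 4 * exp (- x\<^sup>2 / (2 * ((1 + \<eta>) * h))) + 4 * exp (- y\<^sup>2 / (2 * d))"
  have Ee: "E i \<in> events" for i
    unfolding E_def using assms d by (intro sets.Un exceed_events) auto
  have Ep: "prob (E i) \<le> e" for i
  proof -
    have "prob (E i) \<le> prob (exceed (real i * d) ((1 + \<eta>) * h) x) + prob (exceed (real i * d) d y)"
      unfolding E_def using assms d by (intro measure_Un_le exceed_events) auto
    also have "\<dots> \<le> e" unfolding e_def using assms d by (intro add_mono exceed_prob) auto
    finally show ?thesis .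
  qed
  define B where "B = (\<Union>i\<le>n. E i)"
  have "prob B \<le> (\<Sum>i\<le>n. prob (E i))"
    unfolding B_def using Ee by (intro finite_measure_subadditive_finite) auto
  also have "\<dots> \<le> (\<Sum>i\<le>n. e)" by (intro sum_mono Ep)
  also have "\<dots> = (real n + 1) * e" by simp
  also have "\<dots> \<le> (2 * U / d + 1) * e" using n by (intro mult_right_mono) (auto simp: e_def)
  finally have P: "prob B \<le> (2 * U / d + 1) * e" .
  have le: "\<bar>W s \<omega> - W t \<omega>\<bar> \<le> x + y"
    if w: "\<omega> \<in> space M - B" "continuous_on {0..} (\<lambda>t. W t \<omega>)"
      and st: "0 \<le> s" "s \<le> t" "t \<le> 2 * U" "t - s \<le> h" for \<omega> s t
  proof -
    define i where "i = nat \<lfloor>s / d\<rfloor>"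
    have i: "real i \<le> s / d" "s / d \<le> real i + 1" using st d by (auto simp: i_def)
    then have id: "real i * d \<le> s" "s \<le> real i * d + d" using d by (auto simp: field_simps)
    have "s / d \<le> 2 * U / d" using st d by (intro divide_right_mono) auto
    then have "i \<le> n" unfolding i_def n_def by (intro nat_mono floor_mono)
    then have "\<omega> \<notin> E i" using w by (auto simp: B_def)
    then have ne: "\<omega> \<notin> exceed (real i * d) ((1 + \<eta>) * h) x" "\<omega> \<notin> exceed (real i * d) d y"
      by (auto simp: E_def)
    have "\<bar>W t \<omega> - W (real i * d) \<omega>\<bar> \<le> x"
      using w d assms st id by (intro not_exceed[OF w(2) _ ne(1)]) (auto simp: d_def algebra_simps)
    moreover have "\<bar>W s \<omega> - W (real i * d) \<omega>\<bar> \<le> y"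
      using w d assms st id by (intro not_exceed[OF w(2) _ ne(2)]) auto
    ultimately show ?thesis by linarith
  qed
  have "\<bar>W s \<omega> - W t \<omega>\<bar> \<le> x + y"
    if w: "\<omega> \<in> space M - B" "continuous_on {0..} (\<lambda>t. W t \<omega>)"
      and st: "s \<in> {0..2 * U}" "t \<in> {0..2 * U}" "\<bar>s - t\<bar> \<le> h" for \<omega> s t
    using le[OF w, of s t] le[OF w, of t s] st by (cases "s \<le> t") auto
  moreover have "B \<in> events" unfolding B_def using Ee by auto
  ultimately show ?thesis
    using P unfolding d_def e_def by (intro bexI[of _ B] conjI) auto
qed

text \<open>Both thresholds of \<open>modulus_event\<close> are tuned so that each exceedance has
  probability of order \<open>V powr (- q)\<close>. The bound \<open>H \<le> 4 * V\<close> absorbs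
  the \<open>+ 1\<close> of the grid count, giving 6 * 8 = 48.\<close>

lemma modulus_level:
  assumes V: "1 \<le> V" and H: "0 < H" "H \<le> 4 * V" and \<eta>: "0 < \<eta>" "\<eta> \<le> 1" and q: "0 \<le> q"
  shows "\<exists>B\<in>events. prob B \<le> 48 / \<eta> * (V / H) * V powr (- q) \<and>
    (\<forall>\<omega>\<in>space M - B. continuous_on {0..} (\<lambda>t. W t \<omega>) \<longrightarrow>
      osc_le (\<lambda>t. W t \<omega>) V H ((sqrt (2 * (1 + \<eta>) * q) + sqrt (2 * \<eta> * q)) * sqrt (H * ln V)))"
proof -
  define x where "x = sqrt (2 * (1 + \<eta>) * q) * sqrt (H * ln V)"
  define y where "y = sqrt (2 * \<eta> * q) * sqrt (H * ln V)"
  have l: "0 \<le> ln V" using V by simp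
  have x2: "x\<^sup>2 = 2 * ((1 + \<eta>) * H) * (q * ln V)"
    unfolding x_def power_mult_distrib using l H \<eta> q by simp
  have y2: "y\<^sup>2 = 2 * (\<eta> * H) * (q * ln V)"
    unfolding y_def power_mult_distrib using l H \<eta> q by simp
  have cancel: "- (2 * a * b) / (2 * a) = - b" if "0 < a" for a b :: real using that by simp
  have "- x\<^sup>2 / (2 * ((1 + \<eta>) * H)) = - q * ln V"
    unfolding x2 using H \<eta> by (subst cancel) auto
  then have ex: "exp (- x\<^sup>2 / (2 * ((1 + \<eta>) * H))) = V powr (- q)"
    using V by (simp only: powr_def) auto
  have "- y\<^sup>2 / (2 * (\<eta> * H)) = - q * ln V" unfolding y2 using H \<eta> by (subst cancel) auto
  then have ey: "exp (- y\<^sup>2 / (2 * (\<eta> * H))) = V powr (- q)"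
    using V by (simp only: powr_def) auto
  have "0 \<le> x" "0 \<le> y" using l H \<eta> q by (auto simp: x_def y_def)
  from modulus_event[OF _ H(1) \<eta>(1) this, of V] V obtain B where B: "B \<in> events"
    "prob B \<le> (2 * V / (\<eta> * H) + 1) * (4 * V powr (- q) + 4 * V powr (- q))"
    "\<forall>\<omega>\<in>space M - B. continuous_on {0..} (\<lambda>t. W t \<omega>) \<longrightarrow>
      osc_le (\<lambda>t. W t \<omega>) V H (x + y)"
    unfolding ex ey by auto
  have "\<eta> * H \<le> 1 * (4 * V)" using H \<eta> by (intro mult_mono) auto
  then have "1 \<le> 4 * V / (\<eta> * H)" using H \<eta> by (simp add: field_simps)
  then have "2 * V / (\<eta> * H) + 1 \<le> 2 * V / (\<eta> * H) + 4 * V / (\<eta> * H)" by linarith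
  also have "\<dots> = 6 * V / (\<eta> * H)" by (simp add: add_divide_distrib[symmetric])
  finally have "2 * V / (\<eta> * H) + 1 \<le> 6 * V / (\<eta> * H)" .
  then have "(2 * V / (\<eta> * H) + 1) * (8 * V powr (- q)) \<le> 6 * V / (\<eta> * H) * (8 * V powr (- q))"
    by (intro mult_right_mono) auto
  then have "prob B \<le> 48 / \<eta> * (V / H) * V powr (- q)" using B(2) by (simp add: field_simps)
  then show ?thesis using B unfolding x_def y_def by (intro bexI[of _ B]) (auto simp: distrib_right)
qed

text \<open>Borel-Cantelli over dyadic levels m, with all lags of a geometric progression treated at
  once. The bad probability at level m and index k is of order
  \<open>(2 powr (1 - \<kappa> - q)) ^ m / (1 + \<eta>) ^ k\<close>, summable in both indices
  because \<open>1 - \<kappa> < q\<close>. The smallest lag is halved so that it stays below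
  \<open>U powr \<kappa>\<close> after U is rounded up to a power of 2.\<close>

lemma modulus_dyadic:
  assumes \<kappa>: "0 \<le> \<kappa>" "\<kappa> \<le> 1" and \<eta>: "0 < \<eta>" "\<eta> \<le> 1" and q: "1 - \<kappa> < q"
  shows "AE \<omega> in M. \<forall>\<^sub>F m in sequentially. \<forall>k. (2 ^ m) powr \<kappa> / 2 * (1 + \<eta>) ^ k \<le> 4 * 2 ^ m \<longrightarrow>
     osc_le (\<lambda>t. W t \<omega>) (2 ^ m) ((2 ^ m) powr \<kappa> / 2 * (1 + \<eta>) ^ k) ((sqrt (2 * (1 + \<eta>) * q) + sqrt (2 * \<eta> * q)) * sqrt ((2 ^ m) powr \<kappa> / 2 * (1 + \<eta>) ^ k * ln (2 ^ m)))"
proof -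
  define H where "H m k = (2 ^ m) powr \<kappa> / 2 * (1 + \<eta>) ^ k" for m k :: nat
  define \<theta> where "\<theta> = 1 / (1 + \<eta>)"
  have th: "0 < \<theta>" "\<theta> < 1" using \<eta> by (auto simp: \<theta>_def field_simps)
  define G where "G m k \<omega> \<longleftrightarrow> osc_le (\<lambda>t. W t \<omega>) (2 ^ m) (H m k) ((sqrt (2 * (1 + \<eta>) * q) + sqrt (2 * \<eta> * q)) * sqrt (H m k * ln (2 ^ m)))" for m k \<omega>
  have Hpos: "0 < H m k" for m k using \<eta> by (auto simp: H_def)
  have "\<exists>B\<in>events. prob B \<le> 96 / \<eta> * (2 powr (1 - \<kappa> - q)) ^ m * \<theta> ^ k \<and>
      (H m k \<le> 4 * 2 ^ m \<longrightarrow> (\<forall>\<omega>\<in>space M - B. continuous_on {0..} (\<lambda>t. W t \<omega>) \<longrightarrow> G m k \<omega>))" for m k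
  proof (cases "H m k \<le> 4 * 2 ^ m")
    case False
    then show ?thesis using th \<eta> by (intro bexI[of _ "{}"]) auto
  next
    case True
    obtain B where B: "B \<in> events" "prob B \<le> 48 / \<eta> * (2 ^ m / H m k) * (2 ^ m) powr (- q)"
      "\<forall>\<omega>\<in>space M - B. continuous_on {0..} (\<lambda>t. W t \<omega>) \<longrightarrow> G m k \<omega>"
      using modulus_level[OF _ Hpos True \<eta>, of q] q \<kappa> unfolding G_def by auto
    have "(2 ^ m) powr 1 * (2 ^ m) powr (- \<kappa>) * (2 ^ m) powr (- q) = (2 ^ m :: real) powr (1 - \<kappa> - q)"
      by (simp only: powr_add[symmetric]) simp
    also have "(2 ^ m :: real) = 2 powr real m" by (simp add: powr_realpow)
    also have "(2 powr real m) powr (1 - \<kappa> - q) = (2 powr (1 - \<kappa> - q)) ^ m"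
      by (simp only: powr_powr) (simp add: powr_power mult.commute)
    finally have pw: "(2 powr (1 - \<kappa> - q)) ^ m = (2 ^ m :: real) powr 1 * (2 ^ m) powr (- \<kappa>) * (2 ^ m) powr (- q)"
      by (simp add: powr_realpow)
    have "48 / \<eta> * (2 ^ m / H m k) * (2 ^ m) powr (- q) =
        96 / \<eta> * (2 powr (1 - \<kappa> - q)) ^ m * \<theta> ^ k"
      unfolding pw by (simp add: H_def \<theta>_def powr_minus field_simps power_one_over)
    with B show ?thesis by (intro bexI[of _ B] conjI impI) (simp_all only:)
  qed
  then obtain B where B: "\<And>m k. B m k \<in> events"
    "\<And>m k. prob (B m k) \<le> 96 / \<eta> * (2 powr (1 - \<kappa> - q)) ^ m * \<theta> ^ k"
    "\<And>m k \<omega>. H m k \<le> 4 * 2 ^ m \<Longrightarrow> \<omega> \<in> space M - B m k \<Longrightarrow>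
        continuous_on {0..} (\<lambda>t. W t \<omega>) \<Longrightarrow> G m k \<omega>"
    by metis
  let ?r = "2 powr (1 - \<kappa> - q) :: real"
  have r: "0 \<le> ?r" "?r < 1" using q powr_less_mono[of "1 - \<kappa> - q" 0 2] by auto
  have sm: "summable (\<lambda>k. 96 / \<eta> * ?r ^ m * \<theta> ^ k)" for m
    using th by (intro summable_mult summable_geometric) auto
  have sB: "summable (\<lambda>k. prob (B m k))" for m
    by (rule summable_comparison_test'[OF sm[of m], of 0]) (use B(2) in auto)
  have le: "prob (\<Union>k. B m k) \<le> 96 / \<eta> * (1 / (1 - \<theta>)) * ?r ^ m" for m
  proof -
    have "prob (\<Union>k. B m k) \<le> (\<Sum>k. prob (B m k))"
      using B(1) sB by (intro finite_measure_subadditive_countably) auto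
    also have "\<dots> \<le> (\<Sum>k. 96 / \<eta> * ?r ^ m * \<theta> ^ k)" by (intro suminf_le B(2) sB sm)
    also have "\<dots> = 96 / \<eta> * ?r ^ m * (1 / (1 - \<theta>))"
      using th by (subst suminf_mult) (auto intro: summable_geometric simp: suminf_geometric)
    finally show ?thesis by (simp add: mult_ac)
  qed
  have "summable (\<lambda>m. 96 / \<eta> * (1 / (1 - \<theta>)) * ?r ^ m)"
    using r by (intro summable_mult summable_geometric) auto
  then have sumM: "summable (\<lambda>m. prob (\<Union>k. B m k))"
    by (rule summable_comparison_test'[of _ 0]) (use le in auto)
  have "AE \<omega> in M. \<forall>\<^sub>F m in sequentially. \<omega> \<in> space M - (\<Union>k. B m k)"
    by (rule borel_cantelli_AE1) (use B(1) sumM in \<open>auto simp: emeasure_eq_measure\<close>)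
  then show ?thesis
    using W_continuous
  proof eventually_elim
    case (elim \<omega>)
    show ?case
      using elim(1)
    proof eventually_elim
      case (elim m)
      show ?case
      proof (intro allI impI)
        fix k assume "(2 ^ m) powr \<kappa> / 2 * (1 + \<eta>) ^ k \<le> 4 * 2 ^ m"
        then show "osc_le (\<lambda>t. W t \<omega>) (2 ^ m) ((2 ^ m) powr \<kappa> / 2 * (1 + \<eta>) ^ k) ((sqrt (2 * (1 + \<eta>) * q) + sqrt (2 * \<eta> * q)) * sqrt ((2 ^ m) powr \<kappa> / 2 * (1 + \<eta>) ^ k * ln (2 ^ m)))"
          using B(3)[of m k \<omega>] elim \<open>continuous_on _ _\<close> unfolding G_def H_def by auto
      qed
    qed
  qed
qed

lemma power_bracket:
  fixes \<theta> :: real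
  assumes "1 < \<theta>" "0 < H" "H \<le> h"
  obtains k where "h \<le> H * \<theta> ^ k" "H * \<theta> ^ k \<le> \<theta> * h"
proof -
  define k where "k = (LEAST k. h \<le> H * \<theta> ^ k)"
  obtain k' where "h / H < \<theta> ^ k'" using real_arch_pow[OF assms(1)] by blast
  then have "h \<le> H * \<theta> ^ k'" using assms by (simp add: field_simps)
  then have 1: "h \<le> H * \<theta> ^ k" unfolding k_def by (rule LeastI)
  have "H * \<theta> ^ k \<le> \<theta> * h"
  proof (cases k)
    case 0
    then show ?thesis using mult_mono[of 1 \<theta> H h] assms by simp
  next
    case (Suc j)
    then have "\<not> h \<le> H * \<theta> ^ j"
      using not_less_Least[of j "\<lambda>k. h \<le> H * \<theta> ^ k"] unfolding k_def by auto
    then have "\<theta> * (H * \<theta> ^ j) \<le> \<theta> * h" using assms by (intro mult_left_mono) auto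
    then show ?thesis using Suc by (simp add: mult_ac)
  qed
  with 1 show ?thesis by (rule that)
qed

text \<open>The condition on c is the Gaussian extreme-value constant: there are about
  \<open>U powr (1 - \<kappa>)\<close> disjoint intervals of the smallest lag. Interpolation from
  dyadic times and geometric lags uses up the strictness of the inequality.\<close>

lemma modulus:
  assumes \<kappa>: "0 \<le> \<kappa>" "\<kappa> \<le> 1" and c: "0 < c" "2 * (1 - \<kappa>) < c\<^sup>2"
  shows "AE \<omega> in M. \<forall>\<^sub>F U in at_top. \<forall>h\<ge>U powr \<kappa>. osc_le (\<lambda>t. W t \<omega>) U h (c * sqrt (h * ln U))"
proof -
  define q where "q = ((1 - \<kappa>) + c\<^sup>2 / 2) / 2"
  have q: "1 - \<kappa> < q" "2 * q < c\<^sup>2" "0 \<le> q" using c \<kappa> by (auto simp: q_def)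
  have sq: "sqrt (2 * q) < c" using q c by (metis abs_of_pos real_sqrt_abs real_sqrt_less_mono)
  \<comment> \<open>Rounding the lag up and replacing \<open>ln (2 * U)\<close> by
    \<open>ln U\<close> each cost a factor \<open>1 + \<eta>\<close> under the root, hence
    \<open>1 + \<eta>\<close> outside. As \<eta> tends to 0 the total constant tends to
    \<open>sqrt (2 * q)\<close>, which is below c.\<close>
  have "((\<lambda>\<eta>. (sqrt (2 * (1 + \<eta>) * q) + sqrt (2 * \<eta> * q)) * (1 + \<eta>)) \<longlongrightarrow>
      (sqrt (2 * (1 + 0) * q) + sqrt (2 * 0 * q)) * (1 + 0)) (at_right 0)"
    by (intro tendsto_intros)
  then have "\<forall>\<^sub>F \<eta> in at_right 0. (sqrt (2 * (1 + \<eta>) * q) + sqrt (2 * \<eta> * q)) * (1 + \<eta>) < c"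
    by (rule order_tendstoD(2)) (use sq in simp)
  moreover have "\<forall>\<^sub>F \<eta> in at_right (0::real). 0 < \<eta> \<and> \<eta> \<le> 1"
    unfolding eventually_at_right[OF zero_less_one] by (intro exI[of _ 1]) auto
  ultimately have "\<forall>\<^sub>F \<eta> in at_right 0. 0 < \<eta> \<and> \<eta> \<le> 1 \<and>
      (sqrt (2 * (1 + \<eta>) * q) + sqrt (2 * \<eta> * q)) * (1 + \<eta>) < c"
    by eventually_elim auto
  then obtain \<eta> where \<eta>: "0 < \<eta>" "\<eta> \<le> 1"
    and ec: "(sqrt (2 * (1 + \<eta>) * q) + sqrt (2 * \<eta> * q)) * (1 + \<eta>) < c"
    using eventually_happens'[of "at_right (0::real)"] by auto
  define C where "C = sqrt (2 * (1 + \<eta>) * q) + sqrt (2 * \<eta> * q)"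
  have C: "0 \<le> C" "C * (1 + \<eta>) \<le> c" using ec \<eta> q by (auto simp: C_def)
  show ?thesis
    using modulus_dyadic[OF \<kappa> \<eta> q(1)]
  proof eventually_elim
    case (elim \<omega>)
    then obtain m0 where m0: "\<And>m k s t. m0 \<le> m \<Longrightarrow> (2 ^ m) powr \<kappa> / 2 * (1 + \<eta>) ^ k \<le> 4 * 2 ^ m \<Longrightarrow>
       s \<in> {0..2 * 2 ^ m} \<Longrightarrow> t \<in> {0..2 * 2 ^ m} \<Longrightarrow> \<bar>s - t\<bar> \<le> (2 ^ m) powr \<kappa> / 2 * (1 + \<eta>) ^ k \<Longrightarrow>
        \<bar>W s \<omega> - W t \<omega>\<bar> \<le> C * sqrt ((2 ^ m) powr \<kappa> / 2 * (1 + \<eta>) ^ k * ln (2 ^ m))"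
      unfolding eventually_sequentially C_def by blast
    have "\<forall>\<^sub>F U in at_top. ln (2 * U) \<le> (1 + \<eta>) * ln (U::real)"
      using \<eta>(1) by real_asymp
    then show ?case
      using eventually_ge_at_top[of "2 ^ m0"] eventually_gt_at_top[of 1]
    proof eventually_elim
      case (elim U)
      have U: "1 < U" "2 ^ m0 \<le> U" "ln (2 * U) \<le> (1 + \<eta>) * ln U" using elim by auto
      define m where "m = nat \<lceil>log 2 U\<rceil>"
      have lm: "log 2 U \<le> real m" "real m \<le> log 2 U + 1"
        using U unfolding m_def by (auto simp: of_nat_ceiling)
      have "2 powr (log 2 U) \<le> 2 powr real m" using lm by (intro powr_mono) auto
      then have "U \<le> 2 powr real m" using U by simp
      then have Um: "U \<le> 2 ^ m" by (simp add: powr_realpow)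
      have "2 powr real m \<le> 2 powr (log 2 U + 1)" using lm by (intro powr_mono) auto
      then have mU: "2 ^ m \<le> 2 * U" using U by (simp add: powr_realpow powr_add)
      have "2 ^ m0 \<le> (2::real) ^ m" using U(2) Um by (rule order_trans)
      then have mm0: "m0 \<le> m" by simp
      have main: "\<bar>W s \<omega> - W t \<omega>\<bar> \<le> c * sqrt (h * ln U)"
        if h: "U powr \<kappa> \<le> h" "h \<le> 2 * U" and st: "s \<in> {0..2 * U}" "t \<in> {0..2 * U}" "\<bar>s - t\<bar> \<le> h" for h s t
      proof -
        define H0 where "H0 = (2 ^ m) powr \<kappa> / (2::real)"
        have H0: "0 < H0" by (simp add: H0_def)
        have "(2 ^ m) powr \<kappa> \<le> (2 * U) powr \<kappa>" using mU \<kappa> by (intro powr_mono2) auto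
        also have "\<dots> = 2 powr \<kappa> * U powr \<kappa>" using U by (simp add: powr_mult)
        also have "\<dots> \<le> 2 powr 1 * U powr \<kappa>" using \<kappa> by (intro mult_right_mono powr_mono) auto
        finally have "H0 \<le> U powr \<kappa>" by (simp add: H0_def)
        then have H0h: "H0 \<le> h" using h by simp
        have h0: "0 < h" using H0 H0h by linarith
        obtain k where hk: "h \<le> H0 * (1 + \<eta>) ^ k" and kh: "H0 * (1 + \<eta>) ^ k \<le> (1 + \<eta>) * h"
          using power_bracket[OF _ H0 H0h, of "1 + \<eta>"] \<eta> by auto
        have "(1 + \<eta>) * h \<le> 2 * (2 * U)" using h h0 \<eta> U by (intro mult_mono) auto
        then have k4: "H0 * (1 + \<eta>) ^ k \<le> 4 * 2 ^ m" using kh Um by linarith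
        have "ln (2 ^ m) \<le> ln (2 * U)" using mU U by simp
        then have lm: "ln (2 ^ m) \<le> (1 + \<eta>) * ln U" using U by linarith
        have "\<bar>W s \<omega> - W t \<omega>\<bar> \<le> C * sqrt (H0 * (1 + \<eta>) ^ k * ln (2 ^ m))"
          unfolding H0_def using mm0 k4 st hk Um by (intro m0) (auto simp: H0_def)
        also have "\<dots> \<le> C * sqrt ((1 + \<eta>) * h * ((1 + \<eta>) * ln U))"
          using C mult_mono[OF kh lm] \<eta> h0 by (intro mult_left_mono real_sqrt_le_mono) auto
        also have "(1 + \<eta>) * h * ((1 + \<eta>) * ln U) = (1 + \<eta>)\<^sup>2 * (h * ln U)" by (simp add: power2_eq_square)
        also have "C * sqrt ((1 + \<eta>)\<^sup>2 * (h * ln U)) = C * (1 + \<eta>) * sqrt (h * ln U)"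
          using \<eta> by (simp add: real_sqrt_mult)
        also have "\<dots> \<le> c * sqrt (h * ln U)"
          using C h0 U by (intro mult_right_mono) auto
        finally show ?thesis .
      qed
      show ?case
      proof (intro allI ballI impI)
        fix h s t assume h: "U powr \<kappa> \<le> h" and st: "s \<in> {0..2 * U}" "t \<in> {0..2 * U}" "\<bar>s - t\<bar> \<le> h"
        show "\<bar>W s \<omega> - W t \<omega>\<bar> \<le> c * sqrt (h * ln U)"
        \<comment> \<open>Two times in the window differ by at most \<open>2 * U\<close>, so a
          longer lag permits no more than the lag \<open>2 * U\<close>.\<close>
        proof (cases "h \<le> 2 * U")
          case True
          then show ?thesis using main h st by blast
        next
          case False
          have "U powr \<kappa> \<le> U powr 1" using U \<kappa> by (intro powr_mono) auto
          then have "\<bar>W s \<omega> - W t \<omega>\<bar> \<le> c * sqrt (2 * U * ln U)" using U st by (intro main) auto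
          also have "\<dots> \<le> c * sqrt (h * ln U)"
            using False U c by (intro mult_left_mono real_sqrt_le_mono mult_right_mono) auto
          finally show ?thesis .
        qed
      qed
    qed
  qed
qed

end

section \<open>Large increments\<close>

text \<open>Integer lags and starting points keep the union bound polynomial. The quantifiers over h
  and p sit inside the path property, so both may later be chosen depending on the path; this
  removes the dependence between lag and increment.\<close>

abbreviation has_steps :: "(real \<Rightarrow> real) \<Rightarrow> real \<Rightarrow> real \<Rightarrow> real \<Rightarrow> nat \<Rightarrow> bool" where
  "has_steps w \<kappa> \<nu> c n \<equiv> \<forall>h::nat. 1 \<le> h \<longrightarrow> real h \<le> real n powr \<kappa> \<longrightarrow>
    (\<forall>p::nat. p \<le> n \<longrightarrow> (\<exists>u. real p \<le> u \<and> u + real h \<le> real p + real n powr \<nu> \<and>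
       c * sqrt (real h * ln (real n)) \<le> w (u + real h) - w u))"

lemma (in prob_space) indep_all_less:
  fixes X :: "'b \<Rightarrow> 'a \<Rightarrow> real"
  assumes ind: "indep_vars (\<lambda>_. borel) X I" and I: "finite I"
    and q: "\<And>i. i \<in> I \<Longrightarrow> q i \<le> prob {\<omega>\<in>space M. x i \<le> X i \<omega>}"
  shows "prob {\<omega>\<in>space M. \<forall>i\<in>I. X i \<omega> < x i} \<le> exp (- (\<Sum>i\<in>I. q i))"
proof (cases "I = {}")
  case True
  then show ?thesis by (simp add: prob_space)
next
  case False
  have Xm: "X i \<in> borel_measurable M" if "i \<in> I" for i
    using ind that by (auto simp: indep_vars_def)
  have "{\<omega>\<in>space M. \<forall>i\<in>I. X i \<omega> < x i} = (\<Inter>i\<in>I. X i -` {..<x i} \<inter> space M)" using False by auto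
  also have "prob \<dots> = (\<Prod>i\<in>I. prob (X i -` {..<x i} \<inter> space M))"
    by (rule indep_varsD_finite[OF ind False I]) auto
  also have "\<dots> \<le> (\<Prod>i\<in>I. exp (- q i))"
  proof (intro prod_mono conjI)
    fix i assume i: "i \<in> I"
    have "{\<omega>\<in>space M. x i \<le> X i \<omega>} \<in> events"
      using Xm[OF i] by (intro borel_measurable_le) auto
    then have "prob (space M - {\<omega>\<in>space M. x i \<le> X i \<omega>}) = 1 - prob {\<omega>\<in>space M. x i \<le> X i \<omega>}"
      by (rule prob_compl)
    also have "space M - {\<omega>\<in>space M. x i \<le> X i \<omega>} = X i -` {..<x i} \<inter> space M" by auto
    finally have "prob (X i -` {..<x i} \<inter> space M) \<le> 1 + (- q i)" using q[OF i] by simp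
    also have "\<dots> \<le> exp (- q i)" by (rule exp_ge_add_one_self)
    finally show "prob (X i -` {..<x i} \<inter> space M) \<le> exp (- q i)" .
  qed auto
  also have "\<dots> = exp (- (\<Sum>i\<in>I. q i))" using I by (simp add: exp_sum sum_negf[symmetric])
  finally show ?thesis .
qed

context wiener
begin

abbreviation step :: "real \<Rightarrow> real \<Rightarrow> nat \<Rightarrow> 'a \<Rightarrow> real" where
  "step p h i \<omega> \<equiv> W (p + real (Suc i) * h) \<omega> - W (p + real i * h) \<omega>"

lemma no_large_block:
  assumes h: "0 < h" and p: "0 \<le> p" and x: "0 \<le> x"
  shows "prob {\<omega>\<in>space M. \<forall>i\<in>{..<N}. step p h i \<omega> < sqrt h * x}
    \<le> exp (- real N * (exp (- (x + 1)\<^sup>2 / 2) / 3))"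
proof -
  have "indep_vars (\<lambda>_. borel) (\<lambda>i \<omega>. step p h i \<omega>) {..<N}"
    using h p by (intro indep_increments[of "\<lambda>i. p + real i * h"]) (auto simp: mono_on_def)
  moreover have "exp (- (x + 1)\<^sup>2 / 2) / 3 \<le> prob {\<omega>\<in>space M. sqrt h * x \<le>
      step p h i \<omega>}" for i
  proof -
    have "p + real (Suc i) * h - (p + real i * h) = h" by (simp add: algebra_simps)
    then show ?thesis
      using normal_tail_ge[OF increment_normal, of "p + real i * h" "p + real (Suc i) * h" x] h p x
      by simp
  qed
  ultimately have "prob {\<omega>\<in>space M. \<forall>i\<in>{..<N}. step p h i \<omega> < sqrt h * x}
    \<le> exp (- (\<Sum>i\<in>{..<N}. exp (- (x + 1)\<^sup>2 / 2) / 3))"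
    by (intro indep_all_less) auto
  then show ?thesis by simp
qed

text \<open>An interval of length \<open>n powr \<nu>\<close> holds about
  \<open>n powr (\<nu> - \<kappa>)\<close> or more disjoint blocks of length h, each successful with
  probability roughly \<open>n powr (- c\<^sup>2 / 2)\<close>. The expected number of successes
  grows like a power of n, so having none is far less likely than the reciprocal of the number of
  pairs of lag and starting point.\<close>

lemma large_increments:
  assumes l: "\<kappa> \<le> 1" and c: "0 < c" "c\<^sup>2 / 2 < \<nu> - \<kappa>"
  shows "AE \<omega> in M. \<forall>\<^sub>F n in sequentially. has_steps (\<lambda>t. W t \<omega>) \<kappa> \<nu> c n"
proof -
  define N where "N n h = nat \<lfloor>real n powr \<nu> / real h\<rfloor>" for n h :: nat
  define A where "A n h p = {\<omega>\<in>space M. \<forall>i\<in>{..<N n h}. step (real p) (real h) i \<omega> < sqrt (real h) * (c * sqrt (ln (real n)))}" for n h p :: nat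
  define K where "K n = {h::nat. 1 \<le> h \<and> real h \<le> real n powr \<kappa>}" for n :: nat
  define E where "E n = (\<Union>h\<in>K n. \<Union>p\<in>{..n}. A n h p)" for n
  \<comment> \<open>A lower bound for the expected number of successful blocks, the same for all
    admissible lags: block count times the bound of \<open>normal_tail_ge\<close>.\<close>
  define g where "g n = (real n powr (\<nu> - \<kappa>) - 1) * (exp (- (c * sqrt (ln (real n)) + 1)\<^sup>2 / 2) / 3)" for n :: nat
  have Kn: "K n \<subseteq> {1..n}" for n
  proof
    fix h assume h: "h \<in> K n"
    then have "1 \<le> real h" "real h \<le> real n powr \<kappa>" by (auto simp: K_def)
    moreover from this have "1 \<le> real n" by (cases n) auto
    moreover from this have "real n powr \<kappa> \<le> real n powr 1" using l by (intro powr_mono) auto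
    ultimately show "h \<in> {1..n}" using h by (auto simp: K_def)
  qed
  then have fK: "finite (K n)" for n using finite_subset by blast
  have Am: "A n h p \<in> events" for n h p
  proof -
    have "{\<omega>\<in>space M. step (real p) (real h) i \<omega> < sqrt (real h) * (c * sqrt (ln (real n)))} \<in> events" for i
      by (intro borel_measurable_less borel_measurable_diff measurable_W borel_measurable_const) auto
    moreover have "A n h p = (\<Inter>i\<in>{..<N n h}. {\<omega>\<in>space M. step (real p) (real h) i \<omega> < sqrt (real h) * (c * sqrt (ln (real n)))}) \<inter> space M"
      by (auto simp: A_def)
    ultimately show ?thesis by (cases "N n h = 0") auto
  qed
  have Em: "E n \<in> events" for n unfolding E_def using Am fK by auto
  have Ap: "prob (A n h p) \<le> exp (- g n)" if h: "h \<in> K n" for n h p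
  proof -
    have n: "1 \<le> n" "1 \<le> h" using h Kn[of n] by auto
    have "prob (A n h p) \<le> exp (- real (N n h) * (exp (- (c * sqrt (ln (real n)) + 1)\<^sup>2 / 2) / 3))"
      unfolding A_def using n c by (intro no_large_block) auto
    also have "real n powr (\<nu> - \<kappa>) - 1 \<le> real (N n h)"
    proof -
      have "real n powr (\<nu> - \<kappa>) = real n powr \<nu> / real n powr \<kappa>" by (rule powr_diff)
      also have "\<dots> \<le> real n powr \<nu> / real h" using h n by (intro divide_left_mono) (auto simp: K_def)
      also have "\<dots> \<le> real (N n h) + 1" unfolding N_def by linarith
      finally show ?thesis by simp
    qed
    then have "exp (- real (N n h) * (exp (- (c * sqrt (ln (real n)) + 1)\<^sup>2 / 2) / 3)) \<le> exp (- g n)"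
      unfolding g_def by (simp add: mult_right_mono)
    finally show ?thesis .
  qed
  have Ep: "prob (E n) \<le> (real n * (real n + 1)) * exp (- g n)" for n
  proof -
    have "prob (E n) \<le> (\<Sum>h\<in>K n. prob (\<Union>p\<in>{..n}. A n h p))"
      unfolding E_def using Am fK by (intro finite_measure_subadditive_finite) auto
    also have "\<dots> \<le> (\<Sum>h\<in>K n. \<Sum>p\<in>{..n}. prob (A n h p))"
      using Am by (intro sum_mono finite_measure_subadditive_finite) auto
    also have "\<dots> \<le> (\<Sum>h\<in>K n. \<Sum>p\<in>{..n}. exp (- g n))" by (intro sum_mono Ap)
    also have "\<dots> = real (card (K n)) * (real n + 1) * exp (- g n)" by simp
    also have "\<dots> \<le> real n * (real n + 1) * exp (- g n)"
      using card_mono[OF _ Kn[of n]] by (intro mult_right_mono) auto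
    finally show ?thesis .
  qed
  \<comment> \<open>The slack in the exponent. One half absorbs the lower-order terms of
    \<open>(x + 1)\<^sup>2 / 2\<close>; the other leaves the power \<open>n powr (d / 2)\<close>,
    which beats any multiple of the logarithm.\<close>
  define d where "d = \<nu> - \<kappa> - c\<^sup>2 / 2"
  have d: "0 < d" using c by (simp add: d_def)
  \<comment> \<open>Five logarithms suffice: the failure probability is then at most n to the -5,
    and the at most n (n + 1) pairs still leave a summable bound.\<close>
  have g5: "\<forall>\<^sub>F n in sequentially. 5 * ln (real n) \<le> g n"
  proof -
    have 1: "\<forall>\<^sub>F n in sequentially. c * sqrt (ln (real n)) + 1 / 2 \<le> d / 2 * ln (real n)"
      using c d by real_asymp
    have 2: "\<forall>\<^sub>F n in sequentially. 1 \<le> real n powr (\<nu> - \<kappa>) / 2"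
    proof -
      have "0 < \<nu> - \<kappa>" using c(2) zero_le_power2[of c] by linarith
      then show ?thesis by real_asymp
    qed
    have 3: "\<forall>\<^sub>F n in sequentially. 5 * ln (real n) \<le> real n powr (d / 2) / 6"
      using d by real_asymp
    show ?thesis
      using 1 2 3 eventually_gt_at_top[of 0]
    proof eventually_elim
      case (elim n)
      have "(c * sqrt (ln (real n)) + 1)\<^sup>2 / 2 = c\<^sup>2 / 2 * ln (real n) + (c * sqrt (ln (real n)) + 1 / 2)"
        using elim by (simp add: power2_eq_square algebra_simps)
      then have "- (c * sqrt (ln (real n)) + 1)\<^sup>2 / 2 \<ge> - (c\<^sup>2 / 2 + d / 2) * ln (real n)"
        using elim by (simp add: algebra_simps)
      then have e: "real n powr (- (c\<^sup>2 / 2 + d / 2)) \<le> exp (- (c * sqrt (ln (real n)) + 1)\<^sup>2 / 2)"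
        using elim by (simp add: powr_def)
      have "real n powr (d / 2) = real n powr (\<nu> - \<kappa>) * real n powr (- (c\<^sup>2 / 2 + d / 2))"
        unfolding powr_add[symmetric] by (simp add: d_def field_simps)
      then have "5 * ln (real n) \<le> real n powr (\<nu> - \<kappa>) / 2 * (real n powr (- (c\<^sup>2 / 2 + d / 2)) / 3)"
        using elim by simp
      also have "\<dots> \<le> g n"
        unfolding g_def using elim e by (intro mult_mono divide_right_mono) auto
      finally show ?case .
    qed
  qed
  have "\<forall>\<^sub>F n in sequentially. norm (prob (E n)) \<le> 2 * (1 / real n ^ 2)"
    using g5 eventually_gt_at_top[of 0]
  proof eventually_elim
    case (elim n)
    have "exp (- g n) \<le> exp (- (5 * ln (real n)))" using elim by simp
    also have "\<dots> = real n powr (- 5)" using elim by (simp add: powr_def)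
    also have "\<dots> \<le> real n powr (- 4)" using elim by (intro powr_mono) auto
    also have "\<dots> = 1 / real n ^ 4" using elim by (simp add: powr_minus powr_numeral divide_inverse)
    finally have "exp (- g n) \<le> 1 / real n ^ 4" .
    moreover have "real n * (real n + 1) \<le> real n * (2 * real n)" using elim by (intro mult_left_mono) auto
    ultimately have "(real n * (real n + 1)) * exp (- g n) \<le> (real n * (2 * real n)) * (1 / real n ^ 4)"
      using mult_mono[of "real n * (real n + 1)" "real n * (2 * real n)" "exp (- g n)" "1 / real n ^ 4"] by simp
    also have "\<dots> = 2 * (1 / real n ^ 2)" using elim by (simp add: eval_nat_numeral)
    finally show ?case using Ep[of n] by simp
  qed
  moreover have "summable (\<lambda>n. 2 * (1 / real n ^ 2))"
    using inverse_power_summable[of 2] by (intro summable_mult) (simp add: divide_inverse)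
  ultimately have "summable (\<lambda>n. prob (E n))" by (rule summable_comparison_test_ev)
  then have "AE \<omega> in M. \<forall>\<^sub>F n in sequentially. \<omega> \<in> space M - E n"
    using Em by (intro borel_cantelli_AE1) (auto simp: emeasure_eq_measure)
  then show ?thesis
  proof eventually_elim
    case (elim \<omega>)
    then show ?case
      using eventually_gt_at_top[of 0]
    proof eventually_elim
      case (elim n)
      show ?case
      proof (intro allI impI)
        fix h p :: nat assume h: "1 \<le> h" "real h \<le> real n powr \<kappa>" and p: "p \<le> n"
        then have "\<omega> \<notin> A n h p" using elim by (auto simp: E_def K_def)
        then obtain i where i: "i < N n h" "sqrt (real h) * (c * sqrt (ln (real n))) \<le>
            step (real p) (real h) i \<omega>"
          using elim by (auto simp: A_def not_less)
        have "real (Suc i) \<le> real (N n h)" using i by simp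
        also have "\<dots> \<le> real n powr \<nu> / real h" unfolding N_def by simp
        finally have "real (Suc i) * real h \<le> real n powr \<nu>" using h by (simp add: field_simps)
        then show "\<exists>u. real p \<le> u \<and> u + real h \<le> real p + real n powr \<nu> \<and>
           c * sqrt (real h * ln (real n)) \<le> W (u + real h) \<omega> - W u \<omega>"
          using i by (intro exI[of _ "real p + real i * real h"]) (auto simp: real_sqrt_mult algebra_simps)
      qed
    qed
  qed
qed

end

section \<open>The law of the iterated logarithm\<close>

context wiener
begin

lemma lil_upper:
  assumes c: "1 < c"
  shows "AE \<omega> in M. \<forall>\<^sub>F U in at_top. \<forall>u\<in>{0..U}. \<bar>W u \<omega>\<bar> \<le> c * sqrt (2 * U * ln (ln U))"
proof -
  \<comment> \<open>The slack c is split evenly. A factor \<open>sqrt c\<close> in the threshold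
    makes the k-th probability of order \<open>k powr (- c)\<close>; another comes from
    interpolation, where U and its iterated logarithm each lose a factor \<theta> under the root and
    \<open>\<theta> * \<theta> = c\<close>.\<close>
  define \<theta> where "\<theta> = sqrt c"
  have th: "1 < \<theta>" "\<theta> * \<theta> = c" using c by (auto simp: \<theta>_def)
  define x where "x k = sqrt c * sqrt (2 * \<theta> ^ k * ln (ln (\<theta> ^ k)))" for k :: nat
  have l: "\<forall>\<^sub>F k in sequentially. 1 < ln (\<theta> ^ k)"
    using th by real_asymp
  have "\<forall>\<^sub>F k in sequentially. norm (prob (exceed 0 (\<theta> ^ k) (x k))) \<le> 4 * ln \<theta> powr (- c) * real k powr (- c)"
    using l eventually_gt_at_top[of 0]
  proof eventually_elim
    case (elim k)
    have L: "0 < ln (ln (\<theta> ^ k))" using elim by simp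
    have x0: "0 \<le> x k" using L th c by (auto simp: x_def)
    have "(x k)\<^sup>2 = 2 * \<theta> ^ k * (c * ln (ln (\<theta> ^ k)))"
      unfolding x_def power_mult_distrib using L th c by simp
    then have "- (x k)\<^sup>2 / (2 * \<theta> ^ k) = - c * ln (ln (\<theta> ^ k))" using th by simp
    then have "exp (- (x k)\<^sup>2 / (2 * \<theta> ^ k)) = ln (\<theta> ^ k) powr (- c)" using elim by (simp add: powr_def)
    also have "ln (\<theta> ^ k) = ln \<theta> * real k" using th by (simp add: ln_realpow)
    also have "(ln \<theta> * real k) powr (- c) = ln \<theta> powr (- c) * real k powr (- c)"
      by (rule powr_mult)
    finally have "exp (- (x k)\<^sup>2 / (2 * \<theta> ^ k)) = ln \<theta> powr (- c) * real k powr (- c)" .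
    then show ?case using exceed_prob[OF _ _ x0, of 0 "\<theta> ^ k"] th by simp
  qed
  moreover have "summable (\<lambda>k. 4 * ln \<theta> powr (- c) * real k powr (- c))"
    using c by (intro summable_mult) (simp add: summable_real_powr_iff)
  ultimately have "summable (\<lambda>k. prob (exceed 0 (\<theta> ^ k) (x k)))" by (rule summable_comparison_test_ev)
  then have "AE \<omega> in M. \<forall>\<^sub>F k in sequentially. \<omega> \<in> space M - exceed 0 (\<theta> ^ k) (x k)"
    using th by (intro borel_cantelli_AE1) (auto simp: emeasure_eq_measure intro!: exceed_events)
  then show ?thesis
    using W_continuous W_0
  proof eventually_elim
    case (elim \<omega>)
    then obtain k0 where k0: "\<And>k. k0 \<le> k \<Longrightarrow> \<omega> \<in> space M - exceed 0 (\<theta> ^ k) (x k)"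
      unfolding eventually_sequentially by blast
    have "\<forall>\<^sub>F U in at_top. ln (ln (\<theta> * U)) \<le> \<theta> * ln (ln (U::real))"
      using th by real_asymp
    then show ?case
      using eventually_ge_at_top[of "\<theta> ^ k0"] eventually_gt_at_top[of "exp 1"]
    proof eventually_elim
      case (elim U)
      have U1: "1 < U" using elim(3) exp_ge_add_one_self[of 1] by linarith
      have lU: "1 < ln U" using elim(3) U1 by (subst ln_exp[of 1, symmetric], subst ln_less_cancel_iff) auto
      obtain k where Uk: "U \<le> \<theta> ^ k" and kU: "\<theta> ^ k \<le> \<theta> * U"
        using power_bracket[OF th(1), of 1 U] U1 by auto
      have "\<theta> ^ k0 \<le> \<theta> ^ k" using elim(2) Uk by (rule order_trans)
      then have "k0 \<le> k" using th by simp
      then have ne: "\<omega> \<in> space M" "\<omega> \<notin> exceed 0 (\<theta> ^ k) (x k)" using k0[of k] by auto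
      show ?case
      proof
        fix u assume u: "u \<in> {0..U}"
        have "\<bar>W u \<omega> - W 0 \<omega>\<bar> \<le> x k"
          using u Uk th \<open>continuous_on _ _\<close> by (intro not_exceed[OF _ ne]) auto
        also have "x k \<le> sqrt c * sqrt (2 * (\<theta> * U) * (\<theta> * ln (ln U)))"
        proof -
          have "1 < ln (\<theta> ^ k)" using lU Uk U1 by (meson less_le_trans ln_le_cancel_iff less_trans zero_less_one)
          moreover have "ln (\<theta> ^ k) \<le> ln (\<theta> * U)" using kU th U1 by simp
          ultimately have "ln (ln (\<theta> ^ k)) \<le> ln (ln (\<theta> * U))" "0 \<le> ln (ln (\<theta> ^ k))" by auto
          then show ?thesis unfolding x_def using kU elim(1) th U1 c
            by (intro mult_left_mono real_sqrt_le_mono mult_mono) auto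
        qed
        also have "2 * (\<theta> * U) * (\<theta> * ln (ln U)) = c * (2 * U * ln (ln U))"
          using th(2) by (simp add: algebra_simps)
        also have "sqrt c * sqrt (c * (2 * U * ln (ln U))) = c * sqrt (2 * U * ln (ln U))"
          using c by (simp add: real_sqrt_mult)
        finally show "\<bar>W u \<omega>\<bar> \<le> c * sqrt (2 * U * ln (ln U))" using \<open>W 0 \<omega> = 0\<close> by simp
      qed
    qed
  qed
qed

text \<open>The divergence half of Borel-Cantelli: by independence, the probability that all
  increments from index K on stay small is at most the exponential of minus arbitrarily large
  partial sums of q.\<close>

lemma large_increments_infinitely_often:
  fixes t :: "nat \<Rightarrow> real" and x q :: "nat \<Rightarrow> real"
  assumes t: "0 \<le> t 0" "strict_mono t"
    and q: "\<And>k. 0 \<le> q k" "\<And>k. q k \<le> prob {\<omega>\<in>space M. x k \<le> W (t (Suc k)) \<omega> - W (t k) \<omega>}"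
    and ns: "\<not> summable q"
  shows "AE \<omega> in M. \<exists>\<^sub>F k in sequentially. x k \<le> W (t (Suc k)) \<omega> - W (t k) \<omega>"
proof -
  define X where "X k \<omega> = W (t (Suc k)) \<omega> - W (t k) \<omega>" for k \<omega>
  have t0: "0 \<le> t k" for k using t by (metis order_trans strict_mono_less_eq le0)
  have Xm: "X k \<in> borel_measurable M" for k
    unfolding X_def[abs_def] using t0 by (intro borel_measurable_diff measurable_W)
  have ind: "indep_vars (\<lambda>_. borel) X {..<n}" for n
    unfolding X_def[abs_def] using t by (intro indep_increments) (auto simp: mono_on_def strict_mono_less_eq)
  define A where "A K m = {\<omega>\<in>space M. \<forall>k\<in>{K..<m}. X k \<omega> < x k}" for K m
  define B where "B K = {\<omega>\<in>space M. \<forall>k\<ge>K. X k \<omega> < x k}" for K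
  have less: "{\<omega>\<in>space M. X k \<omega> < x k} \<in> events" for k using Xm by (intro borel_measurable_less) auto
  have Am: "A K m \<in> events" for K m
  proof -
    have "A K m = (\<Inter>k\<in>{K..<m}. {\<omega>\<in>space M. X k \<omega> < x k}) \<inter> space M" by (auto simp: A_def)
    then show ?thesis using less by (cases "{K..<m} = {}") auto
  qed
  have "B K = (\<Inter>k\<in>{K..}. {\<omega>\<in>space M. X k \<omega> < x k})" for K by (auto simp: B_def)
  then have Bm: "B K \<in> events" for K using less by (auto intro!: sets.countable_INT')
  have B0: "prob (B K) = 0" for K
  proof -
    have le: "prob (B K) \<le> exp (- (\<Sum>k\<in>{K..<m}. q k))" for m
    proof -
      have "prob (B K) \<le> prob (A K m)" using Am by (intro finite_measure_mono) (auto simp: A_def B_def)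
      also have "\<dots> \<le> exp (- (\<Sum>k\<in>{K..<m}. q k))"
        unfolding A_def
        by (rule indep_all_less[OF indep_vars_subset[OF ind[of m]]]) (use q in \<open>auto simp: X_def\<close>)
      finally show ?thesis .
    qed
    have "\<not> (\<exists>C. \<forall>n. (\<Sum>k<n. q k) \<le> C)"
      using ns q(1) summableI_nonneg_bounded[of q] by blast
    then have un: "\<exists>n. C < (\<Sum>k<n. q k)" for C by (meson not_le)
    have "prob (B K) \<le> e" if "0 < e" for e
    proof -
      obtain n where n: "(\<Sum>k<K. q k) - ln e < (\<Sum>k<n. q k)" using un by blast
      have "(\<Sum>k<n. q k) \<le> (\<Sum>k<K + n. q k)" using q by (intro sum_mono2) auto
      also have "\<dots> = (\<Sum>k<K. q k) + (\<Sum>k\<in>{K..<K + n}. q k)"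
        by (metis atLeast0LessThan le_add1 sum.atLeastLessThan_concat zero_le)
      finally have "- (\<Sum>k\<in>{K..<K + n}. q k) \<le> ln e" using n by linarith
      then have "exp (- (\<Sum>k\<in>{K..<K + n}. q k)) \<le> e" using that by (metis exp_le_cancel_iff exp_ln)
      then show ?thesis using le[of "K + n"] by linarith
    qed
    then have "prob (B K) \<le> 0" by (rule field_le_epsilon[of _ 0, simplified])
    then show ?thesis using measure_nonneg[of M "B K"] by linarith
  qed
  have "AE \<omega> in M. \<omega> \<notin> B K" for K
    using Bm B0 by (intro AE_not_in) (auto simp: null_sets_def emeasure_eq_measure)
  then have "AE \<omega> in M. \<forall>K. \<omega> \<notin> B K" by (simp add: AE_all_countable)
  then show ?thesis
    using AE_space
  proof eventually_elim
    case (elim \<omega>)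
    then show ?case by (auto simp: frequently_sequentially B_def X_def not_less)
  qed
qed

lemma lil_lower:
  assumes c: "0 < c" "c < 1"
  shows "AE \<omega> in M. \<exists>\<^sub>F U in at_top. c * sqrt (2 * U * ln (ln U)) \<le> W U \<omega>"
proof -
  define c1 where "c1 = (1 + c) / 2"
  have c1: "0 < c1" "c1 < 1" "c < c1" using c by (auto simp: c1_def)
  \<comment> \<open>For large ratio \<theta> the last geometric block is almost the whole interval:
    \<open>sqrt (1 - 1 / \<theta>)\<close> is its share of the standard deviation, and
    \<open>2 / sqrt \<theta>\<close> bounds the value at its left end through
    \<open>lil_upper\<close> with constant 2.\<close>
  have "((\<lambda>\<theta>. c1 * sqrt (1 - 1 / \<theta>) - 2 / sqrt \<theta>) \<longlongrightarrow> c1) at_top"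
    by real_asymp
  then have "\<forall>\<^sub>F \<theta> in at_top. c < c1 * sqrt (1 - 1 / \<theta>) - 2 / sqrt \<theta>"
    using c1 by (intro order_tendstoD(1)) auto
  then have "\<forall>\<^sub>F \<theta> in at_top. c < c1 * sqrt (1 - 1 / \<theta>) - 2 / sqrt \<theta> \<and> 1 < \<theta>"
    using eventually_gt_at_top by eventually_elim auto
  then obtain \<theta> :: real where th: "1 < \<theta>" "c < c1 * sqrt (1 - 1 / \<theta>) - 2 / sqrt \<theta>"
    using eventually_happens'[of "at_top :: real filter"] by auto
  define t where "t k = \<theta> ^ k" for k :: nat
  \<comment> \<open>The value 0 covers the finitely many k at which the iterated logarithm is not
    positive; \<open>normal_tail_ge\<close> then applies for every k.\<close>
  define y where "y k = (if 1 < ln (t (Suc k)) then c1 * sqrt (2 * ln (ln (t (Suc k)))) else 0)" for k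
  define s where "s k = sqrt (t (Suc k) - t k)" for k
  define q where "q k = exp (- (y k + 1)\<^sup>2 / 2) / 3" for k
  have tm: "strict_mono t" unfolding t_def using th by (intro power_strict_increasing_iff[THEN iffD2] strict_monoI) auto
  have t0: "0 < t k" for k using th by (simp add: t_def)
  have ts: "t k < t (Suc k)" for k using tm by (simp add: strict_mono_less)
  have y0: "0 \<le> y k" for k using c1 by (auto simp: y_def)
  have qp: "q k \<le> prob {\<omega>\<in>space M. s k * y k \<le> W (t (Suc k)) \<omega> - W (t k) \<omega>}" for k
    unfolding q_def s_def using t0[of k] ts[of k] y0 by (intro normal_tail_ge increment_normal) auto
  \<comment> \<open>Since \<open>c1 < 1\<close>, the shift by 1 in
    \<open>(y k + 1)\<^sup>2 / 2\<close> is eventually absorbed and the exponent is at most the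
    iterated logarithm of \<open>t (Suc k)\<close>. So q dominates a multiple of the harmonic
    series.\<close>
  have ns: "\<not> summable q"
  proof
    assume "summable q"
    have 1: "\<forall>\<^sub>F k in sequentially. 1 < ln (\<theta> ^ Suc k)" using th by real_asymp
    have d: "c1\<^sup>2 < 1" using c1 by (simp add: power_less_one_iff)
    have 2: "\<forall>\<^sub>F k in sequentially. c1 * sqrt (2 * ln (ln (\<theta> ^ Suc k))) + 1 / 2 \<le> (1 - c1\<^sup>2) * ln (ln (\<theta> ^ Suc k))"
    proof -
      have "\<forall>\<^sub>F z in at_top. c1 * sqrt (2 * z) + 1 / 2 \<le> (1 - c1\<^sup>2) * z"
        using c1 d by real_asymp
      moreover have "filterlim (\<lambda>k. ln (ln (\<theta> ^ Suc k))) at_top sequentially" using th by real_asymp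
      ultimately show ?thesis by (rule eventually_compose_filterlim)
    qed
    have "\<forall>\<^sub>F k in sequentially. norm (inverse (real (Suc k))) \<le> 3 * ln \<theta> * q k"
      using 1 2
    proof eventually_elim
      case (elim k)
      define L where "L = ln (ln (\<theta> ^ Suc k))"
      have L: "0 < L" using elim by (simp add: L_def)
      have yk: "y k = c1 * sqrt (2 * L)" using elim by (simp add: y_def t_def L_def)
      have "(y k + 1)\<^sup>2 / 2 = c1\<^sup>2 * L + (c1 * sqrt (2 * L) + 1 / 2)"
        unfolding yk using L by (simp add: power2_eq_square algebra_simps)
      also have "\<dots> \<le> L" using elim(2) unfolding L_def[symmetric] by (simp add: algebra_simps)
      finally have "exp (- L) \<le> exp (- (y k + 1)\<^sup>2 / 2)" by simp
      moreover have "exp (- L) = inverse (ln (\<theta> ^ Suc k))" using elim by (simp add: L_def exp_minus)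
      moreover have "ln (\<theta> ^ Suc k) = real (Suc k) * ln \<theta>" using th by (subst ln_realpow) auto
      ultimately have "inverse (real (Suc k) * ln \<theta>) \<le> 3 * q k" by (simp add: q_def)
      then have "ln \<theta> * inverse (real (Suc k) * ln \<theta>) \<le> ln \<theta> * (3 * q k)" using th by (intro mult_left_mono) auto
      moreover have "ln \<theta> * inverse (real (Suc k) * ln \<theta>) = inverse (real (Suc k))"
        using th by (simp add: inverse_mult_distrib)
      ultimately have "inverse (real (Suc k)) \<le> ln \<theta> * (3 * q k)" by (simp only:)
      then show ?case by (simp del: of_nat_Suc add: mult.left_commute mult.assoc)
    qed
    then have "summable (\<lambda>k. inverse (real (Suc k)))"
      using \<open>summable q\<close> by (rule summable_comparison_test_ev[OF _ summable_mult])
    then have "summable (\<lambda>k. inverse (real k))" by (subst (asm) summable_Suc_iff)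
    then show False using not_summable_harmonic[where 'a = real] by (simp add: inverse_eq_divide)
  qed
  have "AE \<omega> in M. \<exists>\<^sub>F k in sequentially. s k * y k \<le> W (t (Suc k)) \<omega> - W (t k) \<omega>"
    using t0[of 0] tm qp ns by (intro large_increments_infinitely_often[of t q]) (auto simp: q_def)
  then show ?thesis
    using lil_upper[of 2, simplified]
  proof eventually_elim
    case (elim \<omega>)
    have tinf: "filterlim t at_top sequentially" unfolding t_def using th by real_asymp
    have tinf': "filterlim (\<lambda>k. t (Suc k)) at_top sequentially" using tinf by (subst filterlim_sequentially_Suc)
    have 1: "\<forall>\<^sub>F k in sequentially. \<forall>u\<in>{0..t k}. \<bar>W u \<omega>\<bar> \<le> 2 * sqrt (2 * t k * ln (ln (t k)))"
      using eventually_compose_filterlim[OF elim(2) tinf] by simp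
    have 2: "\<forall>\<^sub>F k in sequentially. 1 < ln (t k)" unfolding t_def using th by real_asymp
    have "\<exists>\<^sub>F k in sequentially. c * sqrt (2 * t (Suc k) * ln (ln (t (Suc k)))) \<le> W (t (Suc k)) \<omega>"
      using elim(1)
    proof (rule frequently_rev_mp)
      show "\<forall>\<^sub>F k in sequentially. s k * y k \<le> W (t (Suc k)) \<omega> - W (t k) \<omega> \<longrightarrow>
          c * sqrt (2 * t (Suc k) * ln (ln (t (Suc k)))) \<le> W (t (Suc k)) \<omega>"
        using 1 2
      proof eventually_elim
        case (elim k)
        define V where "V = sqrt (2 * t (Suc k) * ln (ln (t (Suc k))))"
        have "ln (t k) < ln (t (Suc k))" using ts[of k] t0[of k] by simp
        then have l: "1 < ln (t (Suc k))" "ln (ln (t k)) \<le> ln (ln (t (Suc k)))" using elim(2) by auto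
        have V0: "0 \<le> V" using l t0[of "Suc k"] by (auto simp: V_def)
        have tk: "t k = t (Suc k) / \<theta>" using th by (simp add: t_def)
        have "2 * t k * ln (ln (t k)) \<le> 2 * t k * ln (ln (t (Suc k)))"
          using l t0[of k] by (intro mult_left_mono) auto
        also have "\<dots> = (2 * t (Suc k) * ln (ln (t (Suc k)))) / \<theta>" by (simp add: tk)
        finally have "sqrt (2 * t k * ln (ln (t k))) \<le> V / sqrt \<theta>"
          unfolding V_def real_sqrt_divide[symmetric] by (rule real_sqrt_le_mono)
        moreover have "\<bar>W (t k) \<omega>\<bar> \<le> 2 * sqrt (2 * t k * ln (ln (t k)))" using elim(1) t0[of k] by simp
        ultimately have a: "\<bar>W (t k) \<omega>\<bar> \<le> 2 / sqrt \<theta> * V" by simp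
        have "s k = sqrt ((1 - 1 / \<theta>) * t (Suc k))" unfolding s_def tk using th by (simp add: algebra_simps)
        then have "s k * y k = c1 * sqrt (1 - 1 / \<theta>) * V"
          using l by (simp add: y_def V_def real_sqrt_mult)
        moreover have "c * V \<le> (c1 * sqrt (1 - 1 / \<theta>) - 2 / sqrt \<theta>) * V" using th V0 by (intro mult_right_mono) auto
        ultimately show ?case using a unfolding V_def[symmetric] by (auto simp: algebra_simps)
      qed
    qed
    then show ?case
      using tinf' unfolding frequently_def filterlim_iff by blast
  qed
qed

end

section \<open>Renewal paths\<close>

definition run_max :: "(real \<Rightarrow> real) \<Rightarrow> real \<Rightarrow> real" where
  "run_max f U = (SUP u\<in>{0..U}. \<bar>f u\<bar>)"

text \<open>A real supremum is meaningful only over a bounded set. The partial sums and passage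
  times are not continuous, so boundedness on compact intervals is tracked as a property of its
  own.\<close>

definition bounded_runs :: "(real \<Rightarrow> real) \<Rightarrow> bool" where
  "bounded_runs f \<longleftrightarrow> (\<forall>U. \<exists>K. \<forall>u\<in>{0..U}. \<bar>f u\<bar> \<le> K)"

lemma bounded_runsD: "bounded_runs f \<Longrightarrow> bdd_above ((\<lambda>u. \<bar>f u\<bar>) ` {0..U})"
  unfolding bounded_runs_def bdd_above_def by blast

lemma run_max_upper: "bounded_runs f \<Longrightarrow> 0 \<le> u \<Longrightarrow> u \<le> U \<Longrightarrow> \<bar>f u\<bar> \<le> run_max f U"
  unfolding run_max_def by (rule cSUP_upper[OF _ bounded_runsD]) auto

lemma run_max_le: "0 \<le> U \<Longrightarrow> (\<And>u. 0 \<le> u \<Longrightarrow> u \<le> U \<Longrightarrow> \<bar>f u\<bar> \<le> K) \<Longrightarrow> run_max f U \<le> K"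
  unfolding run_max_def by (rule cSUP_least) auto

lemma run_max_nonneg: "bounded_runs f \<Longrightarrow> 0 \<le> U \<Longrightarrow> 0 \<le> run_max f U"
  using run_max_upper[of f 0 U] by simp

lemma bounded_runs_add:
  assumes "bounded_runs f" "bounded_runs g"
  shows "bounded_runs (\<lambda>u. f u + g u)"
  unfolding bounded_runs_def
proof
  fix U
  obtain K L where "\<forall>u\<in>{0..U}. \<bar>f u\<bar> \<le> K" "\<forall>u\<in>{0..U}. \<bar>g u\<bar> \<le> L"
    using assms unfolding bounded_runs_def by meson
  then have "\<forall>u\<in>{0..U}. \<bar>f u + g u\<bar> \<le> K + L" by (auto intro!: order_trans[OF abs_triangle_ineq] add_mono)
  then show "\<exists>K. \<forall>u\<in>{0..U}. \<bar>f u + g u\<bar> \<le> K" by blast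
qed

lemma bounded_runs_continuous:
  assumes "continuous_on {0..} f"
  shows "bounded_runs f"
  unfolding bounded_runs_def
proof
  fix U
  have "compact ((\<lambda>u. \<bar>f u\<bar>) ` {0..U})"
    by (intro compact_continuous_image continuous_intros continuous_on_subset[OF assms]) auto
  then have "bounded ((\<lambda>u. \<bar>f u\<bar>) ` {0..U})" by (rule compact_imp_bounded)
  then show "\<exists>K. \<forall>u\<in>{0..U}. \<bar>f u\<bar> \<le> K" by (auto simp: bounded_iff)
qed

lemma run_max_cmult: "0 \<le> c \<Longrightarrow> bounded_runs f \<Longrightarrow> 0 \<le> U \<Longrightarrow> run_max (\<lambda>u. c * f u) U = c * run_max f U"
proof (cases "c = 0")
  case False
  assume c: "0 \<le> c" "bounded_runs f" "0 \<le> U"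
  have "c * run_max f U \<le> run_max (\<lambda>u. c * f u) U"
  proof -
    have "bounded_runs (\<lambda>u. c * f u)"
      using c unfolding bounded_runs_def by (metis abs_mult abs_of_nonneg mult_left_mono)
    then have "\<bar>f u\<bar> \<le> run_max (\<lambda>u. c * f u) U / c" if "0 \<le> u" "u \<le> U" for u
      using run_max_upper[of "\<lambda>u. c * f u" u U] that c False by (simp add: abs_mult field_simps)
    then have "run_max f U \<le> run_max (\<lambda>u. c * f u) U / c" using c by (intro run_max_le) auto
    then show ?thesis using c False by (simp add: field_simps)
  qed
  moreover have "run_max (\<lambda>u. c * f u) U \<le> c * run_max f U"
    using c by (intro run_max_le) (auto simp: abs_mult intro!: mult_left_mono run_max_upper)
  ultimately show ?thesis by simp
qed (auto simp: run_max_def)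

lemma run_max_uminus: "run_max (\<lambda>u. - f u) U = run_max f U"
  by (simp add: run_max_def)

text \<open>The pointwise estimate is available only beyond some \<open>u1\<close>; the initial
  segment contributes a constant, which the nonnegative exponent absorbs.\<close>

lemma run_max_diff_bigo:
  assumes fg: "(\<lambda>u. f u - g u) \<in> O(\<lambda>u. u powr \<gamma>)" and \<gamma>: "0 \<le> \<gamma>"
    and f: "bounded_runs f" and g: "bounded_runs g"
  shows "(\<lambda>U. run_max f U - run_max g U) \<in> O(\<lambda>U. U powr \<gamma>)"
proof -
  obtain C where C: "0 < C" "\<forall>\<^sub>F u in at_top. norm (f u - g u) \<le> C * norm (u powr \<gamma>)"
    using fg by (auto elim: landau_o.bigE)
  then obtain u1 where u1: "\<And>u. u1 \<le> u \<Longrightarrow> \<bar>f u - g u\<bar> \<le> C * u powr \<gamma>"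
    by (auto simp: eventually_at_top_linorder)
  obtain Kf Kg where K: "\<And>u. 0 \<le> u \<Longrightarrow> u \<le> u1 \<Longrightarrow> \<bar>f u\<bar> \<le> Kf" "\<And>u. 0 \<le> u \<Longrightarrow> u \<le> u1 \<Longrightarrow> \<bar>g u\<bar> \<le> Kg"
    using f g unfolding bounded_runs_def by (metis atLeastAtMost_iff)
  define K where "K = \<bar>Kf\<bar> + \<bar>Kg\<bar>"
  have d: "\<bar>f u - g u\<bar> \<le> (K + C) * U powr \<gamma>" if u: "0 \<le> u" "u \<le> U" and U: "1 \<le> U" for u U
  proof (cases "u \<le> u1")
    case True
    then have "\<bar>f u - g u\<bar> \<le> K" using K[of u] u unfolding K_def by linarith
    also have "\<dots> \<le> K * U powr \<gamma>"
      using U \<gamma> mult_left_mono[of 1 "U powr \<gamma>" K] by (simp add: K_def ge_one_powr_ge_zero)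
    also have "\<dots> \<le> (K + C) * U powr \<gamma>" using C by (intro mult_right_mono) auto
    finally show ?thesis .
  next
    case False
    then have "\<bar>f u - g u\<bar> \<le> C * u powr \<gamma>" by (intro u1) auto
    also have "\<dots> \<le> (K + C) * U powr \<gamma>"
      using u \<gamma> C by (intro mult_mono powr_mono2) (auto simp: K_def)
    finally show ?thesis .
  qed
  show ?thesis
  proof (rule landau_o.bigI[of "K + C"])
    show "0 < K + C" using C by (simp add: K_def)
    show "\<forall>\<^sub>F U in at_top. norm (run_max f U - run_max g U) \<le> (K + C) * norm (U powr \<gamma>)"
      using eventually_ge_at_top[of 1]
    proof eventually_elim
      case (elim U)
      have "run_max f U \<le> run_max g U + (K + C) * U powr \<gamma>"
      proof (rule run_max_le)
        fix u assume "0 \<le> u" "u \<le> U"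
        then show "\<bar>f u\<bar> \<le> run_max g U + (K + C) * U powr \<gamma>"
          using d[of u U] run_max_upper[OF g, of u U] elim by linarith
      qed (use elim in auto)
      moreover have "run_max g U \<le> run_max f U + (K + C) * U powr \<gamma>"
      proof (rule run_max_le)
        fix u assume "0 \<le> u" "u \<le> U"
        then show "\<bar>g u\<bar> \<le> run_max f U + (K + C) * U powr \<gamma>"
          using d[of u U] run_max_upper[OF f, of u U] elim by linarith
      qed (use elim in auto)
      ultimately show ?case by auto
    qed
  qed
qed

text \<open>Made for \<open>limsup_value\<close>, where h comes from the law of the iterated
  logarithm and oscillates below its limsup 1, while g carries all convergent factors.\<close>

lemma Limsup_mult_tendsto:
  fixes g h :: "real \<Rightarrow> real"
  assumes g: "(g \<longlongrightarrow> k) at_top" and k: "0 < k"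
    and up: "\<And>c. 1 < c \<Longrightarrow> \<forall>\<^sub>F x in at_top. h x \<le> c"
    and lo: "\<And>c. 0 < c \<Longrightarrow> c < 1 \<Longrightarrow> \<exists>\<^sub>F x in at_top. c \<le> h x"
  shows "Limsup at_top (\<lambda>x. ereal (g x * h x)) = ereal k"
proof (rule antisym)
  have g0: "\<forall>\<^sub>F x in at_top. 0 < g x" using order_tendstoD(1)[OF g k] .
  show "Limsup at_top (\<lambda>x. ereal (g x * h x)) \<le> ereal k"
  proof (rule ereal_le_epsilon2)
    fix e :: real assume e: "0 < e"
    have "((\<lambda>c. (k + (c - 1)) * c) \<longlongrightarrow> (k + (1 - 1)) * 1) (at_right 1)" by (intro tendsto_intros)
    then have "\<forall>\<^sub>F c in at_right 1. (k + (c - 1)) * c < k + e"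
      by (rule order_tendstoD(2)) (use e in simp)
    moreover have "\<forall>\<^sub>F c in at_right (1::real). 1 < c" by (simp add: eventually_at_right_less)
    ultimately have "\<forall>\<^sub>F c in at_right 1. (k + (c - 1)) * c < k + e \<and> 1 < c" by eventually_elim auto
    then obtain c where c: "1 < c" "(k + (c - 1)) * c < k + e"
      using eventually_happens'[of "at_right (1::real)"] by auto
    have "\<forall>\<^sub>F x in at_top. g x < k + (c - 1)" using g by (rule order_tendstoD(2)) (use c in simp)
    then have "\<forall>\<^sub>F x in at_top. ereal (g x * h x) \<le> ereal k + ereal e"
      using g0 up[OF c(1)]
    proof eventually_elim
      case (elim x)
      have "g x * h x \<le> g x * c" using elim by (intro mult_left_mono) auto
      also have "\<dots> \<le> (k + (c - 1)) * c" using elim c by (intro mult_right_mono) auto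
      finally show ?case using c by simp
    qed
    then show "Limsup at_top (\<lambda>x. ereal (g x * h x)) \<le> ereal k + ereal e" by (rule Limsup_bounded)
  qed
  show "ereal k \<le> Limsup at_top (\<lambda>x. ereal (g x * h x))"
  proof (rule ccontr)
    assume "\<not> ereal k \<le> Limsup at_top (\<lambda>x. ereal (g x * h x))"
    then have "Limsup at_top (\<lambda>x. ereal (g x * h x)) < ereal k" by simp
    then obtain z where z: "Limsup at_top (\<lambda>x. ereal (g x * h x)) < ereal z" "ereal z < ereal k"
      using ereal_dense2 by blast
    \<comment> \<open>Truncation at 0 keeps \<open>r / c\<close> nonnegative, so that the eventual
      lower bound \<open>r / c < g x\<close> makes g positive and may be multiplied by h.\<close>
    define r where "r = max z 0"
    have r: "0 \<le> r" "r < k" using z(2) k by (auto simp: r_def)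
    have ev: "\<forall>\<^sub>F x in at_top. g x * h x \<le> r"
      using Limsup_lessD[OF z(1)] by eventually_elim (simp add: r_def)
    have "r / k < 1" using r k by simp
    then obtain c where c: "r / k < c" "c < 1" using dense by blast
    moreover have "0 \<le> r / k" using r k by simp
    ultimately have c0: "0 < c" by linarith
    have rc: "r / c < k" using c(1) c0 k by (simp add: pos_divide_less_eq mult.commute)
    have "\<forall>\<^sub>F x in at_top. r / c < g x" using g rc by (rule order_tendstoD(1))
    then have "\<forall>\<^sub>F x in at_top. \<not> c \<le> h x"
      using ev
    proof eventually_elim
      case (elim x)
      show ?case
      proof
        assume "c \<le> h x"
        have "r / c * c < g x * c" using elim(1) c0 by (intro mult_strict_right_mono) auto
        also have "\<dots> \<le> g x * h x"
          using \<open>c \<le> h x\<close> less_le_trans[OF _ less_imp_le[OF elim(1)], of 0] elim(1) divide_nonneg_pos[OF r(1) c0]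
          by (intro mult_left_mono) linarith+
        finally show False using elim c0 by simp
      qed
    qed
    then show False using lo[OF c0 c(2)] by (simp add: frequently_def)
  qed
qed

section \<open>First passage asymptotics along a fixed path\<close>

lemma eventually_in_double: "\<forall>\<^sub>F T in at_top. T \<in> {0..2 * T::real}"
  using eventually_ge_at_top[of "0::real"] by eventually_elim auto

text \<open>The lower bound on \<open>b\<close> leaves room for the exponent \<open>5/32\<close> of the oscillation of \<open>w\<close> over lags of order \<open>T\<close> to the power \<open>5/16\<close>.\<close>
locale renewal_path =
  fixes w :: "real \<Rightarrow> real" and y :: "nat \<Rightarrow> real" and \<mu> \<sigma> b :: real and S N Q :: "real \<Rightarrow> real"
  assumes \<mu>: "0 < \<mu>" and \<sigma>: "0 < \<sigma>" and b: "3 / 16 \<le> b" "b < 1 / 4"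
    and cont: "continuous_on {0..} w" and w0: "w 0 = 0"
    and crude: "\<forall>\<^sub>F U in at_top. \<forall>h\<ge>1. osc_le w U h (2 * sqrt (h * ln U))"
    and approx: "(\<lambda>T. run_max (\<lambda>t. S t - \<mu> * t - \<sigma> * w t) T) \<in> O(\<lambda>T. T powr b)"
    and S_def: "\<And>t. S t = (\<Sum>i = 1..nat \<lfloor>t\<rfloor>. y i)"
    and N_def: "\<And>t. N t = Inf {s. 1 \<le> s \<and> S s > t}"
    and Q_def: "\<And>t. Q t = S t + \<mu> * N (\<mu> * t) - 2 * \<mu> * t"
begin

definition R :: "real \<Rightarrow> real" where
  "R t = S t - \<mu> * t - \<sigma> * w t"

text \<open>The rule behind all exponents: closeness of two times to order \<gamma> becomes
  closeness of the path values to any order above half of it, the gap absorbing the logarithm of the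
  modulus.\<close>

lemma osc_bigo:
  assumes fg: "\<forall>\<^sub>F T in at_top. f T \<in> {0..2 * T}" "\<forall>\<^sub>F T in at_top. g T \<in> {0..2 * T}"
    and d: "(\<lambda>T. f T - g T) \<in> O(\<lambda>T. T powr \<gamma>)" and \<gamma>: "0 \<le> \<gamma>" "\<gamma> / 2 < \<gamma>'"
  shows "(\<lambda>T. w (f T) - w (g T)) \<in> O(\<lambda>T. T powr \<gamma>')"
proof -
  obtain C where C: "0 < C" "\<forall>\<^sub>F u in at_top. norm (f u - g u) \<le> C * norm (u powr \<gamma>)"
    using d by (auto elim: landau_o.bigE)
  \<comment> \<open>The crude modulus speaks of lags of at least 1 only.\<close>
  define D where "D = max C 1"
  have D: "0 < D" "1 \<le> D" "C \<le> D" by (auto simp: D_def)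
  have "\<forall>\<^sub>F T in at_top. norm (w (f T) - w (g T)) \<le> 1 * norm (2 * sqrt (D * T powr \<gamma> * ln T))"
    using C(2) crude fg eventually_ge_at_top[of 1]
  proof eventually_elim
    case (elim T)
    have h: "1 \<le> D * T powr \<gamma>"
      using mult_mono[of 1 D 1 "T powr \<gamma>"] D elim \<gamma> by (simp add: ge_one_powr_ge_zero)
    have "\<bar>f T - g T\<bar> \<le> D * T powr \<gamma>" using elim D by (simp add: order_trans[OF _ mult_right_mono])
    then have "\<bar>w (f T) - w (g T)\<bar> \<le> 2 * sqrt (D * T powr \<gamma> * ln T)" using elim h by blast
    then show ?case by simp
  qed
  then have "(\<lambda>T. w (f T) - w (g T)) \<in> O(\<lambda>T. 2 * sqrt (D * T powr \<gamma> * ln T))" by (rule bigoI)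
  also have "(\<lambda>T. 2 * sqrt (D * T powr \<gamma> * ln T)) \<in> O(\<lambda>T. T powr \<gamma>')"
    using D(1) \<gamma>(2) by real_asymp
  finally show ?thesis .
qed

lemma S_bounded_runs: "bounded_runs S"
  unfolding bounded_runs_def
proof (intro allI exI ballI)
  fix U u :: real assume "u \<in> {0..U}"
  then have "nat \<lfloor>u\<rfloor> \<le> nat \<lfloor>U\<rfloor>" by (auto intro!: nat_mono floor_mono)
  have "\<bar>S u\<bar> \<le> (\<Sum>i = 1..nat \<lfloor>u\<rfloor>. \<bar>y i\<bar>)" unfolding S_def by (rule sum_abs)
  also have "\<dots> \<le> (\<Sum>i = 1..nat \<lfloor>U\<rfloor>. \<bar>y i\<bar>)" using \<open>nat \<lfloor>u\<rfloor> \<le> _\<close> by (intro sum_mono2) auto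
  finally show "\<bar>S u\<bar> \<le> (\<Sum>i = 1..nat \<lfloor>U\<rfloor>. \<bar>y i\<bar>)" .
qed

lemma R_bounded_runs: "bounded_runs R"
proof -
  have "bounded_runs (\<lambda>t. - \<mu> * t + (- \<sigma>) * w t)"
    by (intro bounded_runs_continuous continuous_intros cont)
  from bounded_runs_add[OF S_bounded_runs this] show ?thesis by (simp add: R_def[abs_def] algebra_simps)
qed

lemma R_bigo:
  assumes f: "\<forall>\<^sub>F T in at_top. f T \<in> {0..2 * T}"
  shows "(\<lambda>T. R (f T)) \<in> O(\<lambda>T. T powr b)"
proof -
  have "(\<lambda>T. run_max R T) \<in> O(\<lambda>T. T powr b)" using approx by (simp add: R_def[abs_def])
  then have "(\<lambda>T. run_max R (2 * T)) \<in> O(\<lambda>T. (2 * T) powr b)"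
    by (rule landau_o.big.compose) real_asymp
  also have "(\<lambda>T::real. (2 * T) powr b) \<in> O(\<lambda>T. T powr b)" by real_asymp
  finally have *: "(\<lambda>T. run_max R (2 * T)) \<in> O(\<lambda>T. T powr b)" .
  have "(\<lambda>T. R (f T)) \<in> O(\<lambda>T. run_max R (2 * T))"
  proof (rule bigoI[of _ 1])
    show "\<forall>\<^sub>F T in at_top. norm (R (f T)) \<le> 1 * norm (run_max R (2 * T))"
      using f
    proof eventually_elim
      case (elim T)
      then show ?case using run_max_upper[OF R_bounded_runs, of "f T" "2 * T"] by auto
    qed
  qed
  then show ?thesis using * by (rule landau_o.big_trans)
qed

lemma S_eq: "S t = \<mu> * t + \<sigma> * w t + R t" by (simp add: R_def)

text \<open>Comparison with time 0, a lag of order T. The 9/16 is a convenient number above 1/2 from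
  which two more halvings, with some slack each, end at 3/16.\<close>

lemma w_bigo:
  assumes f: "\<forall>\<^sub>F T in at_top. f T \<in> {0..2 * T}"
  shows "(\<lambda>T. w (f T)) \<in> O(\<lambda>T. T powr (9 / 16))"
proof -
  have "(\<lambda>T. w (f T) - w 0) \<in> O(\<lambda>T. T powr (9 / 16))"
  proof (rule osc_bigo[of f "\<lambda>_. 0" 1])
    show "\<forall>\<^sub>F T in at_top. (0::real) \<in> {0..2 * T}" using eventually_ge_at_top[of 0] by eventually_elim auto
    show "(\<lambda>T. f T - 0) \<in> O(\<lambda>T. T powr 1)"
      using f by (intro bigoI[of _ 2]) (auto elim!: eventually_mono)
  qed (use f in auto)
  then show ?thesis by (simp add: w0)
qed

text \<open>Ensures that level \<open>\<mu> * T\<close> is passed by time \<open>2 * T\<close>, so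
  the set defining \<open>N\<close> is nonempty and \<open>N (\<mu> * T)\<close> stays inside the
  window of the modulus.\<close>

lemma S_large: "\<forall>\<^sub>F T in at_top. \<mu> * T < S (2 * T)"
proof -
  have f: "\<forall>\<^sub>F T in at_top. 2 * T \<in> {0..2 * T :: real}"
    using eventually_ge_at_top[of 0] by eventually_elim auto
  have "(\<lambda>T. \<sigma> * w (2 * T) + R (2 * T)) \<in> O(\<lambda>T. T powr (9 / 16))"
  proof (intro sum_in_bigo)
    show "(\<lambda>T. \<sigma> * w (2 * T)) \<in> O(\<lambda>T. T powr (9 / 16))"
      using w_bigo[OF f] by simp
    have "(\<lambda>T. R (2 * T)) \<in> O(\<lambda>T. T powr b)" by (rule R_bigo[OF f])
    also have "(\<lambda>T. T powr b) \<in> O(\<lambda>T. T powr (9 / 16))" using b by real_asymp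
    finally show "(\<lambda>T. R (2 * T)) \<in> O(\<lambda>T. T powr (9 / 16))" .
  qed
  also have "(\<lambda>T. T powr (9 / 16)) \<in> o(\<lambda>T::real. T)" by real_asymp
  finally have "\<forall>\<^sub>F T in at_top. norm (\<sigma> * w (2 * T) + R (2 * T)) \<le> \<mu> / 2 * norm T"
    using \<mu> by (intro landau_o.smallD) auto
  then show ?thesis
    using eventually_gt_at_top[of 0]
  proof eventually_elim
    case (elim T)
    have "\<mu> / 2 * T < \<mu> * T" using elim \<mu> by simp
    moreover have "\<bar>\<sigma> * w (2 * T) + R (2 * T)\<bar> \<le> \<mu> / 2 * T" using elim by simp
    moreover have "S (2 * T) = 2 * (\<mu> * T) + (\<sigma> * w (2 * T) + R (2 * T))" by (simp add: S_eq[of "2 * T"])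
    ultimately show ?case by linarith
  qed
qed

text \<open>\<open>S\<close> is constant between consecutive integers, so the infimum over real
  times is a minimum attained at an integer.\<close>

lemma first_passage_attained:
  assumes s: "1 \<le> s" "x < S s"
  obtains n :: nat where "1 \<le> n" "N x = real n" "x < S (real n)"
    "\<And>s. 1 \<le> s \<Longrightarrow> s < real n \<Longrightarrow> S s \<le> x" "real n \<le> s"
proof -
  have Sf: "S t = S (real (nat \<lfloor>t\<rfloor>))" for t by (simp add: S_def)
  define P where "P n \<longleftrightarrow> 1 \<le> n \<and> x < S (real n)" for n :: nat
  have P: "P (nat \<lfloor>t\<rfloor>)" if "1 \<le> t" "x < S t" for t
    using that Sf[of t] by (auto simp: P_def le_nat_iff le_floor_iff)
  define n where "n = (LEAST n. P n)"
  have n: "P n" unfolding n_def using P[OF s] by (rule LeastI)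
  have nle: "real n \<le> t" if "1 \<le> t" "x < S t" for t
  proof -
    have "n \<le> nat \<lfloor>t\<rfloor>" unfolding n_def using P[OF that] by (rule Least_le)
    then show ?thesis using that by linarith
  qed
  have "N x = real n"
    unfolding N_def using n nle by (intro cInf_eq_minimum) (auto simp: P_def)
  moreover have "S t \<le> x" if "1 \<le> t" "t < real n" for t
    using nle[OF that(1)] that by fastforce
  ultimately show ?thesis using n nle[OF s] by (intro that[of n]) (auto simp: P_def)
qed

lemma S_unbounded: "\<exists>s\<ge>1. x < S s"
proof -
  have "\<forall>\<^sub>F T in at_top. \<mu> * T < S (2 * T) \<and> x / \<mu> < T \<and> 1 < T"
    using S_large eventually_gt_at_top[of "x / \<mu>"] eventually_gt_at_top[of 1] by eventually_elim auto
  then obtain T where "\<mu> * T < S (2 * T)" "x / \<mu> < T" "1 < T"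
    using eventually_happens'[of "at_top :: real filter"] by auto
  then show ?thesis using \<mu> by (intro exI[of _ "2 * T"]) (auto simp: field_simps)
qed

lemma N_bounded_runs: "bounded_runs N"
  unfolding bounded_runs_def
proof
  fix U
  obtain s where s: "1 \<le> s" "U < S s" using S_unbounded by blast
  have "\<bar>N u\<bar> \<le> s" if u: "u \<in> {0..U}" for u
  proof -
    have "u < S s" using u s by auto
    from first_passage_attained[OF s(1) this] show ?thesis by (metis abs_of_nat)
  qed
  then show "\<exists>K. \<forall>u\<in>{0..U}. \<bar>N u\<bar> \<le> K" by blast
qed

lemma overshoot:
  "\<forall>\<^sub>F T in at_top. 1 \<le> N (\<mu> * T) - 1 \<and> N (\<mu> * T) \<le> 2 * T \<and> \<mu> * T < S (N (\<mu> * T)) \<and> S (N (\<mu> * T) - 1) \<le> \<mu> * T"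
  using S_large eventually_ge_at_top[of 1] eventually_ge_at_top[of "S 1 / \<mu>"]
proof eventually_elim
  case (elim T)
  obtain n where n: "1 \<le> n" "N (\<mu> * T) = real n" "\<mu> * T < S (real n)"
    "\<And>s. 1 \<le> s \<Longrightarrow> s < real n \<Longrightarrow> S s \<le> \<mu> * T" "real n \<le> 2 * T"
    using first_passage_attained[of "2 * T" "\<mu> * T"] elim by auto
  \<comment> \<open>A passage at time 1 must be excluded: the preceding time 0 lies outside the
    range of the infimum, and minimality would say nothing about \<open>S\<close> there.\<close>
  have "S 1 \<le> \<mu> * T" using elim \<mu> by (simp add: field_simps)
  then have "n \<noteq> 1" using n(3) by auto
  then have "1 \<le> real n - 1" using n(1) by linarith
  then show ?case using n by auto
qed

text \<open>The overshoot is at most the last jump of \<open>S\<close>, which consists of \<mu>,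
  \<sigma> times an increment of w over unit time, and two values of \<open>R\<close>; each is of
  order \<open>T powr b\<close>.\<close>

lemma passage_error:
  "(\<lambda>T. \<mu> * N (\<mu> * T) - \<mu> * T + \<sigma> * w (N (\<mu> * T))) \<in> O(\<lambda>T. T powr b)"
proof -
  let ?n = "\<lambda>T. N (\<mu> * T)"
  have f: "\<forall>\<^sub>F T in at_top. ?n T \<in> {0..2 * T}" "\<forall>\<^sub>F T in at_top. ?n T - 1 \<in> {0..2 * T}"
    using overshoot by (eventually_elim; auto)+
  have "(\<lambda>T. S (?n T) - \<mu> * T) \<in> O(\<lambda>T. \<mu> + \<sigma> * (w (?n T) - w (?n T - 1)) + (R (?n T) - R (?n T - 1)))"
  proof (rule bigoI[of _ 1])
    show "\<forall>\<^sub>F T in at_top. norm (S (?n T) - \<mu> * T) \<le>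
        1 * norm (\<mu> + \<sigma> * (w (?n T) - w (?n T - 1)) + (R (?n T) - R (?n T - 1)))"
      using overshoot
    proof eventually_elim
      case (elim T)
      have "S (?n T) - S (?n T - 1) = \<mu> + \<sigma> * (w (?n T) - w (?n T - 1)) + (R (?n T) - R (?n T - 1))"
        unfolding S_eq[of "?n T"] S_eq[of "?n T - 1"] by (simp add: algebra_simps)
      then show ?case using elim by auto
    qed
  qed
  also have "(\<lambda>T. \<mu> + \<sigma> * (w (?n T) - w (?n T - 1)) + (R (?n T) - R (?n T - 1))) \<in> O(\<lambda>T. T powr b)"
  proof (intro sum_in_bigo R_bigo f)
    show "(\<lambda>T. \<mu>) \<in> O(\<lambda>T. T powr b)" using b by real_asymp
    have "(\<lambda>T. w (?n T) - w (?n T - 1)) \<in> O(\<lambda>T. T powr b)"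
      by (rule osc_bigo[OF f, of 0]) (use b in \<open>simp_all\<close>)
    then show "(\<lambda>T. \<sigma> * (w (?n T) - w (?n T - 1))) \<in> O(\<lambda>T. T powr b)" by simp
  qed
  finally have "(\<lambda>T. (S (?n T) - \<mu> * T) - R (?n T)) \<in> O(\<lambda>T. T powr b)"
    using R_bigo[OF f(1)] by (rule sum_in_bigo(2))
  moreover have "(S (?n T) - \<mu> * T) - R (?n T) = \<mu> * ?n T - \<mu> * T + \<sigma> * w (?n T)" for T
    by (simp add: S_eq[of "N _"])
  ultimately show ?thesis by (simp only:)
qed

text \<open>A bootstrap. The size of w places N within order 9/16 of T; hence w at N and at T agree
  to order 5/16; hence N is within order 5/16 of \<open>T - \<sigma> / \<mu> * w T\<close>, and w at
  these two times agrees to order 3/16, at most b.\<close>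

lemma passage_asymp:
  shows "(\<lambda>T. \<mu> * N (\<mu> * T) - \<mu> * T + \<sigma> * w T) \<in> O(\<lambda>T. T powr (5 / 16))" (is ?A)
    and "\<forall>\<^sub>F T in at_top. T - \<sigma> / \<mu> * w T \<in> {0..2 * T}" (is ?B)
    and "(\<lambda>T. w (N (\<mu> * T)) - w (T - \<sigma> / \<mu> * w T)) \<in> O(\<lambda>T. T powr b)" (is ?C)
proof -
  let ?n = "\<lambda>T. N (\<mu> * T)"
  have f: "\<forall>\<^sub>F T in at_top. ?n T \<in> {0..2 * T}"
    using overshoot by eventually_elim auto
  have b1: "(\<lambda>T. T powr b) \<in> O(\<lambda>T. T powr (9 / 16))" using b by real_asymp
  have b2: "(\<lambda>T. T powr b) \<in> O(\<lambda>T. T powr (5 / 16))" using b by real_asymp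
  have "(\<lambda>T. (\<mu> * ?n T - \<mu> * T + \<sigma> * w (?n T)) - \<sigma> * w (?n T)) \<in> O(\<lambda>T. T powr (9 / 16))"
    by (rule sum_in_bigo(2)[OF landau_o.big_trans[OF passage_error b1]]) (use w_bigo[OF f] in simp)
  then have "(\<lambda>T. \<mu> * (?n T - T)) \<in> O(\<lambda>T. T powr (9 / 16))" by (simp add: algebra_simps)
  then have "(\<lambda>T. ?n T - T) \<in> O(\<lambda>T. T powr (9 / 16))" using \<mu> by simp
  then have o: "(\<lambda>T. w (?n T) - w T) \<in> O(\<lambda>T. T powr (5 / 16))"
    by (rule osc_bigo[OF f eventually_in_double]) auto
  have "(\<lambda>T. (\<mu> * ?n T - \<mu> * T + \<sigma> * w (?n T)) - \<sigma> * (w (?n T) - w T)) \<in> O(\<lambda>T. T powr (5 / 16))"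
    by (rule sum_in_bigo(2)[OF landau_o.big_trans[OF passage_error b2]]) (use o in simp)
  then show A: ?A by (simp add: algebra_simps)
  have "(\<lambda>T. \<sigma> / \<mu> * w T) \<in> O(\<lambda>T. T powr (9 / 16))"
    using w_bigo[OF eventually_in_double] \<sigma> \<mu> by (subst landau_o.big.cmult_in_iff) auto
  also have "(\<lambda>T. T powr (9 / 16)) \<in> o(\<lambda>T::real. T)" by real_asymp
  finally have "\<forall>\<^sub>F T in at_top. norm (\<sigma> / \<mu> * w T) \<le> 1 * norm T"
    by (intro landau_o.smallD) auto
  then show B: ?B
    using eventually_gt_at_top[of 0]
  proof eventually_elim
    case (elim T)
    have "\<bar>\<sigma> / \<mu> * w T\<bar> \<le> T" using elim by (simp only: real_norm_def abs_of_pos mult_1)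
    then show ?case unfolding abs_le_iff atLeastAtMost_iff by linarith
  qed
  have "(\<lambda>T. 1 / \<mu> * (\<mu> * ?n T - \<mu> * T + \<sigma> * w T)) \<in> O(\<lambda>T. T powr (5 / 16))"
    using A by (subst landau_o.big.cmult_in_iff) (use \<mu> in auto)
  also have "(\<lambda>T. 1 / \<mu> * (\<mu> * ?n T - \<mu> * T + \<sigma> * w T)) = (\<lambda>T. ?n T - (T - \<sigma> / \<mu> * w T))"
    using \<mu> by (auto simp: field_simps)
  finally have "(\<lambda>T. w (?n T) - w (T - \<sigma> / \<mu> * w T)) \<in> O(\<lambda>T. T powr (3 / 16))"
    by (rule osc_bigo[OF f B]) auto
  also have "(\<lambda>T. T powr (3 / 16)) \<in> O(\<lambda>T. T powr b)"
    using b by (intro bigoI[of _ 1] eventually_mono[OF eventually_ge_at_top[of 1]]) (simp add: powr_mono)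
  finally show ?C .
qed

text \<open>\<open>Q T\<close> equals the passage error plus \<open>R T\<close> plus \<sigma> times
  \<open>w T - w (N (\<mu> * T))\<close>: the fluctuations of the sum and of the passage time cancel
  up to an increment of w.\<close>

lemma Q_asymp: "(\<lambda>T. Q T - \<sigma> * (w T - w (T - \<sigma> / \<mu> * w T))) \<in> O(\<lambda>T. T powr b)"
proof -
  have "(\<lambda>T. (\<mu> * N (\<mu> * T) - \<mu> * T + \<sigma> * w (N (\<mu> * T))) + R T
      - \<sigma> * (w (N (\<mu> * T)) - w (T - \<sigma> / \<mu> * w T))) \<in> O(\<lambda>T. T powr b)"
    by (rule sum_in_bigo(2)[OF sum_in_bigo(1)[OF passage_error R_bigo[OF eventually_in_double]]]) (use passage_asymp(3) in simp)
  moreover have "(\<mu> * N (\<mu> * T) - \<mu> * T + \<sigma> * w (N (\<mu> * T))) + R T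
      - \<sigma> * (w (N (\<mu> * T)) - w (T - \<sigma> / \<mu> * w T)) = Q T - \<sigma> * (w T - w (T - \<sigma> / \<mu> * w T))" for T
    by (simp only: Q_def R_def right_diff_distrib)
  ultimately show ?thesis by (simp only:)
qed

lemma Q_bounded_runs: "bounded_runs Q"
proof -
  have "bounded_runs (\<lambda>t. \<mu> * N (\<mu> * t))"
    unfolding bounded_runs_def
  proof
    fix U
    obtain K where K: "\<And>u. u \<in> {0..\<mu> * U} \<Longrightarrow> \<bar>N u\<bar> \<le> K"
      using N_bounded_runs unfolding bounded_runs_def by blast
    have "\<bar>\<mu> * N (\<mu> * u)\<bar> \<le> \<mu> * K" if "u \<in> {0..U}" for u
      using K[of "\<mu> * u"] that \<mu> by (auto simp: abs_mult)
    then show "\<exists>K. \<forall>u\<in>{0..U}. \<bar>\<mu> * N (\<mu> * u)\<bar> \<le> K" by blast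
  qed
  then have "bounded_runs (\<lambda>t. S t + \<mu> * N (\<mu> * t))" by (rule bounded_runs_add[OF S_bounded_runs])
  moreover have "bounded_runs (\<lambda>t. - 2 * \<mu> * t)" by (intro bounded_runs_continuous continuous_intros)
  ultimately have "bounded_runs (\<lambda>t. (S t + \<mu> * N (\<mu> * t)) + - 2 * \<mu> * t)" by (rule bounded_runs_add)
  then show ?thesis by (simp add: Q_def[abs_def])
qed

lemma passage_bounded_runs: "bounded_runs (\<lambda>t. \<mu> * N (\<mu> * t) - \<mu> * t)"
proof -
  have "bounded_runs (\<lambda>t. Q t + (- 1) * S t)"
    using Q_bounded_runs S_bounded_runs
    by (intro bounded_runs_add) (auto simp: bounded_runs_def)
  then have "bounded_runs (\<lambda>t. (Q t + (- 1) * S t) + \<mu> * t)"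
    by (rule bounded_runs_add) (intro bounded_runs_continuous continuous_intros)
  then show ?thesis by (simp add: Q_def algebra_simps)
qed

end

section \<open>Oscillation of a path at a random lag\<close>

text \<open>The value 0 at negative times agrees with \<open>zero_ext\<close>; it matters only on an
  initial segment, which running maxima nevertheless include.\<close>

definition lag :: "real \<Rightarrow> (real \<Rightarrow> real) \<Rightarrow> real \<Rightarrow> real" where
  "lag a w u = w u - (if u - a * w u < 0 then 0 else w (u - a * w u))"

lemma lag_bounded_runs:
  assumes a: "0 \<le> a" and w: "bounded_runs w"
  shows "bounded_runs (lag a w)"
  unfolding bounded_runs_def
proof (intro allI exI ballI)
  fix U u :: real assume u: "u \<in> {0..U}"
  then have wu: "\<bar>w u\<bar> \<le> run_max w U" by (intro run_max_upper[OF w]) auto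
  have "\<bar>w (u - a * w u)\<bar> \<le> run_max w (U + a * run_max w U)" if "0 \<le> u - a * w u"
  proof (rule run_max_upper[OF w that])
    have "a * - run_max w U \<le> a * w u" using wu a by (intro mult_left_mono) (auto simp: abs_le_iff)
    then show "u - a * w u \<le> U + a * run_max w U" using u by simp
  qed
  moreover have "0 \<le> run_max w (U + a * run_max w U)"
  proof -
    have "0 \<le> a * run_max w U" using wu a by (intro mult_nonneg_nonneg) auto
    then show ?thesis using u by (intro run_max_nonneg[OF w]) auto
  qed
  ultimately show "\<bar>lag a w u\<bar> \<le> run_max w U + run_max w (U + a * run_max w U)"
    using wu unfolding lag_def by (auto simp: not_less)
qed

text \<open>
  The exponents are admissible in \<open>modulus\<close> and \<open>large_increments\<close>: \<open>1 + 4\<delta> > 2 (1/2 + \<delta>)\<close> for the modulus, and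
  \<open>(1 - 12\<delta>)/2 < (1 - 4\<delta>) - (1/2 + \<delta>)\<close> for the increments. An interval of length
  \<open>U\<close> to the power \<open>1 - 4\<delta>\<close> is so short that \<open>W\<close> varies there by less than its running maximum.
\<close>
locale kiefer_path =
  fixes w :: "real \<Rightarrow> real" and a \<delta> :: real
  assumes a: "0 < a" and \<delta>: "0 < \<delta>" "\<delta> < 1 / 12"
    and cont: "continuous_on {0..} w" and w0: "w 0 = 0"
    and crude: "\<forall>\<^sub>F U in at_top. \<forall>h\<ge>1. osc_le w U h (2 * sqrt (h * ln U))"
    and sharp: "\<forall>\<^sub>F U in at_top. \<forall>h\<ge>U powr (1 / 2 - \<delta>). osc_le w U h (sqrt (1 + 4 * \<delta>) * sqrt (h * ln U))"
    and steps: "\<forall>\<^sub>F n in sequentially. has_steps w (1 / 2 + \<delta>) (1 - 4 * \<delta>) (sqrt (1 - 12 * \<delta>)) n"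
    and long_steps: "\<forall>\<^sub>F n in sequentially. has_steps w (1 - \<delta>) 1 \<delta> n"
begin

lemma w_bounded_runs: "bounded_runs w"
  by (rule bounded_runs_continuous[OF cont])

abbreviation m :: "real \<Rightarrow> real" where "m \<equiv> run_max w"

text \<open>An increment is at most twice the running maximum, and \<open>long_steps\<close>
  provides, for every large n, one over a lag close to \<open>n powr (1 - \<delta>)\<close>. The
  logarithm under the root absorbs the arbitrary constant c.\<close>

lemma max_lower: "\<forall>\<^sub>F U in at_top. c * U powr (1 / 2 - \<delta>) \<le> m U"
proof -
  have fl: "filterlim (\<lambda>U::real. nat \<lfloor>U\<rfloor>) sequentially at_top"
    by (rule filterlim_compose[OF filterlim_nat_sequentially filterlim_floor_sequentially])
  have 1: "\<forall>\<^sub>F U in at_top. c * U powr (1 / 2 - \<delta>) \<le> \<delta> / 2 * sqrt (((U - 1) powr (1 - \<delta>) - 1) * ln (U - 1))"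
    using \<delta> by real_asymp
  have 2: "\<forall>\<^sub>F U in at_top. 2 \<le> (U - 1) powr (1 - \<delta>)" using \<delta> by real_asymp
  show ?thesis
    using 1 2 eventually_compose_filterlim[OF long_steps fl] eventually_ge_at_top[of 3]
  proof eventually_elim
    case (elim U)
    define n where "n = nat \<lfloor>U\<rfloor>"
    have n: "real n \<le> U" "U - 1 \<le> real n" using elim(4) by (auto simp: n_def)
    define h where "h = nat \<lfloor>real n powr (1 - \<delta>)\<rfloor>"
    have pn: "(U - 1) powr (1 - \<delta>) \<le> real n powr (1 - \<delta>)"
      using n elim(4) \<delta> by (intro powr_mono2) auto
    have h: "real h \<le> real n powr (1 - \<delta>)" "real n powr (1 - \<delta>) - 1 \<le> real h" "1 \<le> h"
      using pn elim(2) unfolding h_def by (auto simp: le_nat_iff)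
    obtain u where u: "0 \<le> u" "u + real h \<le> real n powr 1"
      "\<delta> * sqrt (real h * ln (real n)) \<le> w (u + real h) - w u"
      using elim(3)[folded n_def, rule_format, OF h(3) h(1), of 0] by auto
    have "real n powr 1 = real n" by simp
    then have uU: "u + real h \<le> U" using u n by simp
    have "(U - 1) powr (1 - \<delta>) - 1 \<le> real h" using pn h by linarith
    moreover have "ln (U - 1) \<le> ln (real n)" "0 \<le> ln (U - 1)" using n elim(4) by auto
    ultimately have "((U - 1) powr (1 - \<delta>) - 1) * ln (U - 1) \<le> real h * ln (real n)"
      using elim(2) by (intro mult_mono) auto
    then have "\<delta> * sqrt (((U - 1) powr (1 - \<delta>) - 1) * ln (U - 1)) \<le> \<delta> * sqrt (real h * ln (real n))"
      using \<delta> by (intro mult_left_mono) auto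
    also have "\<dots> \<le> w (u + real h) - w u" by (rule u)
    also have "\<dots> \<le> 2 * m U"
      using run_max_upper[OF w_bounded_runs, of "u + real h" U] run_max_upper[OF w_bounded_runs, of u U] u uU
      by (auto simp: abs_le_iff)
    finally show ?case using elim(1) by simp
  qed
qed

lemma max_upper: "\<forall>\<^sub>F U in at_top. m U \<le> 2 * sqrt (U * ln U)"
  using crude eventually_ge_at_top[of 1]
proof eventually_elim
  case (elim U)
  show ?case
  proof (rule run_max_le)
    fix u assume u: "0 \<le> u" "u \<le> U"
    have "\<bar>w u - w 0\<bar> \<le> 2 * sqrt (U * ln U)"
      using elim(1)[rule_format, of U u 0] elim(2) u by auto
    then show "\<bar>w u\<bar> \<le> 2 * sqrt (U * ln U)" by (simp add: w0)
  qed (use elim in auto)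
qed

lemma lag_range:
  "\<exists>u0>0. \<forall>u\<ge>u0. 0 \<le> u - a * w u \<and> u - a * w u \<le> 2 * u"
proof -
  have "\<forall>\<^sub>F U in at_top. a * (2 * sqrt (U * ln U)) \<le> U" by real_asymp
  then have "\<forall>\<^sub>F u in at_top. 0 < u \<and> 0 \<le> u - a * w u \<and> u - a * w u \<le> 2 * u"
    using max_upper eventually_gt_at_top[of 0]
  proof eventually_elim
    case (elim u)
    have "\<bar>w u\<bar> \<le> m u" using elim by (intro run_max_upper[OF w_bounded_runs]) auto
    then have "a * \<bar>w u\<bar> \<le> a * (2 * sqrt (u * ln u))" using elim a by (intro mult_left_mono) auto
    then have "\<bar>a * w u\<bar> \<le> u" using elim(1) a unfolding abs_mult by linarith
    then show ?case using elim by (auto simp: abs_le_iff)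
  qed
  then obtain u0 where "\<And>u. u0 \<le> u \<Longrightarrow> 0 < u \<and> 0 \<le> u - a * w u \<and> u - a * w u \<le> 2 * u"
    by (auto simp: eventually_at_top_linorder)
  then show ?thesis by blast
qed

text \<open>The modulus at lag \<open>a * m U\<close>, which is admissible because
  \<open>max_lower\<close> puts it above \<open>U powr (1 / 2 - \<delta>)\<close>. Times below
  \<open>u0\<close>, where the shifted time may be out of range, contribute only a constant.\<close>

lemma lag_upper: "\<forall>\<^sub>F U in at_top. run_max (lag a w) U \<le> sqrt (1 + 4 * \<delta>) * sqrt (a * m U * ln U)"
proof -
  obtain u0 where u0: "0 < u0" "\<And>u. u0 \<le> u \<Longrightarrow> 0 \<le> u - a * w u \<and> u - a * w u \<le> 2 * u"
    using lag_range by blast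
  obtain K where K: "\<And>u. u \<in> {0..u0} \<Longrightarrow> \<bar>lag a w u\<bar> \<le> K"
    using lag_bounded_runs[OF _ w_bounded_runs, of a] a unfolding bounded_runs_def by fastforce
  have "\<forall>\<^sub>F U in at_top. K \<le> sqrt (1 + 4 * \<delta>) * sqrt (U powr (1 / 2 - \<delta>) * ln U)"
    using \<delta> by real_asymp
  then show ?thesis
    using sharp max_lower[of "1 / a"] eventually_ge_at_top[of u0] eventually_ge_at_top[of 1]
  proof eventually_elim
    case (elim U)
    have am: "U powr (1 / 2 - \<delta>) \<le> a * m U" using elim(3) a by (simp add: field_simps)
    show ?case
    proof (rule run_max_le)
      fix u assume u: "0 \<le> u" "u \<le> U"
      show "\<bar>lag a w u\<bar> \<le> sqrt (1 + 4 * \<delta>) * sqrt (a * m U * ln U)"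
      proof (cases "u \<le> u0")
        case True
        then have "\<bar>lag a w u\<bar> \<le> K" using u K by auto
        also have "\<dots> \<le> sqrt (1 + 4 * \<delta>) * sqrt (U powr (1 / 2 - \<delta>) * ln U)" by (rule elim(1))
        also have "\<dots> \<le> sqrt (1 + 4 * \<delta>) * sqrt (a * m U * ln U)"
          using am elim(5) \<delta> by (intro mult_left_mono real_sqrt_le_mono mult_right_mono) auto
        finally show ?thesis .
      next
        case False
        then have r: "0 \<le> u - a * w u" "u - a * w u \<le> 2 * u" using u0(2)[of u] by auto
        have "\<bar>w u\<bar> \<le> m U" using u by (intro run_max_upper[OF w_bounded_runs])
        then have "\<bar>u - (u - a * w u)\<bar> \<le> a * m U" using a by (simp add: abs_mult)
        then have "\<bar>w u - w (u - a * w u)\<bar> \<le> sqrt (1 + 4 * \<delta>) * sqrt (a * m U * ln U)"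
          using elim(2) am r u by auto
        then show ?thesis using r by (simp add: lag_def)
      qed
    qed (use elim in auto)
  qed
qed

text \<open>The loss \<open>2 * sqrt (2 * \<eta>)\<close> is the crude modulus at lag
  \<open>2 * (\<eta> * (a * m U))\<close>, which bounds the mismatch between the true lag and a
  fixed integer h: one half for the variation of w near the maximiser, one half for
  rounding.\<close>

lemma lag_lower:
  assumes \<eta>: "0 < \<eta>" "\<eta> < 1"
  shows "\<forall>\<^sub>F U in at_top. (sqrt (1 - 12 * \<delta>) - 2 * sqrt (2 * \<eta>)) * sqrt (a * m U * ln U) \<le> run_max (lag a w) U"
proof -
  obtain u0 where u0: "0 < u0" "\<And>u. u0 \<le> u \<Longrightarrow> 0 \<le> u - a * w u \<and> u - a * w u \<le> 2 * u"
    using lag_range by blast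
  have fl: "filterlim (\<lambda>U::real. nat \<lceil>U\<rceil>) sequentially at_top"
    by (rule filterlim_compose[OF filterlim_nat_sequentially
          filterlim_at_top_mono[OF filterlim_floor_sequentially]]) (simp add: floor_le_ceiling)
  have 1: "\<forall>\<^sub>F U in at_top. 2 * sqrt (((U + 1) powr (1 - 4 * \<delta>) + 1) * ln U) \<le> \<eta> * U powr (1 / 2 - \<delta>)"
    using \<delta> \<eta> by real_asymp
  have 2: "\<forall>\<^sub>F U in at_top. a * (2 * sqrt (U * ln U)) + 1 \<le> U powr (1 / 2 + \<delta>)"
    using \<delta> a by real_asymp
  have 3: "\<forall>\<^sub>F U in at_top. (U + 1) powr (1 - 4 * \<delta>) \<le> U" using \<delta> by real_asymp
  have 4: "\<forall>\<^sub>F U in at_top. a * ((1 + \<eta>) * (2 * sqrt (U * ln U))) \<le> U" using a \<eta> by real_asymp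
  \<comment> \<open>Yields \<open>u0 \<le> a * m U\<close>, which brings the shifted time into
    range, and \<open>1 \<le> \<eta> * (a * m U)\<close>, which pays for rounding the lag and for
    the condition \<open>h \<ge> 1\<close> in \<open>crude\<close>.\<close>
  have 5: "\<forall>\<^sub>F U in at_top. max u0 (1 / \<eta>) / a \<le> U powr (1 / 2 - \<delta>)" using \<delta> by real_asymp
  show ?thesis
    using 1 2 3 4 5 max_lower[of 1] max_upper crude eventually_compose_filterlim[OF steps fl]
      eventually_ge_at_top[of 3]
  proof eventually_elim
    case (elim U)
    let ?m = "m U" and ?G = "sqrt (a * m U * ln U)"
    have U: "3 \<le> U" "0 \<le> ln U" using elim(10) by auto
    have mlow: "U powr (1 / 2 - \<delta>) \<le> ?m" using elim(6) by simp
    have "max u0 (1 / \<eta>) / a \<le> ?m" using elim(5) mlow by linarith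
    then have amx: "max u0 (1 / \<eta>) \<le> a * ?m" using a by (simp add: field_simps)
    then have am: "u0 \<le> a * ?m" "1 / \<eta> \<le> a * ?m" by auto
    from am(2) have am1: "1 \<le> \<eta> * (a * ?m)" using \<eta> by (simp add: field_simps)
    have am0: "0 < a * ?m" using am(1) u0(1) by linarith
    have m0: "0 < ?m" using am0 a by (simp add: zero_less_mult_iff)
    define n where "n = nat \<lceil>U\<rceil>"
    have n: "U \<le> real n" "real n \<le> U + 1" using U by (auto simp: n_def)
    define L where "L = real n powr (1 - 4 * \<delta>)"
    have LU: "L \<le> (U + 1) powr (1 - 4 * \<delta>)"
      unfolding L_def using n U \<delta> by (intro powr_mono2) auto
    have L: "L \<le> U" "0 \<le> L" using LU elim(3) by (auto simp: L_def)
    obtain x where x: "x \<in> {0..U}" "\<bar>w x\<bar> = ?m"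
    proof -
      have "continuous_on {0..U} (\<lambda>u. \<bar>w u\<bar>)"
        by (intro continuous_intros continuous_on_subset[OF cont]) auto
      then obtain x where "x \<in> {0..U}" "\<And>u. u \<in> {0..U} \<Longrightarrow> \<bar>w u\<bar> \<le> \<bar>w x\<bar>"
        using continuous_attains_sup[of "{0..U}" "\<lambda>u. \<bar>w u\<bar>"] U by auto
      moreover from this have "?m \<le> \<bar>w x\<bar>" using U by (intro run_max_le) auto
      moreover have "\<bar>w x\<bar> \<le> ?m"
        using \<open>x \<in> {0..U}\<close> by (intro run_max_upper[OF w_bounded_runs]) auto
      ultimately show ?thesis by (intro that[of x]) auto
    qed
    \<comment> \<open>The window of length L is placed just before the maximiser and clipped at 0,
      so it stays inside \<open>{0..U}\<close>. Rounding p down adds at most 1 to the distance from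
      x, hence \<open>L + 1\<close> below.\<close>
    define p where "p = nat \<lfloor>max 0 (x - L)\<rfloor>"
    have p: "real p \<le> max 0 (x - L)" "max 0 (x - L) - 1 \<le> real p" unfolding p_def by linarith+
    have pn: "p \<le> n" using p(1) x(1) n L by (simp only: of_nat_le_iff[symmetric, where 'a = real]) auto
    have near: "\<bar>w v - w x\<bar> \<le> \<eta> * ?m \<and> 0 \<le> v \<and> v \<le> U" if v: "real p \<le> v" "v \<le> real p + L" for v
    proof -
      have vU: "0 \<le> v" "v \<le> U" "\<bar>v - x\<bar> \<le> L + 1" using v p x(1) L by (auto simp: max_def abs_le_iff split: if_splits)
      have "\<bar>w v - w x\<bar> \<le> 2 * sqrt ((L + 1) * ln U)"
        using elim(8)[rule_format, of "L + 1" v x] vU x(1) L by auto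
      also have "\<dots> \<le> 2 * sqrt (((U + 1) powr (1 - 4 * \<delta>) + 1) * ln U)"
        using LU U by (intro mult_left_mono real_sqrt_le_mono mult_right_mono) auto
      also have "\<dots> \<le> \<eta> * U powr (1 / 2 - \<delta>)" by (rule elim(1))
      also have "\<dots> \<le> \<eta> * ?m" using mlow \<eta> by (intro mult_left_mono) auto
      finally show ?thesis using vU by simp
    qed
    \<comment> \<open>Rounding up keeps \<open>h\<close> at least \<open>a * m U\<close>, so the
      guaranteed step is no smaller than the target size.\<close>
    define h where "h = nat \<lceil>a * ?m\<rceil>"
    have h: "a * ?m \<le> real h" "real h \<le> a * ?m + 1" using am0 by (auto simp: h_def)
    have h1: "1 \<le> h" using h(1) am0 by (cases h) auto
    have "a * ?m \<le> a * (2 * sqrt (U * ln U))" using elim(7) a by (intro mult_left_mono) auto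
    then have "real h \<le> U powr (1 / 2 + \<delta>)" using h(2) elim(2) by linarith
    also have "\<dots> \<le> real n powr (1 / 2 + \<delta>)" using n U \<delta> by (intro powr_mono2) auto
    finally have h2: "real h \<le> real n powr (1 / 2 + \<delta>)" .
    obtain u where u: "real p \<le> u" "u + real h \<le> real p + L"
      "sqrt (1 - 12 * \<delta>) * sqrt (real h * ln (real n)) \<le> w (u + real h) - w u"
      using elim(9)[folded n_def, rule_format, OF h1 h2 pn] unfolding L_def by blast
    have "?G \<le> sqrt (real h * ln (real n))"
      using h n U am0 by (intro real_sqrt_le_mono mult_mono) auto
    then have "sqrt (1 - 12 * \<delta>) * ?G \<le> sqrt (1 - 12 * \<delta>) * sqrt (real h * ln (real n))"
      using \<delta> by (intro mult_left_mono) auto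
    then have jump: "sqrt (1 - 12 * \<delta>) * ?G \<le> w (u + real h) - w u" using u(3) by linarith
    have small: "\<bar>w s - w t\<bar> \<le> 2 * sqrt (2 * \<eta>) * ?G"
      if "s \<in> {0..2 * U}" "t \<in> {0..2 * U}" "\<bar>s - t\<bar> \<le> 2 * (\<eta> * (a * ?m))" for s t
    proof -
      have "\<bar>w s - w t\<bar> \<le> 2 * sqrt (2 * (\<eta> * (a * ?m)) * ln U)"
        using elim(8)[rule_format, of "2 * (\<eta> * (a * ?m))" s t] am1 that by auto
      also have "\<dots> = 2 * sqrt (2 * \<eta>) * ?G" by (simp add: real_sqrt_mult)
      finally show ?thesis .
    qed
    have close: "\<bar>a * \<bar>w v\<bar> - real h\<bar> \<le> 2 * (\<eta> * (a * ?m))" if "\<bar>w v - w x\<bar> \<le> \<eta> * ?m" for v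
    proof -
      have "\<bar>\<bar>w v\<bar> - ?m\<bar> \<le> \<eta> * ?m" using that x(2) by linarith
      then have "a * \<bar>\<bar>w v\<bar> - ?m\<bar> \<le> a * (\<eta> * ?m)" using a by (intro mult_left_mono) auto
      then have "\<bar>a * (\<bar>w v\<bar> - ?m)\<bar> \<le> \<eta> * (a * ?m)" using a by (simp add: abs_mult mult.left_commute)
      then show ?thesis using h am1 unfolding right_diff_distrib by linarith
    qed
    have \<eta>m: "\<eta> * ?m < ?m" using \<eta> m0 by simp
    have D: "\<bar>lag a w v\<bar> \<le> run_max (lag a w) U" if "0 \<le> v" "v \<le> U" for v
      using that a by (intro run_max_upper lag_bounded_runs w_bounded_runs) auto
    show ?case
    \<comment> \<open>The sign at the maximiser decides at which end of the step the lag is applied.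
      If w is positive there, the shift goes back, from the right end to near the left end; if
      negative, it goes forward, from the left end to near the right end.\<close>
    proof (cases "0 \<le> w x")
      case True
      define v where "v = u + real h"
      have v: "\<bar>w v - w x\<bar> \<le> \<eta> * ?m" "0 \<le> v" "v \<le> U" using near[of v] u by (auto simp: v_def)
      then have "0 < w v" using True x(2) \<eta>m by linarith
      have "u0 \<le> v" using am(1) h(1) u(1) unfolding v_def by linarith
      then have r: "0 \<le> v - a * w v" "v - a * w v \<le> 2 * v" using u0(2) by auto
      have "\<bar>w u - w (v - a * w v)\<bar> \<le> 2 * sqrt (2 * \<eta>) * ?G"
        using close[OF v(1)] \<open>0 < w v\<close> r v u by (intro small) (auto simp: v_def)
      then have "(sqrt (1 - 12 * \<delta>) - 2 * sqrt (2 * \<eta>)) * ?G \<le> w v - w (v - a * w v)"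
        using jump unfolding v_def[symmetric] left_diff_distrib by linarith
      also have "\<dots> \<le> \<bar>lag a w v\<bar>" using r by (simp add: lag_def)
      finally show ?thesis using D[OF v(2,3)] by linarith
    next
      case False
      have v: "\<bar>w u - w x\<bar> \<le> \<eta> * ?m" "0 \<le> u" "u \<le> U" using near[of u] u by auto
      then have wu: "w u < 0" using False x(2) \<eta>m by linarith
      have "- w u \<le> (1 + \<eta>) * ?m" using v x(2) by (simp add: distrib_right)
      also have "\<dots> \<le> (1 + \<eta>) * (2 * sqrt (U * ln U))" using elim(7) \<eta> by (intro mult_left_mono) auto
      finally have "a * (- w u) \<le> a * ((1 + \<eta>) * (2 * sqrt (U * ln U)))" using a by (intro mult_left_mono) auto
      then have r: "0 \<le> u - a * w u" "u - a * w u \<le> 2 * U"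
        using elim(4) v mult_pos_neg[OF a wu] by auto
      have uh: "u + real h \<le> U" "0 \<le> u + real h" using near[of "u + real h"] u by auto
      have "\<bar>w (u + real h) - w (u - a * w u)\<bar> \<le> 2 * sqrt (2 * \<eta>) * ?G"
        using close[OF v(1)] wu r v u uh U by (intro small) (auto simp: abs_le_iff)
      then have "(sqrt (1 - 12 * \<delta>) - 2 * sqrt (2 * \<eta>)) * ?G \<le> w (u - a * w u) - w u"
        using jump unfolding left_diff_distrib by linarith
      also have "\<dots> \<le> \<bar>lag a w u\<bar>" using r by (simp add: lag_def)
      finally show ?thesis using D[OF v(2,3)] by linarith
    qed
  qed
qed

end

section \<open>Limits of ratios of running maxima\<close>

lemma tendsto_frac_close:
  fixes F G :: "real \<Rightarrow> real"
  assumes FG: "(\<lambda>U. F U - k * G U) \<in> O(\<lambda>U. U powr b)" and sm: "((\<lambda>U. U powr b / H U) \<longlongrightarrow> 0) at_top"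
    and G: "((\<lambda>U. G U / H U) \<longlongrightarrow> l) at_top"
  shows "((\<lambda>U. F U / H U) \<longlongrightarrow> k * l) at_top"
proof -
  have "(\<lambda>U. (F U - k * G U) / H U) \<in> O(\<lambda>U. U powr b / H U)"
    using landau_o.big.mult[OF FG landau_o.big_refl[of "\<lambda>U. inverse (H U)"]] by (simp add: divide_inverse)
  then have "((\<lambda>U. (F U - k * G U) / H U) \<longlongrightarrow> 0) at_top"
  proof -
    assume *: "(\<lambda>U. (F U - k * G U) / H U) \<in> O(\<lambda>U. U powr b / H U)"
    have "(\<lambda>U. U powr b / H U) \<in> o(\<lambda>_. 1)" using sm by (intro smalloI_tendsto) auto
    with * have "(\<lambda>U. (F U - k * G U) / H U) \<in> o(\<lambda>_. 1)" by (rule landau_o.big_small_trans)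
    then show ?thesis using smalloD_tendsto by fastforce
  qed
  then have "((\<lambda>U. (F U - k * G U) / H U + k * (G U / H U)) \<longlongrightarrow> 0 + k * l) at_top"
    by (intro tendsto_intros G)
  moreover have "(F U - k * G U) / H U + k * (G U / H U) = F U / H U" for U
    by (simp add: diff_divide_distrib)
  ultimately show ?thesis by (simp add: filterlim_cong)
qed

text \<open>Almost sure properties can be combined over countably many parameters only, so the path
  satisfies \<open>kiefer_path\<close> along one sequence tending to 0.\<close>

locale kiefer_family =
  fixes w :: "real \<Rightarrow> real" and a :: real and \<delta> :: "nat \<Rightarrow> real"
  assumes kiefer: "\<And>n. kiefer_path w a (\<delta> n)" and \<delta>_lim: "\<delta> \<longlonglongrightarrow> 0"
begin

lemma a_pos: "0 < a"
  using kiefer[of 0] by (simp add: kiefer_path_def)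

lemma bounded_w: "bounded_runs w"
  using kiefer[of 0] by (rule kiefer_path.w_bounded_runs)

lemma max_lower: "0 < e \<Longrightarrow> \<forall>\<^sub>F U in at_top. c * U powr (1 / 2 - e) \<le> run_max w U"
proof -
  assume "0 < e"
  have "\<forall>\<^sub>F n in sequentially. \<delta> n < e" by (rule order_tendstoD(2)[OF \<delta>_lim \<open>0 < e\<close>])
  then obtain n where n: "\<delta> n < e" using eventually_happens'[of sequentially] by auto
  show ?thesis
    using kiefer_path.max_lower[OF kiefer[of n], of "\<bar>c\<bar>"] eventually_ge_at_top[of 1]
  proof eventually_elim
    case (elim U)
    have "c * U powr (1 / 2 - e) \<le> \<bar>c\<bar> * U powr (1 / 2 - \<delta> n)"
      using n elim(2) by (intro mult_mono powr_mono) auto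
    then show ?case using elim by linarith
  qed
qed

lemma max_pos: "\<forall>\<^sub>F U in at_top. 0 < run_max w U"
  using max_lower[of "1 / 4" 1, simplified] eventually_gt_at_top[of 0]
proof eventually_elim
  case (elim U)
  have "0 < U powr (1 / 4)" using elim by simp
  then show ?case using elim by linarith
qed

text \<open>For each target c, first \<delta> and then \<eta> is fixed before U grows, so no
  uniformity of the bounds in these parameters is involved.\<close>

lemma lag_ratio: "((\<lambda>U. run_max (lag a w) U / sqrt (a * run_max w U * ln U)) \<longlongrightarrow> 1) at_top"
proof -
  define G where "G U = sqrt (a * run_max w U * ln U)" for U
  have Gp: "\<forall>\<^sub>F U in at_top. 0 < G U"
    using max_pos eventually_gt_at_top[of 1]
    by eventually_elim (use a_pos in \<open>auto simp: G_def\<close>)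
  have "((\<lambda>U. run_max (lag a w) U / G U) \<longlongrightarrow> 1) at_top"
  proof (rule order_tendstoI)
    fix c :: real assume c: "c < 1"
    have "(\<lambda>n. sqrt (1 - 12 * \<delta> n)) \<longlonglongrightarrow> sqrt (1 - 12 * 0)" by (intro tendsto_intros \<delta>_lim)
    then have "\<forall>\<^sub>F n in sequentially. c < sqrt (1 - 12 * \<delta> n)"
      by (rule order_tendstoD(1)) (use c in simp)
    then obtain n where n: "c < sqrt (1 - 12 * \<delta> n)" using eventually_happens'[of sequentially] by auto
    have "((\<lambda>\<eta>. sqrt (1 - 12 * \<delta> n) - 2 * sqrt (2 * \<eta>)) \<longlongrightarrow> sqrt (1 - 12 * \<delta> n) - 2 * sqrt (2 * 0)) (at_right 0)"
      by (intro tendsto_intros)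
    then have "\<forall>\<^sub>F \<eta> in at_right 0. c < sqrt (1 - 12 * \<delta> n) - 2 * sqrt (2 * \<eta>)"
      by (rule order_tendstoD(1)) (use n in simp)
    moreover have "\<forall>\<^sub>F \<eta> in at_right (0::real). 0 < \<eta> \<and> \<eta> < 1"
      unfolding eventually_at_right[OF zero_less_one] by (intro exI[of _ 1]) auto
    ultimately have "\<forall>\<^sub>F \<eta> in at_right 0. c < sqrt (1 - 12 * \<delta> n) - 2 * sqrt (2 * \<eta>) \<and> 0 < \<eta> \<and> \<eta> < 1"
      by eventually_elim auto
    then obtain \<eta> where \<eta>: "c < sqrt (1 - 12 * \<delta> n) - 2 * sqrt (2 * \<eta>)" "0 < \<eta>" "\<eta> < 1"
      using eventually_happens'[of "at_right (0::real)"] by auto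
    show "\<forall>\<^sub>F U in at_top. c < run_max (lag a w) U / G U"
      using kiefer_path.lag_lower[OF kiefer[of n] \<eta>(2,3)] Gp
    proof eventually_elim
      case (elim U)
      have "c * G U < (sqrt (1 - 12 * \<delta> n) - 2 * sqrt (2 * \<eta>)) * G U"
        using \<eta> elim by (intro mult_strict_right_mono) auto
      also have "\<dots> \<le> run_max (lag a w) U" using elim unfolding G_def by simp
      finally show ?case using elim by (simp add: pos_less_divide_eq)
    qed
  next
    fix c :: real assume c: "1 < c"
    have "(\<lambda>n. sqrt (1 + 4 * \<delta> n)) \<longlonglongrightarrow> sqrt (1 + 4 * 0)" by (intro tendsto_intros \<delta>_lim)
    then have "\<forall>\<^sub>F n in sequentially. sqrt (1 + 4 * \<delta> n) < c"
      by (rule order_tendstoD(2)) (use c in simp)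
    then obtain n where n: "sqrt (1 + 4 * \<delta> n) < c" using eventually_happens'[of sequentially] by auto
    show "\<forall>\<^sub>F U in at_top. run_max (lag a w) U / G U < c"
      using kiefer_path.lag_upper[OF kiefer[of n]] Gp
    proof eventually_elim
      case (elim U)
      have "run_max (lag a w) U \<le> sqrt (1 + 4 * \<delta> n) * G U" using elim unfolding G_def by simp
      also have "\<dots> < c * G U" using n elim by (intro mult_strict_right_mono) auto
      finally show ?case using elim by (simp add: pos_divide_less_eq)
    qed
  qed
  then show ?thesis by (simp add: G_def)
qed

end

lemma filterlim_divide_at_top: "0 < \<mu> \<Longrightarrow> filterlim (\<lambda>T::real. T / \<mu>) at_top at_top"
  by real_asymp

lemma SUP_rescale:
  assumes "0 < \<mu>"
  shows "(SUP t\<in>{0..T}. \<bar>f (t / \<mu>)\<bar>) = run_max f (T / \<mu>)"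
proof -
  have "{0..T / \<mu>} = (\<lambda>t. t / \<mu>) ` {0..T}"
  proof (intro equalityI subsetI)
    fix u assume "u \<in> {0..T / \<mu>}"
    then show "u \<in> (\<lambda>t. t / \<mu>) ` {0..T}"
      using assms by (intro image_eqI[of _ _ "\<mu> * u"]) (auto simp: field_simps)
  qed (use assms in \<open>auto simp: divide_right_mono\<close>)
  then show ?thesis by (simp add: run_max_def image_image)
qed

locale renewal_kiefer = renewal_path + kiefer_family w "\<sigma> / \<mu>" \<delta> for \<delta>
begin

text \<open>The centred passage time on the time scale of \<open>Q\<close>, so that both suprema of
  the ratio statement become running maxima at \<open>T / \<mu>\<close>.\<close>

definition P :: "real \<Rightarrow> real" where
  "P t = \<mu> * N (\<mu> * t) - \<mu> * t"

lemma run_max_Q: "(\<lambda>U. run_max Q U - \<sigma> * run_max (lag (\<sigma> / \<mu>) w) U) \<in> O(\<lambda>U. U powr b)"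
proof -
  have lb: "bounded_runs (lag (\<sigma> / \<mu>) w)" using \<sigma> \<mu> by (intro lag_bounded_runs bounded_w) auto
  have "\<forall>\<^sub>F T in at_top. Q T - \<sigma> * (w T - w (T - \<sigma> / \<mu> * w T)) = Q T - \<sigma> * lag (\<sigma> / \<mu>) w T"
    using passage_asymp(2) by eventually_elim (auto simp: lag_def)
  then have "(\<lambda>T. Q T - \<sigma> * lag (\<sigma> / \<mu>) w T) \<in> O(\<lambda>T. T powr b)"
    using Q_asymp by (subst (asm) landau_o.big.in_cong)
  then have "(\<lambda>U. run_max Q U - run_max (\<lambda>T. \<sigma> * lag (\<sigma> / \<mu>) w T) U) \<in> O(\<lambda>U. U powr b)"
  proof (rule run_max_diff_bigo)
    show "bounded_runs (\<lambda>T. \<sigma> * lag (\<sigma> / \<mu>) w T)"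
      using lb \<sigma> unfolding bounded_runs_def by (metis abs_mult abs_of_pos mult_left_mono less_imp_le)
  qed (use Q_bounded_runs b in auto)
  moreover have "\<forall>\<^sub>F U in at_top. run_max Q U - run_max (\<lambda>T. \<sigma> * lag (\<sigma> / \<mu>) w T) U =
      run_max Q U - \<sigma> * run_max (lag (\<sigma> / \<mu>) w) U"
    using eventually_ge_at_top[of 0] by eventually_elim (use \<sigma> lb in \<open>simp add: run_max_cmult\<close>)
  ultimately show ?thesis by (subst (asm) landau_o.big.in_cong)
qed

lemma run_max_P: "(\<lambda>U. run_max P U - \<sigma> * run_max w U) \<in> O(\<lambda>U. U powr (5 / 16))"
proof -
  have "(\<lambda>U. run_max P U - run_max (\<lambda>T. - (\<sigma> * w T)) U) \<in> O(\<lambda>U. U powr (5 / 16))"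
  proof (rule run_max_diff_bigo)
    show "(\<lambda>T. P T - - (\<sigma> * w T)) \<in> O(\<lambda>T. T powr (5 / 16))"
      using passage_asymp(1) by (simp add: P_def)
    show "bounded_runs P" using passage_bounded_runs by (simp add: P_def[abs_def])
    show "bounded_runs (\<lambda>T. - (\<sigma> * w T))" by (intro bounded_runs_continuous continuous_intros cont)
  qed auto
  moreover have "\<forall>\<^sub>F U in at_top. run_max P U - run_max (\<lambda>T. - (\<sigma> * w T)) U =
      run_max P U - \<sigma> * run_max w U"
    using eventually_ge_at_top[of 0]
    by eventually_elim (use \<sigma> bounded_w in \<open>simp add: run_max_uminus run_max_cmult\<close>)
  ultimately show ?thesis by (subst (asm) landau_o.big.in_cong)
qed

lemma Q_ratio: "((\<lambda>U. run_max Q U / sqrt (\<sigma> / \<mu> * run_max w U * ln U)) \<longlongrightarrow> \<sigma>) at_top"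
proof -
  \<comment> \<open>Chosen so that \<open>b < (1 / 2 - ?e) / 2\<close>: the approximation error is
    then negligible against the root of a maximum of size at least
    \<open>U powr (1 / 2 - ?e)\<close>.\<close>
  let ?e = "(1 / 4 - b) / 2"
  have e: "0 < ?e" using b by simp
  have "((\<lambda>U. U powr b / sqrt (\<sigma> / \<mu> * run_max w U * ln U)) \<longlongrightarrow> 0) at_top"
  proof (rule tendsto_sandwich)
    show "\<forall>\<^sub>F U in at_top. 0 \<le> U powr b / sqrt (\<sigma> / \<mu> * run_max w U * ln U)"
      using max_pos eventually_gt_at_top[of 1] by eventually_elim (use \<sigma> \<mu> in auto)
    show "\<forall>\<^sub>F U in at_top. U powr b / sqrt (\<sigma> / \<mu> * run_max w U * ln U) \<le>
        U powr b / sqrt (\<sigma> / \<mu> * U powr (1 / 2 - ?e) * ln U)"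
      using max_pos max_lower[OF e, of 1] eventually_gt_at_top[of 1]
    proof eventually_elim
      case (elim U)
      then have "\<sigma> / \<mu> * U powr (1 / 2 - ?e) * ln U \<le> \<sigma> / \<mu> * run_max w U * ln U"
        using \<sigma> \<mu> by (intro mult_right_mono mult_left_mono) auto
      then show ?case using elim \<sigma> \<mu> by (intro divide_left_mono mult_pos_pos) auto
    qed
    have "b < (1 / 2 - ?e) / 2" using b by (simp add: field_simps)
    then show "((\<lambda>U. U powr b / sqrt (\<sigma> / \<mu> * U powr (1 / 2 - ?e) * ln U)) \<longlongrightarrow> 0) at_top"
      using \<sigma> \<mu> by real_asymp
  qed simp
  from tendsto_frac_close[OF run_max_Q this lag_ratio] show ?thesis by simp
qed

lemma P_ratio: "((\<lambda>U. run_max P U / run_max w U) \<longlongrightarrow> \<sigma>) at_top"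
proof -
  have "((\<lambda>U. U powr (5 / 16) / run_max w U) \<longlongrightarrow> 0) at_top"
  proof (rule tendsto_sandwich)
    show "\<forall>\<^sub>F U in at_top. 0 \<le> U powr (5 / 16) / run_max w U"
      using max_pos by eventually_elim auto
    show "\<forall>\<^sub>F U in at_top. U powr (5 / 16) / run_max w U \<le> U powr (5 / 16) / U powr (1 / 2 - 1 / 16)"
      using max_pos max_lower[of "1 / 16" 1, simplified] eventually_gt_at_top[of 1]
      by eventually_elim (auto intro!: divide_left_mono)
    show "((\<lambda>U::real. U powr (5 / 16) / U powr (1 / 2 - 1 / 16)) \<longlongrightarrow> 0) at_top" by real_asymp
  qed simp
  moreover have "((\<lambda>U. run_max w U / run_max w U) \<longlongrightarrow> 1) at_top"
    by (rule tendsto_eventually) (use max_pos in eventually_elim, simp)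
  ultimately show ?thesis using tendsto_frac_close[OF run_max_P] by fastforce
qed

text \<open>The running maximum of the path cancels between \<open>Q_ratio\<close> and
  \<open>P_ratio\<close>, which is why this quotient converges although each of its two maxima,
  normalised by powers and logarithms of U, need not.\<close>

lemma Q_over_P:
  "((\<lambda>U. run_max Q U / (sqrt (ln (\<mu> * U)) * sqrt (run_max P U))) \<longlongrightarrow> \<sigma> / sqrt \<mu>) at_top"
proof -
  have "((\<lambda>U. ln U / ln (\<mu> * U)) \<longlongrightarrow> 1) at_top" using \<mu> by real_asymp
  then have "((\<lambda>U. run_max Q U / sqrt (\<sigma> / \<mu> * run_max w U * ln U) * sqrt (\<sigma> / \<mu>) *
      sqrt (ln U / ln (\<mu> * U)) / sqrt (run_max P U / run_max w U)) \<longlongrightarrow>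
      \<sigma> * sqrt (\<sigma> / \<mu>) * sqrt 1 / sqrt \<sigma>) at_top"
    using \<sigma> by (intro tendsto_intros Q_ratio P_ratio) auto
  also have "\<sigma> * sqrt (\<sigma> / \<mu>) * sqrt 1 / sqrt \<sigma> = \<sigma> / sqrt \<mu>"
    using \<sigma> by (simp add: real_sqrt_divide)
  finally show ?thesis
  proof (rule Lim_transform_eventually)
    show "\<forall>\<^sub>F U in at_top. run_max Q U / sqrt (\<sigma> / \<mu> * run_max w U * ln U) * sqrt (\<sigma> / \<mu>) *
      sqrt (ln U / ln (\<mu> * U)) / sqrt (run_max P U / run_max w U) =
      run_max Q U / (sqrt (ln (\<mu> * U)) * sqrt (run_max P U))"
      using max_pos eventually_gt_at_top[of 1]
      by eventually_elim (use \<sigma> \<mu> in \<open>simp add: real_sqrt_divide real_sqrt_mult\<close>)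
  qed
qed

lemma P_nonneg: "0 \<le> U \<Longrightarrow> 0 \<le> run_max P U"
  using passage_bounded_runs by (intro run_max_nonneg) (simp add: P_def[abs_def])

lemma SUP_Q: "(SUP t\<in>{0..T}. \<bar>Q (t / \<mu>)\<bar>) = run_max Q (T / \<mu>)"
  by (rule SUP_rescale[OF \<mu>])

lemma SUP_P: "(SUP t\<in>{0..T}. \<bar>\<mu> * N t - t\<bar>) = run_max P (T / \<mu>)"
  using SUP_rescale[OF \<mu>, of P T] \<mu> by (simp add: P_def)

lemma ratio_limit:
  "((\<lambda>T. (SUP t\<in>{0..T}. \<bar>Q (t / \<mu>)\<bar>) /
      (ln T powr (1 / 2) * (SUP t\<in>{0..T}. \<bar>\<mu> * N t - t\<bar>) powr (1 / 2))) \<longlongrightarrow> \<sigma> / \<mu> powr (1 / 2)) at_top"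
proof -
  have "((\<lambda>T. run_max Q (T / \<mu>) / (sqrt (ln (\<mu> * (T / \<mu>))) * sqrt (run_max P (T / \<mu>)))) \<longlongrightarrow>
      \<sigma> / \<mu> powr (1 / 2)) at_top"
    using filterlim_compose[OF Q_over_P filterlim_divide_at_top[OF \<mu>]] \<mu> by (simp add: powr_half_sqrt)
  then show ?thesis
    unfolding SUP_Q SUP_P
  proof (rule Lim_transform_eventually)
    show "\<forall>\<^sub>F T in at_top. run_max Q (T / \<mu>) / (sqrt (ln (\<mu> * (T / \<mu>))) * sqrt (run_max P (T / \<mu>))) =
        run_max Q (T / \<mu>) / (ln T powr (1 / 2) * run_max P (T / \<mu>) powr (1 / 2))"
      using eventually_ge_at_top[of 1]
      by eventually_elim (use \<mu> P_nonneg in \<open>simp add: powr_half_sqrt\<close>)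
  qed
qed

text \<open>The normalised maximum is split as \<open>g * h\<close>, where h is the root of the
  quotient in the law of the iterated logarithm. The upper hypothesis bounds the running maximum for
  all large U, the lower one makes it large for arbitrarily large U.\<close>

lemma limsup_value:
  assumes up: "\<And>c. 1 < c \<Longrightarrow> \<forall>\<^sub>F U in at_top. \<forall>u\<in>{0..U}. \<bar>w u\<bar> \<le> c * sqrt (2 * U * ln (ln U))"
    and lo: "\<And>c. 0 < c \<Longrightarrow> c < 1 \<Longrightarrow> \<exists>\<^sub>F U in at_top. c * sqrt (2 * U * ln (ln U)) \<le> w U"
  shows "Limsup at_top (\<lambda>T. ereal ((SUP t\<in>{0..T}. \<bar>Q (t / \<mu>)\<bar>) /
      ((T * ln (ln T)) powr (1 / 4) * ln T powr (1 / 2)))) =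
      ereal (2 powr (1 / 4) * \<sigma> powr (3 / 2) / \<mu> powr (3 / 4))"
proof -
  define V where "V U = sqrt (2 * U * ln (ln U))" for U :: real
  define h where "h U = sqrt (run_max w U / V U)" for U
  define g where "g U = run_max Q U / (sqrt (ln (\<mu> * U)) * sqrt (run_max P U)) *
      sqrt (run_max P U / run_max w U) * sqrt (sqrt (2 * U * ln (ln U) / (\<mu> * U * ln (ln (\<mu> * U)))))" for U
  define k where "k = \<sigma> / sqrt \<mu> * sqrt \<sigma> * sqrt (sqrt (2 / \<mu>))"
  have "((\<lambda>U. 2 * U * ln (ln U) / (\<mu> * U * ln (ln (\<mu> * U)))) \<longlongrightarrow> 2 / \<mu>) at_top"
    using \<mu> by (real_asymp simp: divide_inverse)
  then have g: "(g \<longlongrightarrow> k) at_top"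
    unfolding g_def[abs_def] k_def
    by (intro tendsto_mult[OF tendsto_mult[OF Q_over_P tendsto_real_sqrt[OF P_ratio]]] tendsto_real_sqrt)
  have k: "0 < k" using \<sigma> \<mu> by (auto simp: k_def)
  have Vp: "\<forall>\<^sub>F U in at_top. 0 < V U"
  proof -
    have "\<forall>\<^sub>F U in at_top. 0 < 2 * U * ln (ln (U::real))" by real_asymp
    then show ?thesis by eventually_elim (simp add: V_def)
  qed
  have hup: "\<forall>\<^sub>F U in at_top. h U \<le> c" if c: "1 < c" for c
  proof -
    have "1 < c\<^sup>2" using c by (simp add: one_less_power)
    from up[OF this] show ?thesis
      using Vp eventually_ge_at_top[of 0]
    proof eventually_elim
      case (elim U)
      have "run_max w U \<le> c\<^sup>2 * V U" unfolding V_def using elim by (intro run_max_le) auto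
      then have "run_max w U / V U \<le> c\<^sup>2" using elim by (simp add: pos_divide_le_eq)
      then show ?case unfolding h_def using c by (intro real_le_lsqrt) auto
    qed
  qed
  have hlo: "\<exists>\<^sub>F U in at_top. c \<le> h U" if c: "0 < c" "c < 1" for c
  proof -
    have "0 < c\<^sup>2" "c\<^sup>2 < 1" using c by (auto simp: power_less_one_iff)
    from lo[OF this] show ?thesis
    proof (rule frequently_rev_mp)
      show "\<forall>\<^sub>F U in at_top. c\<^sup>2 * sqrt (2 * U * ln (ln U)) \<le> w U \<longrightarrow> c \<le> h U"
        using Vp eventually_ge_at_top[of 0]
      proof eventually_elim
        case (elim U)
        show ?case
        proof
          assume "c\<^sup>2 * sqrt (2 * U * ln (ln U)) \<le> w U"
          then have "c\<^sup>2 * V U \<le> run_max w U"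
            using run_max_upper[OF bounded_w, of U U] elim by (simp add: V_def)
          then have "c\<^sup>2 \<le> run_max w U / V U" using elim by (simp add: pos_le_divide_eq)
          then show "c \<le> h U" unfolding h_def by (rule real_le_rsqrt)
        qed
      qed
    qed
  qed
  have fl: "filterlim (\<lambda>T::real. T / \<mu>) at_top at_top" by (rule filterlim_divide_at_top[OF \<mu>])
  have "Limsup at_top (\<lambda>T. ereal (g (T / \<mu>) * h (T / \<mu>))) = ereal k"
  proof (rule Limsup_mult_tendsto[OF filterlim_compose[OF g fl] k])
    show "\<forall>\<^sub>F T in at_top. h (T / \<mu>) \<le> c" if "1 < c" for c
      using eventually_compose_filterlim[OF hup[OF that] fl] .
    \<comment> \<open>Frequent events do not pass through a mere limit of arguments; the inverse
      substitution is applied to the negation.\<close>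
    show "\<exists>\<^sub>F T in at_top. c \<le> h (T / \<mu>)" if c: "0 < c" "c < 1" for c
      unfolding frequently_def
    proof
      assume "\<forall>\<^sub>F T in at_top. \<not> c \<le> h (T / \<mu>)"
      moreover have "filterlim (\<lambda>U::real. \<mu> * U) at_top at_top" using \<mu> by real_asymp
      ultimately have "\<forall>\<^sub>F U in at_top. \<not> c \<le> h (\<mu> * U / \<mu>)" by (rule eventually_compose_filterlim)
      then show False using hlo[OF c] \<mu> by (simp add: frequently_def)
    qed
  qed
  also have "k = 2 powr (1 / 4) * \<sigma> powr (3 / 2) / \<mu> powr (3 / 4)"
  proof -
    have q: "sqrt (sqrt x) = x powr (1 / 4)" if "0 < x" for x
      using that by (simp add: powr_half_sqrt[symmetric] powr_powr)
    have "\<sigma> * sqrt \<sigma> = \<sigma> powr 1 * \<sigma> powr (1 / 2)" using \<sigma> by (simp add: powr_half_sqrt)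
    then have 1: "\<sigma> * sqrt \<sigma> = \<sigma> powr (3 / 2)" unfolding powr_add[symmetric] by simp
    have "sqrt \<mu> * \<mu> powr (1 / 4) = \<mu> powr (1 / 2) * \<mu> powr (1 / 4)" using \<mu> by (simp add: powr_half_sqrt)
    then have 2: "sqrt \<mu> * \<mu> powr (1 / 4) = \<mu> powr (3 / 4)" unfolding powr_add[symmetric] by simp
    have "k = 2 powr (1 / 4) * (\<sigma> * sqrt \<sigma>) / (sqrt \<mu> * \<mu> powr (1 / 4))"
      unfolding k_def using \<mu> by (subst q) (auto simp: powr_divide)
    then show ?thesis unfolding 1 2 .
  qed
  finally have L: "Limsup at_top (\<lambda>T. ereal (g (T / \<mu>) * h (T / \<mu>))) =
      ereal (2 powr (1 / 4) * \<sigma> powr (3 / 2) / \<mu> powr (3 / 4))" .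
  have Pp: "\<forall>\<^sub>F U in at_top. 0 < run_max P U"
    using order_tendstoD(1)[OF P_ratio \<sigma>] max_pos by eventually_elim (simp add: zero_less_divide_iff)
  have lp: "\<forall>\<^sub>F U in at_top. 0 < \<mu> * U * ln (ln (\<mu> * U)) \<and> 0 < ln (\<mu> * U)"
    using \<mu> by (intro eventually_conj) real_asymp+
  have "\<forall>\<^sub>F U in at_top. g U * h U = run_max Q U / ((\<mu> * U * ln (ln (\<mu> * U))) powr (1 / 4) * ln (\<mu> * U) powr (1 / 2))"
    using Vp Pp max_pos lp
  proof eventually_elim
    case (elim U)
    have q: "(\<mu> * U * ln (ln (\<mu> * U))) powr (1 / 4) = sqrt (sqrt (\<mu> * U * ln (ln (\<mu> * U))))"
      using elim by (simp add: powr_half_sqrt[symmetric] powr_powr)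
    have "sqrt (sqrt (2 * U * ln (ln U) / (\<mu> * U * ln (ln (\<mu> * U))))) =
        sqrt (V U) / sqrt (sqrt (\<mu> * U * ln (ln (\<mu> * U))))"
      unfolding V_def by (simp only: real_sqrt_divide)
    then show ?case
      unfolding g_def h_def q using elim by (simp add: real_sqrt_divide powr_half_sqrt)
  qed
  from eventually_compose_filterlim[OF this fl]
  have "\<forall>\<^sub>F T in at_top. ereal (g (T / \<mu>) * h (T / \<mu>)) = ereal (run_max Q (T / \<mu>) /
     ((T * ln (ln T)) powr (1 / 4) * ln T powr (1 / 2)))"
    using \<mu> by simp
  from Limsup_eq[OF this] L show ?thesis unfolding SUP_Q by simp
qed

end

section \<open>The limit distribution\<close>

abbreviation std_normal :: "real measure" where
  "std_normal \<equiv> density lborel std_normal_density"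

lemma real_distribution_std_normal: "real_distribution std_normal"
  unfolding real_distribution_def real_distribution_axioms_def
  using prob_space_normal_density[of 1 0] by simp

lemma std_normal_cdf_bounds: "0 \<le> std_normal_cdf x" "std_normal_cdf x \<le> 1"
  unfolding std_normal_cdf_def
  using real_distribution.cdf_bounded_prob[OF real_distribution_std_normal]
    finite_borel_measure.cdf_nonneg[OF real_distribution.finite_borel_measure_M[OF real_distribution_std_normal]]
  by auto

lemma isCont_std_normal_cdf: "isCont std_normal_cdf x"
proof -
  interpret real_distribution std_normal by (rule real_distribution_std_normal)
  have "emeasure std_normal {x} = 0"
    by (subst emeasure_density) (auto simp: nn_integral_0_iff_AE indicator_def intro!: AE_I[of _ _ "{x}"])
  then have "measure std_normal {x} = 0" by (simp add: measure_def)
  then show ?thesis unfolding std_normal_cdf_def by (simp add: isCont_cdf)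
qed

lemma borel_measurable_std_normal_cdf[measurable]: "std_normal_cdf \<in> borel_measurable borel"
  by (intro borel_measurable_continuous_onI continuous_at_imp_continuous_on)
     (simp add: isCont_std_normal_cdf)

lemma (in prob_space) normal_abs_cdf:
  assumes D: "distributed M lborel X (normal_density 0 s)" and s: "0 < s"
  shows "prob {\<omega>\<in>space M. \<bar>X \<omega>\<bar> \<le> c} = (if 0 \<le> c then 2 * std_normal_cdf (c / s) - 1 else 0)"
proof (cases "0 \<le> c")
  case True
  have cdf: "prob {\<omega>\<in>space M. Z \<omega> \<le> c} = std_normal_cdf (c / s)"
    if Z: "distributed M lborel Z (normal_density 0 s)" for Z
  proof -
    have D: "distributed M lborel (\<lambda>\<omega>. (Z \<omega> - 0) / s) std_normal_density"
      using Z s by (subst normal_standard_normal_convert[symmetric]) auto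
    have "std_normal = distr M lborel (\<lambda>\<omega>. Z \<omega> / s)"
      using distributed_distr_eq_density[OF D] by simp
    moreover have "(\<lambda>\<omega>. Z \<omega> / s) \<in> measurable M lborel"
      using distributed_measurable[OF D] by simp
    ultimately have "std_normal_cdf (c / s) = prob ((\<lambda>\<omega>. Z \<omega> / s) -` {..c / s} \<inter> space M)"
      unfolding std_normal_cdf_def cdf_def by (simp add: measure_distr)
    also have "(\<lambda>\<omega>. Z \<omega> / s) -` {..c / s} \<inter> space M = {\<omega>\<in>space M. Z \<omega> \<le> c}"
      using s by (auto simp: divide_le_cancel)
    finally show ?thesis by simp
  qed
  have [measurable]: "X \<in> borel_measurable M" using distributed_measurable[OF D] by simp
  have "prob {\<omega>\<in>space M. X \<omega> \<le> c} = prob ({\<omega>\<in>space M. \<bar>X \<omega>\<bar> \<le> c} \<union> {\<omega>\<in>space M. c < - X \<omega>})"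
    using True by (intro arg_cong[where f=prob]) auto
  also have "\<dots> = prob {\<omega>\<in>space M. \<bar>X \<omega>\<bar> \<le> c} + prob {\<omega>\<in>space M. c < - X \<omega>}"
    by (rule finite_measure_Union) auto
  also have "{\<omega>\<in>space M. c < - X \<omega>} = space M - {\<omega>\<in>space M. - X \<omega> \<le> c}" by auto
  also have "prob \<dots> = 1 - prob {\<omega>\<in>space M. - X \<omega> \<le> c}" by (rule prob_compl) measurable
  finally show ?thesis using True cdf[OF D] cdf[OF normal_uminus[OF D s]] by simp
next
  case False
  then have e: "{\<omega>\<in>space M. \<bar>X \<omega>\<bar> \<le> c} = {}" by auto
  show ?thesis unfolding e using False by simp
qed

text \<open>Rounding makes the lag discrete, so that conditioning on it is a sum over grid indices.
  The mesh is small against sqrt U, the size of the path, and hence invisible in the limit.\<close>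

definition grid_index :: "real \<Rightarrow> real \<Rightarrow> int" where
  "grid_index U x = \<lfloor>x / U powr (3 / 8)\<rfloor>"

text \<open>
  The cutoff keeps \<open>grid_time\<close> after \<open>U - U powr (5/8)\<close>, the time at which the lag is read off, as
  independence requires. The lag is of order \<open>sqrt U\<close>, so almost surely the cutoff is eventually inactive.
\<close>
definition grid_time :: "real \<Rightarrow> real \<Rightarrow> int \<Rightarrow> real" where
  "grid_time a U k = (if a * (U powr (3 / 8) * \<bar>real_of_int k\<bar>) \<le> U powr (5 / 8)
     then U - a * (U powr (3 / 8) * real_of_int k) else U)"

text \<open>The probability in \<open>prob_grid_increment\<close>. The value 1 belongs to
  \<open>k = 0\<close> and to the cutoff, where the grid time is U itself and the increment
  vanishes.\<close>

definition hit :: "real \<Rightarrow> real \<Rightarrow> real \<Rightarrow> int \<Rightarrow> real" where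
  "hit a U c k = (if a * (U powr (3 / 8) * \<bar>real_of_int k\<bar>) \<le> U powr (5 / 8) \<and> k \<noteq> 0
     then 2 * std_normal_cdf (c / sqrt (a * (U powr (3 / 8) * \<bar>real_of_int k\<bar>))) - 1 else 1)"

lemma abs_hit_le: "\<bar>hit a U c k\<bar> \<le> 1"
  using std_normal_cdf_bounds unfolding hit_def by (auto simp: abs_le_iff)

section \<open>Exact law of the increment at the discretised lag\<close>

context wiener
begin

text \<open>Subtracting \<open>W 0\<close> makes the index a function of an increment, which is what
  independence and normality are assumed for; almost surely it changes nothing.\<close>

definition lagged :: "real \<Rightarrow> real \<Rightarrow> 'a \<Rightarrow> real" where
  "lagged a U \<omega> = W U \<omega> - W (grid_time a U (grid_index U (W (U - U powr (5 / 8)) \<omega> - W 0 \<omega>))) \<omega>"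

lemma grid_times:
  assumes a: "0 < a" and U: "1 < U"
  shows "0 < U - U powr (5 / 8)" "U - U powr (5 / 8) \<le> grid_time a U k" "0 \<le> grid_time a U k"
proof -
  have "U powr (5 / 8) < U powr 1" using U by (intro powr_less_mono) auto
  then show 1: "0 < U - U powr (5 / 8)" using U by simp
  have "a * (U powr (3 / 8) * real_of_int k) \<le> a * (U powr (3 / 8) * \<bar>real_of_int k\<bar>)"
    using a by (intro mult_left_mono) auto
  then show "U - U powr (5 / 8) \<le> grid_time a U k" by (auto simp: grid_time_def)
  then show "0 \<le> grid_time a U k" using 1 by linarith
qed

lemma measurable_grid_index:
  assumes U: "1 < U"
  shows "(\<lambda>\<omega>. grid_index U (W (U - U powr (5 / 8)) \<omega> - W 0 \<omega>)) \<in> measurable M (count_space UNIV)"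
proof -
  have [measurable]: "W (U - U powr (5 / 8)) \<in> borel_measurable M" "W 0 \<in> borel_measurable M"
    using grid_times(1)[of 1 U] U by (auto intro!: measurable_W)
  show ?thesis unfolding grid_index_def by measurable
qed

lemma measurable_lagged:
  assumes a: "0 < a" and U: "1 < U"
  shows "lagged a U \<in> borel_measurable M"
proof -
  have "W (grid_time a U k) \<in> borel_measurable M" for k
    by (rule measurable_W[OF grid_times(3)[OF a U]])
  then have "(\<lambda>\<omega>. W (grid_time a U (grid_index U (W (U - U powr (5 / 8)) \<omega> - W 0 \<omega>))) \<omega>) \<in> borel_measurable M"
    by (rule measurable_compose_countable[where f="\<lambda>k. W (grid_time a U k)", OF _ measurable_grid_index[OF U]])
  moreover have "W U \<in> borel_measurable M" using U by (intro measurable_W) auto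
  ultimately show ?thesis unfolding lagged_def[abs_def] by (rule borel_measurable_diff[rotated])
qed

lemma indep_past_increment:
  assumes t: "0 \<le> r" "r \<le> s" "s \<le> t" and A: "A \<in> sets borel" and B: "B \<in> sets borel"
  shows "prob ({\<omega>\<in>space M. W r \<omega> - W 0 \<omega> \<in> A} \<inter> {\<omega>\<in>space M. W t \<omega> - W s \<omega> \<in> B}) =
    prob {\<omega>\<in>space M. W r \<omega> - W 0 \<omega> \<in> A} * prob {\<omega>\<in>space M. W t \<omega> - W s \<omega> \<in> B}"
proof -
  \<comment> \<open>The partition 0, r, s, t has three independent increments; the middle one is
    discarded.\<close>
  define \<tau> :: "nat \<Rightarrow> real" where "\<tau> i = (if i = 0 then 0 else if i = 1 then r else if i = 2 then s else t)" for i
  have "mono_on {..3} \<tau>" using t by (auto simp: mono_on_def \<tau>_def)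
  then have "indep_vars (\<lambda>_. borel) (\<lambda>i \<omega>. W (\<tau> (Suc i)) \<omega> - W (\<tau> i) \<omega>) {..<3}"
    by (intro indep_increments) (simp add: \<tau>_def)
  then have iv: "indep_vars (\<lambda>_. borel) (\<lambda>i \<omega>. W (\<tau> (Suc i)) \<omega> - W (\<tau> i) \<omega>) {0, 2}"
    by (rule indep_vars_subset) auto
  define C where "C i = (if i = (0::nat) then A else B)" for i
  have "prob (\<Inter>i\<in>{0, 2}. (\<lambda>\<omega>. W (\<tau> (Suc i)) \<omega> - W (\<tau> i) \<omega>) -` C i \<inter> space M) =
      (\<Prod>i\<in>{0, 2}. prob ((\<lambda>\<omega>. W (\<tau> (Suc i)) \<omega> - W (\<tau> i) \<omega>) -` C i \<inter> space M))"
    by (rule indep_varsD_finite[OF iv]) (auto simp: C_def A B)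
  then have "prob ((\<lambda>\<omega>. W r \<omega> - W 0 \<omega>) -` A \<inter> space M \<inter> ((\<lambda>\<omega>. W t \<omega> - W s \<omega>) -` B \<inter> space M)) =
      prob ((\<lambda>\<omega>. W r \<omega> - W 0 \<omega>) -` A \<inter> space M) * prob ((\<lambda>\<omega>. W t \<omega> - W s \<omega>) -` B \<inter> space M)"
    by (simp add: \<tau>_def C_def)
  then show ?thesis by (simp add: vimage_def Int_def conj_commute)
qed

lemma prob_grid_increment:
  assumes a: "0 < a" and U: "1 < U" and c: "0 \<le> c"
  shows "prob {\<omega>\<in>space M. \<bar>W U \<omega> - W (grid_time a U k) \<omega>\<bar> \<le> c} = hit a U c k"
proof (cases "a * (U powr (3 / 8) * \<bar>real_of_int k\<bar>) \<le> U powr (5 / 8) \<and> k \<noteq> 0")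
  case False
  then have "grid_time a U k = U" by (auto simp: grid_time_def)
  then have "{\<omega>\<in>space M. \<bar>W U \<omega> - W (grid_time a U k) \<omega>\<bar> \<le> c} = space M" using c by auto
  then show ?thesis using False by (simp only: prob_space hit_def if_False)
next
  case True
  define d where "d = a * (U powr (3 / 8) * \<bar>real_of_int k\<bar>)"
  have d: "0 < d" using True a U by (auto simp: d_def)
  have s: "\<bar>U - grid_time a U k\<bar> = d" using True a by (auto simp: grid_time_def d_def abs_mult)
  have s0: "0 \<le> grid_time a U k" by (rule grid_times(3)[OF a U])
  have "distributed M lborel (\<lambda>\<omega>. W U \<omega> - W (grid_time a U k) \<omega>) (normal_density 0 (sqrt d))"
  proof (cases "grid_time a U k < U")
    case True
    then show ?thesis using increment_normal[OF s0 True] s by simp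
  next
    case False
    then have "U < grid_time a U k" using s d by linarith
    from increment_normal_signed[OF _ this, of "-1"] show ?thesis using s U \<open>U < _\<close> by (simp add: minus_diff_eq)
  qed
  from normal_abs_cdf[OF this, of c] show ?thesis using d c True by (simp add: hit_def d_def)
qed

text \<open>Conditioning on the index: the finitely many indices within the cutoff contribute
  product probabilities, the others the full probability of their union because the increment is 0.
  The total is the expectation of \<open>hit\<close> at the index, hence a Gaussian
  integral.\<close>

lemma prob_lagged:
  assumes a: "0 < a" and U: "1 < U" and c: "0 \<le> c"
  shows "prob {\<omega>\<in>space M. \<bar>lagged a U \<omega>\<bar> \<le> c} =
    (LBINT x. std_normal_density x * hit a U c (grid_index U (sqrt (U - U powr (5 / 8)) * x)))"
proof -
  define V where "V = U - U powr (5 / 8)"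
  define X where "X \<omega> = W V \<omega> - W 0 \<omega>" for \<omega>
  define I where "I \<omega> = grid_index U (X \<omega>)" for \<omega>
  have V: "0 < V" unfolding V_def by (rule grid_times(1)[OF a U])
  have Xm[measurable]: "X \<in> borel_measurable M"
    unfolding X_def[abs_def] using V by (intro borel_measurable_diff measurable_W) auto
  have Im[measurable]: "I \<in> measurable M (count_space UNIV)"
    using measurable_grid_index[OF U] by (simp add: I_def[abs_def] X_def V_def)
  define S where "S = {k::int. a * (U powr (3 / 8) * \<bar>real_of_int k\<bar>) \<le> U powr (5 / 8)}"
  have fS: "finite S"
  proof -
    have "S \<subseteq> {- \<lceil>U powr (5 / 8) / (a * U powr (3 / 8))\<rceil>..\<lceil>U powr (5 / 8) / (a * U powr (3 / 8))\<rceil>}"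
    proof
      fix k assume "k \<in> S"
      then have "\<bar>real_of_int k\<bar> \<le> U powr (5 / 8) / (a * U powr (3 / 8))"
        using a U by (simp add: S_def pos_le_divide_eq mult_ac)
      then show "k \<in> {- \<lceil>U powr (5 / 8) / (a * U powr (3 / 8))\<rceil>..\<lceil>U powr (5 / 8) / (a * U powr (3 / 8))\<rceil>}"
        by (auto simp: abs_le_iff) linarith+
    qed
    then show ?thesis by (rule finite_subset) simp
  qed
  define E where "E k = {\<omega>\<in>space M. I \<omega> = k}" for k
  define F where "F k = {\<omega>\<in>space M. \<bar>W U \<omega> - W (grid_time a U k) \<omega>\<bar> \<le> c}" for k
  define R where "R = {\<omega>\<in>space M. I \<omega> \<notin> S}"
  have Em[measurable]: "E k \<in> events" for k unfolding E_def by measurable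
  have Rm[measurable]: "R \<in> events" unfolding R_def by measurable
  have Fm[measurable]: "F k \<in> events" for k
    unfolding F_def using U grid_times(3)[OF a U, of k]
    by (intro borel_measurable_le borel_measurable_abs borel_measurable_diff measurable_W borel_measurable_const) auto
  have EF: "prob (E k \<inter> F k) = prob (E k) * hit a U c k" for k
  proof -
    define A where "A = {x::real. grid_index U x = k}"
    have A: "A \<in> sets borel" unfolding A_def grid_index_def by measurable
    have E: "E k = {\<omega>\<in>space M. W V \<omega> - W 0 \<omega> \<in> A}" by (simp add: E_def A_def I_def X_def)
    \<comment> \<open>The lag may have either sign, so the two times are put in increasing order.
      The cutoff guarantees that both come after V, where the index is read off.\<close>
    define lo hi where "lo = min U (grid_time a U k)" and "hi = max U (grid_time a U k)"
    have lohi: "V \<le> lo" "lo \<le> hi" using grid_times(2)[OF a U, of k] U by (auto simp: lo_def hi_def V_def)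
    have F: "F k = {\<omega>\<in>space M. W hi \<omega> - W lo \<omega> \<in> {-c..c}}"
      by (auto simp: F_def lo_def hi_def min_def max_def abs_le_iff)
    have "prob (E k \<inter> F k) = prob (E k) * prob (F k)"
      unfolding E F using V lohi A by (intro indep_past_increment) auto
    then show ?thesis unfolding F_def prob_grid_increment[OF a U c] .
  qed
  have outside: "grid_time a U k = U" "hit a U c k = 1" if "k \<notin> S" for k
    using that by (auto simp: grid_time_def hit_def S_def)
  have "prob {\<omega>\<in>space M. \<bar>lagged a U \<omega>\<bar> \<le> c} = prob ((\<Union>k\<in>S. E k \<inter> F k) \<union> R)"
  proof (intro arg_cong[where f=prob] equalityI subsetI)
    fix \<omega> assume "\<omega> \<in> {\<omega>\<in>space M. \<bar>lagged a U \<omega>\<bar> \<le> c}"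
    then have "\<omega> \<in> space M" "\<bar>W U \<omega> - W (grid_time a U (I \<omega>)) \<omega>\<bar> \<le> c"
      by (auto simp: lagged_def I_def X_def V_def)
    then show "\<omega> \<in> (\<Union>k\<in>S. E k \<inter> F k) \<union> R" by (auto simp: E_def F_def R_def)
  next
    fix \<omega> assume "\<omega> \<in> (\<Union>k\<in>S. E k \<inter> F k) \<union> R"
    then have "\<omega> \<in> space M" "\<bar>W U \<omega> - W (grid_time a U (I \<omega>)) \<omega>\<bar> \<le> c"
      using c by (auto simp: E_def F_def R_def outside)
    then show "\<omega> \<in> {\<omega>\<in>space M. \<bar>lagged a U \<omega>\<bar> \<le> c}" by (auto simp: lagged_def I_def X_def V_def)
  qed
  also have "\<dots> = prob (\<Union>k\<in>S. E k \<inter> F k) + prob R"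
    using fS by (intro finite_measure_Union) (auto simp: E_def R_def)
  also have "prob (\<Union>k\<in>S. E k \<inter> F k) = (\<Sum>k\<in>S. prob (E k \<inter> F k))"
    using fS by (intro finite_measure_finite_Union) (auto simp: disjoint_family_on_def E_def)
  also have "(\<Sum>k\<in>S. prob (E k \<inter> F k)) + prob R = expectation (\<lambda>\<omega>. (\<Sum>k\<in>S. hit a U c k * indicator (E k) \<omega>) + indicator R \<omega>)"
    by (simp add: EF mult.commute less_top[symmetric])
  also have "\<dots> = expectation (\<lambda>\<omega>. hit a U c (I \<omega>))"
  proof (rule Bochner_Integration.integral_cong[OF refl])
    fix \<omega> assume w: "\<omega> \<in> space M"
    have "(\<Sum>k\<in>S. hit a U c k * indicator (E k) \<omega>) = (\<Sum>k\<in>S. if k = I \<omega> then hit a U c k else 0)"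
      using w by (intro sum.cong) (auto simp: E_def indicator_def)
    also have "\<dots> = (if I \<omega> \<in> S then hit a U c (I \<omega>) else 0)" using fS by (simp add: sum.delta)
    finally show "(\<Sum>k\<in>S. hit a U c k * indicator (E k) \<omega>) + indicator R \<omega> = hit a U c (I \<omega>)"
      using w by (auto simp: R_def indicator_def outside)
  qed
  also have "\<dots> = (LBINT x. std_normal_density x * hit a U c (grid_index U (sqrt V * x)))"
  proof -
    have "distributed M lborel X (normal_density 0 (sqrt V))"
      using increment_normal[of 0 V] V by (simp add: X_def[abs_def])
    then have D: "distributed M lborel (\<lambda>\<omega>. (X \<omega> - 0) / sqrt V) std_normal_density"
      using V by (subst normal_standard_normal_convert[symmetric]) auto
    have "(\<lambda>x. hit a U c (grid_index U (sqrt V * x))) \<in> borel_measurable lborel"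
      unfolding grid_index_def by measurable
    from distributed_integral[OF D this] show ?thesis using V by (simp add: I_def)
  qed
  finally show ?thesis by (simp add: V_def)
qed

end

section \<open>Convergence of the Gaussian mixtures\<close>

abbreviation lag_index :: "real \<Rightarrow> real \<Rightarrow> int" where
  "lag_index U x \<equiv> grid_index U (sqrt (U - U powr (5 / 8)) * x)"

abbreviation mix :: "real \<Rightarrow> real \<Rightarrow> real \<Rightarrow> real" where
  "mix a c x \<equiv> std_normal_cdf (c * (a * \<bar>x\<bar>) powr (- 1 / 2))"

text \<open>Divided by sqrt U, the rounded path value tends to z: the time change from U to
  \<open>U - U powr (5 / 8)\<close> and the mesh \<open>U powr (3 / 8)\<close> are both of smaller
  order. At nonzero z the normal distribution function is evaluated at a continuous expression, and
  the cutoff is eventually inactive.\<close>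

lemma hit_limit:
  assumes a: "0 < a" and z: "z \<noteq> 0"
  shows "((\<lambda>U. hit a U (c * U powr (1 / 4)) (lag_index U z)) \<longlongrightarrow>
    2 * mix a c z - 1) at_top"
proof -
  define r where "r U = U powr (3 / 8) * real_of_int (lag_index U z) / sqrt U" for U
  have "(r \<longlongrightarrow> z) at_top"
  proof (rule tendsto_sandwich)
    have e: "r U = U powr (3 / 8) / sqrt U * real_of_int \<lfloor>sqrt (U - U powr (5 / 8)) * z / U powr (3 / 8)\<rfloor>" for U
      by (simp add: r_def grid_index_def)
    show "\<forall>\<^sub>F U in at_top. sqrt (U - U powr (5 / 8)) * z / sqrt U - U powr (3 / 8) / sqrt U \<le> r U"
      using eventually_gt_at_top[of 0]
    proof eventually_elim
      case (elim U)
      have "U powr (3 / 8) / sqrt U * (sqrt (U - U powr (5 / 8)) * z / U powr (3 / 8) - 1) \<le> r U"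
        unfolding e using elim by (intro mult_left_mono) (linarith, simp)
      then show ?case using elim by (simp add: right_diff_distrib)
    qed
    show "\<forall>\<^sub>F U in at_top. r U \<le> sqrt (U - U powr (5 / 8)) * z / sqrt U"
      using eventually_gt_at_top[of 0]
    proof eventually_elim
      case (elim U)
      have "r U \<le> U powr (3 / 8) / sqrt U * (sqrt (U - U powr (5 / 8)) * z / U powr (3 / 8))"
        unfolding e using elim by (intro mult_left_mono) (linarith, simp)
      then show ?case using elim by simp
    qed
    show "((\<lambda>U. sqrt (U - U powr (5 / 8)) * z / sqrt U - U powr (3 / 8) / sqrt U) \<longlongrightarrow> z) at_top"
      by real_asymp
    show "((\<lambda>U. sqrt (U - U powr (5 / 8)) * z / sqrt U) \<longlongrightarrow> z) at_top"
      by real_asymp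
  qed
  then have rl: "((\<lambda>U. \<bar>r U\<bar>) \<longlongrightarrow> \<bar>z\<bar>) at_top" by (rule tendsto_rabs)
  have lim: "((\<lambda>U. 2 * std_normal_cdf (c / sqrt (a * \<bar>r U\<bar>)) - 1) \<longlongrightarrow>
      2 * std_normal_cdf (c / sqrt (a * \<bar>z\<bar>)) - 1) at_top"
    using a z by (intro tendsto_intros isCont_tendsto_compose[OF isCont_std_normal_cdf] rl) auto
  have e1: "\<forall>\<^sub>F U in at_top. \<bar>r U\<bar> < \<bar>z\<bar> + 1" using rl by (rule order_tendstoD(2)) simp
  have e2: "\<forall>\<^sub>F U in at_top. 0 < \<bar>r U\<bar>" using rl by (rule order_tendstoD(1)) (use z in simp)
  have e3: "\<forall>\<^sub>F U in at_top. a * (\<bar>z\<bar> + 1) * sqrt U \<le> U powr (5 / 8)" using a by real_asymp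
  have "\<forall>\<^sub>F U in at_top. 2 * std_normal_cdf (c / sqrt (a * \<bar>r U\<bar>)) - 1 =
      hit a U (c * U powr (1 / 4)) (lag_index U z)"
    using e1 e2 e3 eventually_gt_at_top[of 0]
  proof eventually_elim
    case (elim U)
    define k where "k = lag_index U z"
    have rk: "U powr (3 / 8) * \<bar>real_of_int k\<bar> = \<bar>r U\<bar> * sqrt U"
      using elim(4) by (simp add: r_def k_def abs_mult)
    have "k \<noteq> 0" using elim(2) by (auto simp: r_def k_def)
    moreover have "a * (\<bar>r U\<bar> * sqrt U) \<le> U powr (5 / 8)"
    proof -
      have "a * \<bar>r U\<bar> * sqrt U \<le> a * (\<bar>z\<bar> + 1) * sqrt U"
        using elim a by (intro mult_right_mono mult_left_mono) auto
      then show ?thesis using elim(3) by (simp add: mult.assoc)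
    qed
    moreover have "c * U powr (1 / 4) / sqrt (a * (\<bar>r U\<bar> * sqrt U)) = c / sqrt (a * \<bar>r U\<bar>)"
    proof -
      have "U powr (1 / 4) = sqrt (sqrt U)" using elim by (simp add: powr_half_sqrt[symmetric] powr_powr)
      then show ?thesis using elim(4) by (simp add: real_sqrt_mult)
    qed
    ultimately show ?case unfolding k_def[symmetric] hit_def rk by simp
  qed
  with lim have "((\<lambda>U. hit a U (c * U powr (1 / 4)) (lag_index U z)) \<longlongrightarrow>
      2 * std_normal_cdf (c / sqrt (a * \<bar>z\<bar>)) - 1) at_top" by (rule Lim_transform_eventually)
  moreover have "c / sqrt (a * \<bar>z\<bar>) = c * (a * \<bar>z\<bar>) powr (- 1 / 2)"
    using a by (simp add: powr_minus_divide powr_half_sqrt)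
  ultimately show ?thesis by simp
qed

text \<open>For \<open>0 \<le> c\<close>, the distribution function of the product of
  \<open>sqrt (a * \<bar>X\<bar>)\<close> and the absolute value of Z, with X and Z independent
  standard normal.\<close>

definition mixture_cdf :: "real \<Rightarrow> real \<Rightarrow> real" where
  "mixture_cdf a c = (LBINT x. std_normal_density x * (2 * mix a c x - 1))"

text \<open>Dominated convergence with the normal density as majorant, since \<open>hit\<close> is
  bounded by 1; the point 0, where the lag degenerates, is a null set.\<close>

lemma (in wiener) lagged_limit:
  assumes a: "0 < a" and c: "0 \<le> c"
  shows "((\<lambda>U. prob {\<omega>\<in>space M. \<bar>lagged a U \<omega>\<bar> \<le> c * U powr (1 / 4)}) \<longlongrightarrow> mixture_cdf a c) at_top"
proof -
  have "((\<lambda>U. LBINT x. std_normal_density x * hit a U (c * U powr (1 / 4)) (lag_index U x))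
      \<longlongrightarrow> mixture_cdf a c) at_top"
    unfolding mixture_cdf_def
  proof (rule integral_dominated_convergence_at_top)
    show "integrable lborel std_normal_density" by simp
    show "(\<lambda>x. std_normal_density x * (2 * mix a c x - 1)) \<in> borel_measurable lborel"
      by measurable
    show "(\<lambda>x. std_normal_density x * hit a U (c * U powr (1 / 4)) (lag_index U x))
        \<in> borel_measurable lborel" for U
      unfolding grid_index_def by measurable
    have "AE x in lborel. x \<noteq> (0::real)" by (rule AE_lborel_singleton)
    then show "AE x in lborel. ((\<lambda>U. std_normal_density x *
        hit a U (c * U powr (1 / 4)) (lag_index U x)) \<longlongrightarrow>
        std_normal_density x * (2 * mix a c x - 1)) at_top"
      by eventually_elim (intro tendsto_mult tendsto_const hit_limit a)
    show "\<forall>\<^sub>F U in at_top. AE x in lborel. norm (std_normal_density x *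
        hit a U (c * U powr (1 / 4)) (lag_index U x)) \<le> std_normal_density x"
      by (intro always_eventually allI AE_I2) (simp add: abs_mult mult_left_le abs_hit_le)
  qed
  then show ?thesis
  proof (rule Lim_transform_eventually)
    show "\<forall>\<^sub>F U in at_top. (LBINT x. std_normal_density x * hit a U (c * U powr (1 / 4))
        (lag_index U x)) = prob {\<omega>\<in>space M. \<bar>lagged a U \<omega>\<bar> \<le> c * U powr (1 / 4)}"
      using eventually_gt_at_top[of 1] by eventually_elim (simp add: prob_lagged a c)
  qed
qed

lemma norm_centered_cdf_le: "norm (2 * std_normal_cdf x - 1) \<le> 1"
  using std_normal_cdf_bounds[of x] by (auto simp: abs_le_iff)

lemma isCont_mixture_cdf: "isCont (mixture_cdf a) c"
proof (rule continuous_at_sequentiallyI)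
  fix u :: "nat \<Rightarrow> real" assume u: "u \<longlonglongrightarrow> c"
  show "(\<lambda>n. mixture_cdf a (u n)) \<longlonglongrightarrow> mixture_cdf a c"
    unfolding mixture_cdf_def
  proof (rule integral_dominated_convergence)
    show "integrable lborel std_normal_density" by simp
    show "AE x in lborel. (\<lambda>n. std_normal_density x * (2 * mix a (u n) x - 1))
        \<longlonglongrightarrow> std_normal_density x * (2 * mix a c x - 1)"
      by (intro AE_I2 tendsto_intros isCont_tendsto_compose[OF isCont_std_normal_cdf] u)
    show "AE x in lborel. norm (std_normal_density x * (2 * mix a (u n) x - 1))
        \<le> std_normal_density x" for n
      using norm_centered_cdf_le by (intro AE_I2) (simp add: abs_mult mult_left_le)
  qed measurable
qed

text \<open>Read off from \<open>normal_abs_cdf\<close> for the identity at level 0, where the left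
  side vanishes because the normal law has no atom.\<close>

lemma std_normal_cdf_0: "std_normal_cdf 0 = 1 / 2"
proof -
  interpret S: prob_space std_normal using prob_space_normal_density[of 1 0] by simp
  have D: "distributed std_normal lborel (\<lambda>x. x) (normal_density 0 1)"
    unfolding distributed_def by (auto simp: distr_id2 sets_density)
  have "S.prob {x\<in>space std_normal. \<bar>x\<bar> \<le> 0} = 2 * std_normal_cdf 0 - 1"
    using S.normal_abs_cdf[OF D, of 0] by simp
  moreover have "S.prob {x\<in>space std_normal. \<bar>x\<bar> \<le> 0} = 0"
  proof -
    have "emeasure std_normal {x. x = 0} = 0"
      by (subst emeasure_density) (auto simp: nn_integral_0_iff_AE indicator_def intro!: AE_I[of _ _ "{0}"])
    then show ?thesis by (simp add: measure_def)
  qed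
  ultimately show ?thesis by simp
qed

lemma mixture_cdf_0: "mixture_cdf a 0 = 0"
  by (simp add: mixture_cdf_def std_normal_cdf_0)

lemma mixture_cdf_eq:
  "mixture_cdf a c = 2 * (LBINT x. mix a c x * std_normal_density x) - 1"
proof -
  have i: "integrable lborel (\<lambda>x. mix a c x * std_normal_density x)"
  proof (rule Bochner_Integration.integrable_bound)
    show "integrable lborel std_normal_density" by simp
    show "AE x in lborel. norm (mix a c x * std_normal_density x) \<le> norm (std_normal_density x)"
      using std_normal_cdf_bounds by (intro AE_I2) (simp add: abs_mult mult_left_le_one_le)
  qed measurable
  have "mixture_cdf a c = (LBINT x. 2 * (mix a c x * std_normal_density x) - std_normal_density x)"
    unfolding mixture_cdf_def by (intro Bochner_Integration.integral_cong) (auto simp: algebra_simps)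
  also have "\<dots> = 2 * (LBINT x. mix a c x * std_normal_density x) - 1"
    using i by (subst Bochner_Integration.integral_diff) auto
  finally show ?thesis .
qed

text \<open>A Slutsky argument for absolute values, with the limit known at nonnegative levels.
  Almost sure convergence of the difference gives convergence in probability, and continuity of F
  closes the gap between the levels \<open>y + e\<close> and \<open>y - e\<close>.\<close>

lemma (in prob_space) slutsky_abs:
  fixes A B :: "nat \<Rightarrow> 'a \<Rightarrow> real"
  assumes A[measurable]: "\<And>n. A n \<in> borel_measurable M" and B[measurable]: "\<And>n. B n \<in> borel_measurable M"
    and AB: "AE \<omega> in M. (\<lambda>n. A n \<omega> - B n \<omega>) \<longlonglongrightarrow> 0"
    and lim: "\<And>y. 0 \<le> y \<Longrightarrow> (\<lambda>n. prob {\<omega>\<in>space M. \<bar>A n \<omega>\<bar> \<le> y}) \<longlonglongrightarrow> F y"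
    and F: "\<And>y. isCont F y" "F 0 = 0" and y: "0 \<le> y"
  shows "(\<lambda>n. prob {\<omega>\<in>space M. \<bar>B n \<omega>\<bar> \<le> y}) \<longlonglongrightarrow> F y"
proof -
  define p where "p X n z = prob {\<omega>\<in>space M. \<bar>X n \<omega>\<bar> \<le> z}" for X :: "nat \<Rightarrow> 'a \<Rightarrow> real" and n z
  define d where "d e n = prob {\<omega>\<in>space M. e < \<bar>A n \<omega> - B n \<omega>\<bar>}" for e n
  have lim': "(\<lambda>n. p A n z) \<longlonglongrightarrow> F z" if "0 \<le> z" for z unfolding p_def by (rule lim[OF that])
  have D0: "d e \<longlonglongrightarrow> 0" if e: "0 < e" for e
  proof -
    have "(\<lambda>n. expectation (indicator {\<omega>\<in>space M. e < \<bar>A n \<omega> - B n \<omega>\<bar>} :: 'a \<Rightarrow> real)) \<longlonglongrightarrow> expectation (\<lambda>_. 0 :: real)"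
    proof (rule integral_dominated_convergence[where w="\<lambda>_. 1"])
      show "AE \<omega> in M. (\<lambda>n. indicator {\<omega>\<in>space M. e < \<bar>A n \<omega> - B n \<omega>\<bar>} \<omega> :: real) \<longlonglongrightarrow> 0"
        using AB
      proof eventually_elim
        case (elim \<omega>)
        have "\<forall>\<^sub>F n in sequentially. \<bar>A n \<omega> - B n \<omega>\<bar> < e"
          using order_tendstoD(2)[OF tendsto_rabs[OF elim]] e by simp
        then have "\<forall>\<^sub>F n in sequentially. (indicator {\<omega>\<in>space M. e < \<bar>A n \<omega> - B n \<omega>\<bar>} \<omega> :: real) = 0"
          by eventually_elim (simp add: indicator_def)
        then show ?case by (rule tendsto_eventually)
      qed
    qed (auto simp: indicator_def)
    then show ?thesis by (simp add: d_def[abs_def])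
  qed
  have up: "p B n y \<le> p A n (y + e) + d e n" for n e
  proof -
    have "p B n y \<le> prob ({\<omega>\<in>space M. \<bar>A n \<omega>\<bar> \<le> y + e} \<union> {\<omega>\<in>space M. e < \<bar>A n \<omega> - B n \<omega>\<bar>})"
      unfolding p_def by (intro finite_measure_mono) auto
    also have "\<dots> \<le> p A n (y + e) + d e n" unfolding p_def d_def by (intro measure_Un_le) auto
    finally show ?thesis .
  qed
  have lo: "p A n (y - e) - d e n \<le> p B n y" for n e
  proof -
    have "p A n (y - e) \<le> prob ({\<omega>\<in>space M. \<bar>B n \<omega>\<bar> \<le> y} \<union> {\<omega>\<in>space M. e < \<bar>A n \<omega> - B n \<omega>\<bar>})"
      unfolding p_def by (intro finite_measure_mono) auto
    also have "\<dots> \<le> p B n y + d e n" unfolding p_def d_def by (intro measure_Un_le) auto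
    finally show ?thesis by simp
  qed
  have "(\<lambda>n. p B n y) \<longlonglongrightarrow> F y"
  proof (rule order_tendstoI)
    fix l assume l: "F y < l"
    have "((\<lambda>e. F (y + e)) \<longlongrightarrow> F (y + 0)) (at_right 0)"
      by (intro isCont_tendsto_compose[OF F(1)] tendsto_intros)
    then have "\<forall>\<^sub>F e in at_right 0. F (y + e) < l" by (rule order_tendstoD(2)) (use l in simp)
    then have "\<forall>\<^sub>F e in at_right 0. F (y + e) < l \<and> 0 < e"
      using eventually_at_right_less[of 0] by eventually_elim auto
    then obtain e where e: "F (y + e) < l" "0 < e" using eventually_happens'[of "at_right (0::real)"] by auto
    have "(\<lambda>n. p A n (y + e) + d e n) \<longlonglongrightarrow> F (y + e) + 0"
      using y e by (intro tendsto_add lim' D0) auto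
    then have "\<forall>\<^sub>F n in sequentially. p A n (y + e) + d e n < l"
      by (rule order_tendstoD(2)) (use e in simp)
    then show "\<forall>\<^sub>F n in sequentially. p B n y < l"
      by eventually_elim (use up in \<open>meson le_less_trans\<close>)
  next
    fix l assume l: "l < F y"
    show "\<forall>\<^sub>F n in sequentially. l < p B n y"
    \<comment> \<open>At level 0 there is no smaller nonnegative level to compare with; there
      \<open>F 0 = 0\<close> and nonnegativity of probabilities suffice.\<close>
    proof (cases "y = 0")
      case True
      then have "l < 0" using l F(2) by simp
      then show ?thesis by (intro always_eventually allI) (simp add: p_def less_le_trans[OF _ measure_nonneg])
    next
      case False
      have "((\<lambda>e. F (y - e)) \<longlongrightarrow> F (y - 0)) (at_right 0)"
        by (intro isCont_tendsto_compose[OF F(1)] tendsto_intros)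
      then have "\<forall>\<^sub>F e in at_right 0. l < F (y - e)" by (rule order_tendstoD(1)) (use l in simp)
      moreover have "\<forall>\<^sub>F e in at_right 0. e < y"
        unfolding eventually_at_right[OF zero_less_one] using y False by (intro exI[of _ y]) auto
      ultimately have "\<forall>\<^sub>F e in at_right 0. l < F (y - e) \<and> 0 < e \<and> e < y"
        using eventually_at_right_less[of 0] by eventually_elim auto
      then obtain e where e: "l < F (y - e)" "0 < e" "e < y" using eventually_happens'[of "at_right (0::real)"] by auto
      have "(\<lambda>n. p A n (y - e) - d e n) \<longlonglongrightarrow> F (y - e) - 0"
        using y e by (intro tendsto_diff lim' D0) auto
      then have "\<forall>\<^sub>F n in sequentially. l < p A n (y - e) - d e n"
        by (rule order_tendstoD(1)) (use e in simp)
      then show ?thesis by eventually_elim (use lo in \<open>meson less_le_trans\<close>)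
    qed
  qed
  then show ?thesis by (simp add: p_def)
qed

text \<open>Reading w earlier by \<open>U powr (5 / 8)\<close> and rounding to the mesh each change
  the lag by order \<open>U powr (3 / 8)\<close>. This moves w by order 7/32, still below 1/4, so
  the exponents 5/8 and 3/8 leave the limit law unaffected.\<close>

lemma (in renewal_path) Q_lagged:
  "(\<lambda>U. Q U - \<sigma> * (w U - w (grid_time (\<sigma> / \<mu>) U (grid_index U (w (U - U powr (5 / 8))))))) \<in> o(\<lambda>U. U powr (1 / 4))"
proof -
  define a where "a = \<sigma> / \<mu>"
  define s where "s U = grid_time a U (grid_index U (w (U - U powr (5 / 8))))" for U
  have a: "0 < a" using \<sigma> \<mu> by (simp add: a_def)
  have V: "\<forall>\<^sub>F U in at_top. U - U powr (5 / 8) \<in> {0..2 * U::real}"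
  proof -
    have "\<forall>\<^sub>F U in at_top. (0::real) \<le> U - U powr (5 / 8)" by real_asymp
    then show ?thesis
      using eventually_ge_at_top[of 0] by eventually_elim (auto intro: order_trans[of _ 0])
  qed
  have floor: "\<bar>real_of_int (grid_index U x) * U powr (3 / 8) - x\<bar> \<le> U powr (3 / 8)" if "0 < U" for U x
  proof -
    have "\<bar>real_of_int (grid_index U x) - x / U powr (3 / 8)\<bar> \<le> 1" unfolding grid_index_def by linarith
    then have "\<bar>real_of_int (grid_index U x) - x / U powr (3 / 8)\<bar> * U powr (3 / 8) \<le> 1 * U powr (3 / 8)"
      by (intro mult_right_mono) auto
    moreover have "(real_of_int (grid_index U x) - x / U powr (3 / 8)) * U powr (3 / 8) =
       real_of_int (grid_index U x) * U powr (3 / 8) - x" using that by (simp add: left_diff_distrib)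
    ultimately show ?thesis by (metis abs_mult abs_of_nonneg mult_1 powr_ge_zero)
  qed
  define k where "k U = real_of_int (grid_index U (w (U - U powr (5 / 8)))) * U powr (3 / 8)" for U
  have k1: "(\<lambda>U. k U - w (U - U powr (5 / 8))) \<in> O(\<lambda>U. U powr (3 / 8))"
    unfolding k_def
    by (rule bigoI[of _ 1], rule eventually_mono[OF eventually_gt_at_top[of 0]]) (use floor in simp)
  have k2: "k \<in> O(\<lambda>U. U powr (9 / 16))"
  proof -
    have "(\<lambda>U. U powr (3 / 8)) \<in> O(\<lambda>U::real. U powr (9 / 16))" by real_asymp
    from sum_in_bigo(1)[OF landau_o.big_trans[OF k1 this] w_bigo[OF V]] show ?thesis by simp
  qed
  also have "(\<lambda>U. U powr (9 / 16)) \<in> o(\<lambda>U::real. U powr (5 / 8))" by real_asymp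
  finally have "\<forall>\<^sub>F U in at_top. norm (k U) \<le> 1 / a * norm (U powr (5 / 8))"
    using a by (intro landau_o.smallD) auto
  then have small: "\<forall>\<^sub>F U in at_top. a * \<bar>k U\<bar> \<le> U powr (5 / 8)"
    by eventually_elim (use a in \<open>simp add: field_simps\<close>)
  then have sU: "\<forall>\<^sub>F U in at_top. s U = U - a * k U"
    by eventually_elim (simp add: s_def grid_time_def k_def abs_mult mult.commute)
  have s: "\<forall>\<^sub>F U in at_top. s U \<in> {0..2 * U}"
  proof -
    have "\<forall>\<^sub>F U in at_top. U powr (5 / 8) \<le> (U::real)" by real_asymp
    then show ?thesis using sU small
    proof eventually_elim
      case (elim U)
      have "\<bar>a * k U\<bar> \<le> U" using elim a by (simp add: abs_mult)
      then show ?case using elim(2) by (simp only: abs_le_iff atLeastAtMost_iff) linarith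
    qed
  qed
  have "(\<lambda>U. w (U - U powr (5 / 8)) - w U) \<in> O(\<lambda>U. U powr (3 / 8))"
    by (rule osc_bigo[OF V eventually_in_double, of "5 / 8"]) auto
  from sum_in_bigo(1)[OF k1 this] have "(\<lambda>U. a * (k U - w U)) \<in> O(\<lambda>U. U powr (3 / 8))"
    using a by (subst landau_o.big.cmult_in_iff) auto
  moreover have "\<forall>\<^sub>F U in at_top. a * (k U - w U) = (U - a * w U) - s U"
    using sU by eventually_elim (simp add: right_diff_distrib)
  ultimately have "(\<lambda>U. (U - a * w U) - s U) \<in> O(\<lambda>U. U powr (3 / 8))"
    by (subst (asm) landau_o.big.in_cong)
  then have "(\<lambda>U. w (U - a * w U) - w (s U)) \<in> O(\<lambda>U. U powr (7 / 32))"
    by (rule osc_bigo[OF passage_asymp(2)[folded a_def] s]) auto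
  also have "(\<lambda>U. U powr (7 / 32)) \<in> o(\<lambda>U::real. U powr (1 / 4))" by real_asymp
  finally have 1: "(\<lambda>U. \<sigma> * (w (U - a * w U) - w (s U))) \<in> o(\<lambda>U. U powr (1 / 4))" by simp
  have "(\<lambda>U. U powr b) \<in> o(\<lambda>U. U powr (1 / 4))" using b by real_asymp
  with Q_asymp[folded a_def] have "(\<lambda>U. Q U - \<sigma> * (w U - w (U - a * w U))) \<in> o(\<lambda>U. U powr (1 / 4))"
    by (rule landau_o.big_small_trans)
  from sum_in_smallo(2)[OF this 1]
  have "(\<lambda>U. Q U - \<sigma> * (w U - w (U - a * w U)) - \<sigma> * (w (U - a * w U) - w (s U))) \<in> o(\<lambda>U. U powr (1 / 4))" .
  then show ?thesis unfolding s_def a_def by (simp add: algebra_simps)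
qed

section \<open>Almost sure path properties and the theorem\<close>

lemma measurable_partial_sum:
  assumes "\<And>i. Y i \<in> borel_measurable M"
  shows "partial_sum Y t \<in> borel_measurable M"
  unfolding partial_sum_def[abs_def] using assms by (intro borel_measurable_sum) auto

text \<open>The infimum is the least integer passage time if there is one, and the constant
  \<open>Inf {}\<close> otherwise; measurability thus holds without discarding a null set.\<close>

lemma measurable_first_passage:
  assumes Y: "\<And>i. Y i \<in> borel_measurable M"
  shows "first_passage Y t \<in> borel_measurable M"
proof -
  define P where "P n \<omega> \<longleftrightarrow> 1 \<le> n \<and> t < partial_sum Y (real n) \<omega>" for n :: nat and \<omega>
  have [measurable]: "Measurable.pred M (P n)" for n
    unfolding P_def[abs_def] using measurable_partial_sum[OF Y] by measurable
  have P: "P (nat \<lfloor>s\<rfloor>) \<omega>" if "1 \<le> s" "t < partial_sum Y s \<omega>" for s \<omega>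
    using that by (auto simp: P_def partial_sum_def le_nat_iff le_floor_iff)
  have "first_passage Y t \<omega> = (if \<exists>n. P n \<omega> then real (LEAST n. P n \<omega>) else Inf {})" for \<omega>
  proof (cases "\<exists>n. P n \<omega>")
    case True
    then have L: "P (LEAST n. P n \<omega>) \<omega>" by (rule LeastI_ex)
    have "real (LEAST n. P n \<omega>) \<le> s" if s: "1 \<le> s" "t < partial_sum Y s \<omega>" for s
    proof -
      have "(LEAST n. P n \<omega>) \<le> nat \<lfloor>s\<rfloor>" using P[OF s] by (rule Least_le)
      then show ?thesis using s by linarith
    qed
    then have "first_passage Y t \<omega> = real (LEAST n. P n \<omega>)"
      unfolding first_passage_def using L by (intro cInf_eq_minimum) (auto simp: P_def)
    then show ?thesis using True by simp
  next
    case False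
    then have e: "{s. 1 \<le> s \<and> t < partial_sum Y s \<omega>} = {}" using P by blast
    show ?thesis unfolding first_passage_def e using False by simp
  qed
  then have "first_passage Y t = (\<lambda>\<omega>. if \<exists>n. P n \<omega> then real (LEAST n. P n \<omega>) else Inf {})" by blast
  also have "\<dots> \<in> borel_measurable M" by measurable
  finally show ?thesis .
qed

lemma measurable_Q_process:
  assumes "\<And>i. Y i \<in> borel_measurable M"
  shows "Q_process Y \<mu> t \<in> borel_measurable M"
  unfolding Q_process_def[abs_def]
  using measurable_partial_sum[OF assms, where t=t] measurable_first_passage[OF assms, where t="\<mu> * t"] by measurable

context wiener
begin

text \<open>The case \<kappa> = 0 of \<open>modulus\<close>, where any constant with square above 2
  is admissible.\<close>

lemma crude_modulus:
  "AE \<omega> in M. \<forall>\<^sub>F U in at_top. \<forall>h\<ge>1. osc_le (\<lambda>t. W t \<omega>) U h (2 * sqrt (h * ln U))"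
proof -
  have "AE \<omega> in M. \<forall>\<^sub>F U in at_top. \<forall>h\<ge>U powr 0. osc_le (\<lambda>t. W t \<omega>) U h (2 * sqrt (h * ln U))"
    by (rule modulus) auto
  then show ?thesis
  proof eventually_elim
    case (elim \<omega>)
    then show ?case using eventually_gt_at_top[of 0] by eventually_elim (simp add: powr_zero_eq_one)
  qed
qed

lemma kiefer_path_AE:
  assumes a: "0 < a" and \<delta>: "0 < \<delta>" "\<delta> < 1 / 12"
  shows "AE \<omega> in M. kiefer_path (\<lambda>t. W t \<omega>) a \<delta>"
proof -
  have "\<delta>\<^sup>2 / 2 < 1 - (1 - \<delta>)"
  proof -
    have "\<delta> * \<delta> \<le> \<delta> * 1" using \<delta> by (intro mult_left_mono) auto
    then show ?thesis using \<delta> by (simp add: power2_eq_square)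
  qed
  then have long: "AE \<omega> in M. \<forall>\<^sub>F n in sequentially. has_steps (\<lambda>t. W t \<omega>) (1 - \<delta>) 1 \<delta> n"
    using \<delta> by (intro large_increments) auto
  have steps: "AE \<omega> in M. \<forall>\<^sub>F n in sequentially. has_steps (\<lambda>t. W t \<omega>) (1 / 2 + \<delta>) (1 - 4 * \<delta>) (sqrt (1 - 12 * \<delta>)) n"
    using \<delta> by (intro large_increments) (auto simp: field_simps)
  have sharp: "AE \<omega> in M. \<forall>\<^sub>F U in at_top. \<forall>h\<ge>U powr (1 / 2 - \<delta>). osc_le (\<lambda>t. W t \<omega>) U h (sqrt (1 + 4 * \<delta>) * sqrt (h * ln U))"
    using \<delta> by (intro modulus) auto
  show ?thesis
    using W_continuous W_0 crude_modulus sharp steps long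
    by eventually_elim (unfold kiefer_path_def, intro conjI a \<delta>)
qed

lemma kiefer_family_AE:
  assumes a: "0 < a"
  shows "AE \<omega> in M. kiefer_family (\<lambda>t. W t \<omega>) a (\<lambda>n. 1 / (real n + 13))"
proof -
  \<comment> \<open>The offset 13 keeps every parameter strictly below 1/12.\<close>
  have "AE \<omega> in M. \<forall>n. kiefer_path (\<lambda>t. W t \<omega>) a (1 / (real n + 13))"
    unfolding AE_all_countable by (intro allI kiefer_path_AE a) (auto simp: field_simps)
  then show ?thesis
  proof eventually_elim
    case (elim \<omega>)
    moreover have "(\<lambda>n. 1 / (real n + 13)) \<longlonglongrightarrow> 0" by real_asymp
    ultimately show ?case by (simp add: kiefer_family_def)
  qed
qed

text \<open>One null set for all constants: both bounds are monotone in c, so sequences of constants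
  tending to 1 from either side are enough.\<close>

lemma lil_AE:
  "AE \<omega> in M. (\<forall>c>1. \<forall>\<^sub>F U in at_top. \<forall>u\<in>{0..U}. \<bar>W u \<omega>\<bar> \<le> c * sqrt (2 * U * ln (ln U))) \<and>
     (\<forall>c. 0 < c \<longrightarrow> c < 1 \<longrightarrow> (\<exists>\<^sub>F U in at_top. c * sqrt (2 * U * ln (ln U)) \<le> W U \<omega>))"
proof -
  have "AE \<omega> in M. \<forall>n. \<forall>\<^sub>F U in at_top. \<forall>u\<in>{0..U}. \<bar>W u \<omega>\<bar> \<le> (1 + 1 / (real n + 1)) * sqrt (2 * U * ln (ln U))"
    unfolding AE_all_countable by (intro allI lil_upper) auto
  moreover have "AE \<omega> in M. \<forall>n. \<exists>\<^sub>F U in at_top. (1 - 1 / (real n + 2)) * sqrt (2 * U * ln (ln U)) \<le> W U \<omega>"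
    unfolding AE_all_countable by (intro allI lil_lower) auto
  ultimately show ?thesis
  proof eventually_elim
    case (elim \<omega>)
    have pos: "\<forall>\<^sub>F U in at_top. 0 \<le> sqrt (2 * U * ln (ln (U::real)))" by real_asymp
    show ?case
    proof (intro conjI allI impI)
      fix c :: real assume c: "1 < c"
      have "(\<lambda>n. 1 + 1 / (real n + 1)) \<longlonglongrightarrow> 1" by real_asymp
      then have "\<forall>\<^sub>F n in sequentially. 1 + 1 / (real n + 1) < c" by (rule order_tendstoD(2)[OF _ c])
      then obtain n where n: "1 + 1 / (real n + 1) < c" using eventually_happens'[of sequentially] by auto
      show "\<forall>\<^sub>F U in at_top. \<forall>u\<in>{0..U}. \<bar>W u \<omega>\<bar> \<le> c * sqrt (2 * U * ln (ln U))"
        using elim(1)[rule_format, of n] pos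
      proof eventually_elim
        case (elim U)
        have "(1 + 1 / (real n + 1)) * sqrt (2 * U * ln (ln U)) \<le> c * sqrt (2 * U * ln (ln U))"
          using n elim(2) by (intro mult_right_mono) auto
        then show ?case using elim(1) by (meson order_trans)
      qed
    next
      fix c :: real assume c: "0 < c" "c < 1"
      have "(\<lambda>n. 1 - 1 / (real n + 2)) \<longlonglongrightarrow> 1" by real_asymp
      then have "\<forall>\<^sub>F n in sequentially. c < 1 - 1 / (real n + 2)" by (rule order_tendstoD(1)[OF _ c(2)])
      then obtain n where n: "c < 1 - 1 / (real n + 2)" using eventually_happens'[of sequentially] by auto
      show "\<exists>\<^sub>F U in at_top. c * sqrt (2 * U * ln (ln U)) \<le> W U \<omega>"
        using elim(2)[rule_format, of n]
      proof (rule frequently_rev_mp)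
        show "\<forall>\<^sub>F U in at_top. (1 - 1 / (real n + 2)) * sqrt (2 * U * ln (ln U)) \<le> W U \<omega> \<longrightarrow>
            c * sqrt (2 * U * ln (ln U)) \<le> W U \<omega>"
          using pos
        proof eventually_elim
          case (elim U)
          have "c * sqrt (2 * U * ln (ln U)) \<le> (1 - 1 / (real n + 2)) * sqrt (2 * U * ln (ln U))"
            using n elim by (intro mult_right_mono) auto
          then show ?case by linarith
        qed
      qed
    qed
  qed
qed

end

theorem theorem2p1:
  fixes M :: "'a measure"
    and Y :: "nat \<Rightarrow> 'a \<Rightarrow> real"
    and W :: "real \<Rightarrow> 'a \<Rightarrow> real"
    and \<mu> \<sigma> \<beta> :: real
  assumes "prob_space M"
    and "\<And>i. Y i \<in> borel_measurable M"
    and "\<And>i. distr M borel (Y i) = distr M borel (Y 0)"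
    and "integrable M (Y 0)"
    and "integral\<^sup>L M (Y 0) = \<mu>"
    and "\<mu> > 0"
    and "integrable M (\<lambda>\<omega>. (Y 0 \<omega>)\<^sup>2)"
    and "wiener_process M W"
    and "\<sigma> > 0"
    and "\<beta> < 1/4"
    and "AE \<omega> in M.
           (\<lambda>T::real. SUP t\<in>{0..T}. \<bar>partial_sum Y t \<omega> - \<mu> * t - \<sigma> * W t \<omega>\<bar>)
             \<in> O[at_top](\<lambda>T. T powr \<beta>)"
  shows
    "(AE \<omega> in M.
        (\<lambda>T::real. Q_process Y \<mu> T \<omega>
             - \<sigma> * (zero_ext W T \<omega> - zero_ext W (T - \<sigma> / \<mu> * zero_ext W T \<omega>) \<omega>))
          \<in> o[at_top](\<lambda>T. T powr (1/4)))
     \<and>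
     (AE \<omega> in M.
        Limsup at_top (\<lambda>T::real. ereal (
            (SUP t\<in>{0..T}. \<bar>Q_process Y \<mu> (t / \<mu>) \<omega>\<bar>)
              / ((T * ln (ln T)) powr (1/4) * (ln T) powr (1/2))))
          = ereal (2 powr (1/4) * \<sigma> powr (3/2) / \<mu> powr (3/4)))
     \<and>
     (AE \<omega> in M.
        ((\<lambda>T::real.
            (SUP t\<in>{0..T}. \<bar>Q_process Y \<mu> (t / \<mu>) \<omega>\<bar>)
              / ((ln T) powr (1/2)
                   * (SUP t\<in>{0..T}. \<bar>\<mu> * first_passage Y t \<omega> - t\<bar>) powr (1/2)))
          \<longlongrightarrow> \<sigma> / \<mu> powr (1/2)) at_top)
     \<and>
     (\<forall>y\<ge>0.
        ((\<lambda>T::real. measure M {\<omega> \<in> space M. T powr (-1/4) * \<bar>Q_process Y \<mu> (T / \<mu>) \<omega>\<bar> \<le> y})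
          \<longlongrightarrow>
            2 * (LBINT x. std_normal_cdf (y * \<mu> powr (3/4) * \<sigma> powr (-3/2) * \<bar>x\<bar> powr (-1/2))
                           * std_normal_density x) - 1) at_top)"
proof -
  interpret wiener M W
    using assms(1,8) by (simp add: wiener_def wiener_axioms_def)
  note Y = assms(2) and \<mu> = assms(6) and \<sigma> = assms(9)
  define b where "b = max \<beta> (3 / 16)"
  have b: "3 / 16 \<le> b" "b < 1 / 4" "\<beta> \<le> b" using assms(10) by (auto simp: b_def)
  define a where "a = \<sigma> / \<mu>"
  have a: "0 < a" using \<sigma> \<mu> by (simp add: a_def)
  have path: "AE \<omega> in M. renewal_path (\<lambda>t. W t \<omega>) (\<lambda>i. Y i \<omega>) \<mu> \<sigma> b
      (\<lambda>t. partial_sum Y t \<omega>) (\<lambda>t. first_passage Y t \<omega>) (\<lambda>t. Q_process Y \<mu> t \<omega>)"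
    using assms(11) W_continuous W_0 crude_modulus
  proof eventually_elim
    case (elim \<omega>)
    have "(\<lambda>T. T powr \<beta>) \<in> O(\<lambda>T. T powr b)"
      using b by (intro bigoI[of _ 1] eventually_mono[OF eventually_ge_at_top[of 1]]) (simp add: powr_mono)
    with elim(1) have "(\<lambda>T. run_max (\<lambda>t. partial_sum Y t \<omega> - \<mu> * t - \<sigma> * W t \<omega>) T) \<in> O(\<lambda>T. T powr b)"
      unfolding run_max_def by (rule landau_o.big_trans)
    then show ?case
      unfolding renewal_path_def using elim \<mu> \<sigma> b
      by (simp add: partial_sum_def first_passage_def Q_process_def)
  qed
  have kiefer: "AE \<omega> in M. renewal_kiefer (\<lambda>t. W t \<omega>) (\<lambda>i. Y i \<omega>) \<mu> \<sigma> b
      (\<lambda>t. partial_sum Y t \<omega>) (\<lambda>t. first_passage Y t \<omega>) (\<lambda>t. Q_process Y \<mu> t \<omega>) (\<lambda>n. 1 / (real n + 13))"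
    using path kiefer_family_AE[OF a]
    by eventually_elim (simp add: renewal_kiefer_def a_def)
  show ?thesis
  proof (intro conjI allI impI, goal_cases)
    case 1
    show ?case
      using path
    proof eventually_elim
      case (elim \<omega>)
      then interpret renewal_path "\<lambda>t. W t \<omega>" "\<lambda>i. Y i \<omega>" \<mu> \<sigma> b
        "\<lambda>t. partial_sum Y t \<omega>" "\<lambda>t. first_passage Y t \<omega>" "\<lambda>t. Q_process Y \<mu> t \<omega>" .
      have "(\<lambda>T. T powr b) \<in> o(\<lambda>T. T powr (1 / 4))" using b by real_asymp
      with Q_asymp have "(\<lambda>T. Q_process Y \<mu> T \<omega> - \<sigma> * (W T \<omega> - W (T - \<sigma> / \<mu> * W T \<omega>) \<omega>)) \<in> o(\<lambda>T. T powr (1 / 4))"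
        by (rule landau_o.big_small_trans)
      moreover have "\<forall>\<^sub>F T in at_top. Q_process Y \<mu> T \<omega> - \<sigma> * (W T \<omega> - W (T - \<sigma> / \<mu> * W T \<omega>) \<omega>) =
         Q_process Y \<mu> T \<omega> - \<sigma> * (zero_ext W T \<omega> - zero_ext W (T - \<sigma> / \<mu> * zero_ext W T \<omega>) \<omega>)"
        using passage_asymp(2) eventually_ge_at_top[of 0]
        by eventually_elim (simp add: zero_ext_def)
      ultimately show ?case by (subst (asm) landau_o.small.in_cong)
    qed
  next
    case 2
    show ?case
      using kiefer lil_AE
    proof eventually_elim
      case (elim \<omega>)
      show ?case by (rule renewal_kiefer.limsup_value[OF elim(1)]) (use elim(2) in auto)
    qed
  next
    case 3
    show ?case
      using kiefer by eventually_elim (rule renewal_kiefer.ratio_limit)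
  next
    case (4 y)
    then have y: "0 \<le> y" .
    \<comment> \<open>With \<open>U = T / \<mu>\<close>, the event that \<sigma> times the lagged
      increment, divided by \<open>T powr (1 / 4)\<close>, is at most z in absolute value has the
      level \<open>z * \<mu> powr (1 / 4) / \<sigma>\<close> on the scale
      \<open>U powr (1 / 4)\<close> of \<open>lagged_limit\<close>.\<close>
    define F where "F z = mixture_cdf a (z * \<mu> powr (1 / 4) / \<sigma>)" for z
    have F: "isCont F z" "F 0 = 0" for z
      unfolding F_def by (intro isCont_o2[OF _ isCont_mixture_cdf] continuous_intros) (use \<sigma> in \<open>auto simp: mixture_cdf_0\<close>)
    have lim: "((\<lambda>T. prob {\<omega>\<in>space M. T powr (-1/4) * \<bar>Q_process Y \<mu> (T / \<mu>) \<omega>\<bar> \<le> y}) \<longlongrightarrow> F y) at_top"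
    \<comment> \<open>\<open>slutsky_abs\<close> is stated for sequences, so T runs along an
      arbitrary sequence tending to infinity.\<close>
    proof (rule tendsto_at_topI_sequentially)
      fix X :: "nat \<Rightarrow> real" assume X: "filterlim X at_top sequentially"
      define U where "U n = X n / \<mu>" for n
      have U: "filterlim U at_top sequentially"
        unfolding U_def using filterlim_compose[OF filterlim_divide_at_top[OF \<mu>] X] .
      have XU: "X n = \<mu> * U n" for n using \<mu> by (simp add: U_def)
      \<comment> \<open>The value 0 for \<open>U n \<le> 1\<close> makes every \<open>A n\<close>
        measurable; it is taken for finitely many n only.\<close>
      define A where "A n \<omega> = (if 1 < U n then X n powr (- 1 / 4) * (\<sigma> * lagged a (U n) \<omega>) else 0)" for n \<omega>
      define B where "B n \<omega> = X n powr (- 1 / 4) * Q_process Y \<mu> (U n) \<omega>" for n \<omega>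
      have U1: "\<forall>\<^sub>F n in sequentially. 1 < U n" using U by (rule filterlim_at_top_dense[THEN iffD1, rule_format])
      have "(\<lambda>n. prob {\<omega>\<in>space M. \<bar>B n \<omega>\<bar> \<le> y}) \<longlonglongrightarrow> F y"
      proof (rule slutsky_abs[where A=A and B=B and F=F])
        show "A n \<in> borel_measurable M" for n
          unfolding A_def[abs_def] using measurable_lagged[OF a, of "U n"] by (cases "1 < U n") auto
        show "B n \<in> borel_measurable M" for n
          unfolding B_def[abs_def] using measurable_Q_process[OF Y, where \<mu>=\<mu> and t="U n"] by measurable
        show "AE \<omega> in M. (\<lambda>n. A n \<omega> - B n \<omega>) \<longlonglongrightarrow> 0"
          using path W_0
        proof eventually_elim
          case (elim \<omega>)
          then have o: "(\<lambda>V. Q_process Y \<mu> V \<omega> - \<sigma> * lagged a V \<omega>) \<in> o(\<lambda>V. V powr (1 / 4))"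
            using renewal_path.Q_lagged[OF elim(1)] by (simp add: lagged_def a_def)
          have "((\<lambda>V. (Q_process Y \<mu> V \<omega> - \<sigma> * lagged a V \<omega>) / V powr (1 / 4)) \<longlongrightarrow> 0) at_top"
            by (rule smalloD_tendsto[OF o])
          then have "(\<lambda>n. - (\<mu> powr (- 1 / 4)) * ((Q_process Y \<mu> (U n) \<omega> - \<sigma> * lagged a (U n) \<omega>) / U n powr (1 / 4)))
              \<longlonglongrightarrow> - (\<mu> powr (- 1 / 4)) * 0"
            by (intro tendsto_mult tendsto_const filterlim_compose[OF _ U])
          moreover have "\<forall>\<^sub>F n in sequentially. - (\<mu> powr (- 1 / 4)) * ((Q_process Y \<mu> (U n) \<omega> - \<sigma> * lagged a (U n) \<omega>) / U n powr (1 / 4)) =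
              A n \<omega> - B n \<omega>"
            using U1
          proof eventually_elim
            case (elim n)
            have "X n powr (- 1 / 4) = \<mu> powr (- 1 / 4) / U n powr (1 / 4)"
              unfolding XU using elim \<mu> by (simp add: powr_mult powr_minus_divide)
            then show ?case using elim by (simp add: A_def B_def diff_divide_distrib right_diff_distrib)
          qed
          ultimately show ?case using Lim_transform_eventually by fastforce
        qed
        show "(\<lambda>n. prob {\<omega>\<in>space M. \<bar>A n \<omega>\<bar> \<le> z}) \<longlonglongrightarrow> F z" if z: "0 \<le> z" for z
        proof -
          have "((\<lambda>V. prob {\<omega>\<in>space M. \<bar>lagged a V \<omega>\<bar> \<le> z * \<mu> powr (1 / 4) / \<sigma> * V powr (1 / 4)}) \<longlongrightarrow> F z) at_top"
            unfolding F_def using z \<sigma> by (intro lagged_limit[OF a]) auto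
          from filterlim_compose[OF this U] show ?thesis
          proof (rule Lim_transform_eventually)
            show "\<forall>\<^sub>F n in sequentially. prob {\<omega>\<in>space M. \<bar>lagged a (U n) \<omega>\<bar> \<le> z * \<mu> powr (1 / 4) / \<sigma> * U n powr (1 / 4)} =
                prob {\<omega>\<in>space M. \<bar>A n \<omega>\<bar> \<le> z}"
              using U1
            proof eventually_elim
              case (elim n)
              define p where "p = \<mu> powr (1 / 4) * U n powr (1 / 4)"
              have p: "0 < p" using elim \<mu> by (simp add: p_def)
              have "X n powr (- 1 / 4) = 1 / p"
                unfolding XU p_def using elim \<mu> by (simp add: powr_mult powr_minus_divide)
              then have "\<bar>A n \<omega>\<bar> = \<sigma> * \<bar>lagged a (U n) \<omega>\<bar> / p" for \<omega>
                using elim p \<sigma> by (simp add: A_def abs_mult)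
              moreover have "(\<sigma> * l / p \<le> z) = (l \<le> z * p / \<sigma>)" for l
                using p \<sigma> by (simp add: pos_divide_le_eq pos_le_divide_eq mult.commute)
              moreover have "z * \<mu> powr (1 / 4) / \<sigma> * U n powr (1 / 4) = z * p / \<sigma>" by (simp add: p_def)
              ultimately have "\<bar>A n \<omega>\<bar> \<le> z \<longleftrightarrow> \<bar>lagged a (U n) \<omega>\<bar> \<le> z * \<mu> powr (1 / 4) / \<sigma> * U n powr (1 / 4)" for \<omega>
                by (simp only:)
              then show ?case by simp
            qed
          qed
        qed
      qed (use F y in auto)
      then show "(\<lambda>n. prob {\<omega>\<in>space M. X n powr (-1/4) * \<bar>Q_process Y \<mu> (X n / \<mu>) \<omega>\<bar> \<le> y}) \<longlonglongrightarrow> F y"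
        by (simp add: B_def U_def abs_mult)
    qed
    have e: "y * \<mu> powr (1 / 4) / \<sigma> * (a * \<bar>x\<bar>) powr (- 1 / 2) = y * \<mu> powr (3/4) * \<sigma> powr (-3/2) * \<bar>x\<bar> powr (-1/2)" for x
    proof -
      have "(a * \<bar>x\<bar>) powr (- 1 / 2) = \<sigma> powr (- 1 / 2) * \<mu> powr (1 / 2) * \<bar>x\<bar> powr (- 1 / 2)"
        using a \<sigma> \<mu> by (simp add: a_def powr_mult powr_divide powr_minus_divide)
      then have "y * \<mu> powr (1 / 4) / \<sigma> * (a * \<bar>x\<bar>) powr (- 1 / 2) =
          y * (\<mu> powr (1 / 4) * \<mu> powr (1 / 2)) * (\<sigma> powr (- 1 / 2) / \<sigma>) * \<bar>x\<bar> powr (- 1 / 2)" by simp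
      also have "\<mu> powr (1 / 4) * \<mu> powr (1 / 2) = \<mu> powr (3 / 4)" by (simp add: powr_add[symmetric])
      also have "\<sigma> powr (- 1 / 2) / \<sigma> = \<sigma> powr (- 1 / 2) / \<sigma> powr 1" using \<sigma> by simp
      also have "\<dots> = \<sigma> powr (- 3 / 2)" by (subst powr_diff[symmetric]) simp
      finally show ?thesis .
    qed
    show ?case using lim unfolding F_def mixture_cdf_eq e .
  qed
qed

end
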